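(* Let $d\geq 2$ be a fixed integer. As $n\to\infty$, the number of permutations in $\mathfrak{S}(dn)$ with no decreasing subsequence of length $d+1$ is asymptotically equal (ratio tending to $1$) to the number of involutions in $\mathfrak{S}(2dn)$ whose longest decreasing subsequence has length exactly $d$ and whose longest increasing subsequence has length exactly $2n$.
   Context: $\mathfrak{S}(m)$ denotes the symmetric group on $\{1,\dots,m\}$, with permutations viewed as words $\sigma(1)\sigma(2)\cdots\sigma(m)$ for the purpose of increasing/decreasing subsequences. An involution is a permutation $\sigma$ with $\sigma^2=\mathrm{id}$. *)

theory Defs
  imports
    Complex_Main
    "HOL-Combinatorics.Permutations"
    "HOL-Library.Sublist"
begin

definition perm_word :: "nat \<Rightarrow> (nat \<Rightarrow> nat) \<Rightarrow> nat list" where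
  "perm_word m \<sigma> = map \<sigma> [1..<Suc m]"

(* Subsequences need not be contiguous: subseq, not sublist. *)
definition increasing_subseq :: "nat list \<Rightarrow> nat list \<Rightarrow> bool" where
  "increasing_subseq xs w \<longleftrightarrow> subseq xs w \<and> sorted_wrt (<) xs"

definition decreasing_subseq :: "nat list \<Rightarrow> nat list \<Rightarrow> bool" where
  "decreasing_subseq xs w \<longleftrightarrow> subseq xs w \<and> sorted_wrt (>) xs"

(* Max is taken over a finite set, nonempty because it contains length [] = 0. *)
definition longest_increasing :: "nat list \<Rightarrow> nat" where
  "longest_increasing w = Max {length xs | xs. increasing_subseq xs w}"

definition longest_decreasing :: "nat list \<Rightarrow> nat" where
  "longest_decreasing w = Max {length xs | xs. decreasing_subseq xs w}"

definition perms_no_decreasing :: "nat \<Rightarrow> nat \<Rightarrow> (nat \<Rightarrow> nat) set" where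
  "perms_no_decreasing m k =
     {\<sigma>. \<sigma> permutes {1..m} \<and> \<not> (\<exists>xs. decreasing_subseq xs (perm_word m \<sigma>) \<and> length xs = k)}"

definition involutions_longest :: "nat \<Rightarrow> nat \<Rightarrow> nat \<Rightarrow> (nat \<Rightarrow> nat) set" where
  "involutions_longest m a b =
     {\<sigma>. \<sigma> permutes {1..m} \<and> \<sigma> \<circ> \<sigma> = id \<and>
         longest_decreasing (perm_word m \<sigma>) = a \<and> longest_increasing (perm_word m \<sigma>) = b}"

end

theory Submission
  imports Defs "Jordan_Normal_Form.Determinant" "HOL-Real_Asymp.Real_Asymp"
begin

text \<open>
  Let \<open>f(c)\<close> be the number of standard Young tableaux of shape \<open>c\<close>, encoded as lattice words of
  content \<open>c\<close>. By Robinson--Schensted, the permutations are counted by \<open>\<Sum> f(c)\<^sup>2\<close> over the partitions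
  \<open>c\<close> of \<open>dn\<close> with at most \<open>d\<close> parts. The involutions are extremal for Erdos--Szekeres and correspond
  to tableaux \<open>T\<close> of shape \<open>d \<times> 2n\<close> by \<open>\<sigma>(T(r,k)) = T(d-1-r,k)\<close>; cutting \<open>T\<close> after the entry \<open>dn\<close> turns
  their number into \<open>\<Sum> f(c) f(c')\<close>, where \<open>c'\<close> is the complement of \<open>c\<close> in the \<open>d \<times> 2n\<close> box.
  The determinantal formula gives \<open>f(c') / f(c) = \<Prod> l\<^sub>i! / (2n+d-1-l\<^sub>i)!\<close> with \<open>l\<^sub>i = c\<^sub>i + d-1-i\<close>. This
  quotient tends to 1 uniformly when all \<open>c\<^sub>i\<close> are within \<open>n\<^bsup>3/5\<^esup>\<close> of \<open>n\<close>, because the \<open>l\<^sub>i\<close> have mean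
  \<open>(2n+d-1)/2\<close>, and the remaining shapes are negligible in \<open>\<Sum> f(c)\<^sup>2\<close>.
\<close>

text \<open>The asymptotics are needed in one direction only: taking the complement is an involution
  on the shapes in the box, so \<open>\<Sum> f(c) f(c') \<le> \<Sum> f(c)^2\<close> holds for every
  \<open>n\<close> by the inequality of arithmetic and geometric means. In the quotient f(c')/f(c)
  the determinants cancel. Complementing reflects the shifted parts, l becoming 2n+d-1-l, and a
  determinant of Vandermonde type only changes its sign under a reflection of its nodes. For the
  remaining shapes crude bounds on f suffice. The multinomial bound from above and the integrality
  of the determinant from below lose a factor polynomial in n, whereas a part at distance n^(3/5)
  from n gains a factor of about exp(-n^(1/5)/4). The exponent 3/5 has to exceed 1/2, so that this
  gain beats every power of n, and to stay below 2/3, so that the relative error of reflecting a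
  factorial, of order n^(9/5)/n^2, tends to 0. The tableau of an extremal involution consists of its
  Erdos-Szekeres labels: at each position, the lengths of the longest decreasing and the longest
  increasing chain ending there.\<close>

section \<open>Row insertion on lattice words\<close>

text \<open>Words grow at the head, so the lattice condition is imposed on all suffixes.\<close>

fun ballot :: "nat list \<Rightarrow> bool" where
  "ballot [] = True"
| "ballot (x # w) = (ballot w \<and> (x = 0 \<or> count_list w x < count_list w (x - 1)))"

lemma ballot_antimono: "ballot w \<Longrightarrow> count_list w (Suc j) \<le> count_list w j"
  by (induction w) auto

lemma ballot_antimono': "ballot w \<Longrightarrow> i \<le> j \<Longrightarrow> count_list w j \<le> count_list w i"
  by (rule lift_Suc_antimono_le[of "count_list w"]) (rule ballot_antimono)

text \<open>A standard tableau is the word of the row indices of its entries, the largest entry first. Then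
  \<open>row_insert p u\<close> inserts an entry with exactly \<open>p\<close> smaller ones: it becomes a new letter 0, and each
  bumped letter \<open>k\<close> is the first \<open>k\<close> met above the previous change. The second component is the row of
  the new box.\<close>

fun row_insert :: "nat \<Rightarrow> nat list \<Rightarrow> nat list \<times> nat" where
  "row_insert p [] = ([0], 0)"
| "row_insert p (c # u) =
     (if p \<le> length u then
        let (u', k) = row_insert p u in if c = k then (Suc k # u', Suc k) else (c # u', k)
      else (0 # c # u, 0))"

text \<open>Reverse bumping. Read from the largest entry down, the first letter \<open>k\<close> is
  the end of row \<open>k\<close>; it returns to row \<open>k - 1\<close> and the search continues
  there, until in row 0 an entry is removed whose rank is the length of the rest. The default
  \<open>(0, [])\<close> is not met if row \<open>k\<close> of a lattice word ends in a
  corner.\<close>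

fun row_delete :: "nat \<Rightarrow> nat list \<Rightarrow> nat \<times> nat list" where
  "row_delete k [] = (0, [])"
| "row_delete k (c # w) =
     (if c = k then
        case k of 0 \<Rightarrow> (length w, w) | Suc j \<Rightarrow> let (p, u) = row_delete j w in (p, j # u)
      else let (p, u) = row_delete k w in (p, c # u))"

text \<open>A bump has room: row \<open>Suc k1\<close> was at most as long as row \<open>k1\<close>,
  which the insertion has just lengthened, so the letter \<open>Suc k1\<close> is admissible. A
  letter that stays keeps its count, while the count of its predecessor can only grow.\<close>

lemma row_insert_props:
  assumes "row_insert p u = (u', k)" "p \<le> length u" "ballot u"
  shows "ballot u' \<and> length u' = Suc (length u) \<and>
         (\<forall>j. count_list u' j = count_list u j + (if j = k then 1 else 0)) \<and>
         row_delete k u' = (p, u)"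
  using assms
proof (induction u arbitrary: u' k)
  case Nil
  then show ?case by auto
next
  case (Cons c u)
  show ?case
  proof (cases "p \<le> length u")
    case True
    obtain u1 k1 where 1: "row_insert p u = (u1, k1)" by fastforce
    have IH: "ballot u1" "length u1 = Suc (length u)"
      "\<And>j. count_list u1 j = count_list u j + (if j = k1 then 1 else 0)"
      "row_delete k1 u1 = (p, u)"
      using Cons.IH[OF 1 True] Cons.prems by auto
    have am: "count_list u (Suc k1) \<le> count_list u k1"
      using Cons.prems ballot_antimono by simp
    show ?thesis
    proof (cases "c = k1")
      case c: True
      have "u' = Suc k1 # u1" "k = Suc k1" using Cons.prems 1 True c by auto
      then show ?thesis using IH am c by (auto split: nat.splits)
    next
      case c: False
      have "u' = c # u1" "k = k1" using Cons.prems 1 True c by auto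
      moreover have "c = 0 \<or> count_list u c < count_list u (c - 1)" using Cons.prems by auto
      ultimately show ?thesis using IH c by auto
    qed
  next
    case False
    then show ?thesis using Cons.prems by auto
  qed
qed

text \<open>The strict inequality says that row \<open>k\<close> ends in a corner. When a head
  letter \<open>Suc j\<close> is lowered, the lattice condition at this very letter provides the
  same inequality for row \<open>j\<close> of the rest.\<close>

lemma row_delete_props:
  assumes "row_delete k w = (p, u)" "ballot w" "count_list w (Suc k) < count_list w k"
  shows "ballot u \<and> p \<le> length u \<and> row_insert p u = (w, k) \<and>
         (\<forall>j. count_list w j = count_list u j + (if j = k then 1 else 0))"
  using assms
proof (induction w arbitrary: k p u)
  case Nil
  then show ?case by auto
next
  case (Cons c w)
  have bw: "ballot w" using Cons.prems by auto
  show ?case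
  proof (cases "c = k")
    case ck: True
    show ?thesis
    proof (cases k)
      case 0
      then show ?thesis using Cons.prems ck by (cases w) auto
    next
      case (Suc j)
      obtain p1 u1 where 1: "row_delete j w = (p1, u1)" by fastforce
      have lt: "count_list w (Suc j) < count_list w j" using Cons.prems ck Suc by auto
      note IH = Cons.IH[OF 1 bw lt]
      have e: "p = p1" "u = j # u1" using Cons.prems 1 ck Suc by auto
      have "j = 0 \<or> count_list u1 j < count_list u1 (j - 1)"
      proof (cases j)
        case (Suc i)
        have "count_list w (Suc i) \<le> count_list w i" by (rule ballot_antimono[OF bw])
        then have "count_list w j \<le> count_list w i" using Suc by simp
        moreover have "count_list w j = Suc (count_list u1 j)" "count_list w i = count_list u1 i"
          using IH Suc by auto
        ultimately show ?thesis using Suc by simp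
      qed simp
      then show ?thesis using IH e ck Suc by auto
    qed
  next
    case ck: False
    obtain p1 u1 where 1: "row_delete k w = (p1, u1)" by fastforce
    have lt: "count_list w (Suc k) < count_list w k" using Cons.prems ck by (auto split: if_splits)
    note IH = Cons.IH[OF 1 bw lt]
    have e: "p = p1" "u = c # u1" using Cons.prems 1 ck by auto
    have "c = 0 \<or> count_list u1 c < count_list u1 (c - 1)"
    proof (cases c)
      case (Suc i)
      have a: "count_list w c < count_list w i" using Cons.prems Suc by auto
      have b: "count_list w c = count_list u1 c" using IH ck by auto
      show ?thesis
      \<comment> \<open>If the predecessor row of \<open>c\<close> is the one that loses a box, the
        corner hypothesis, counted with the head \<open>c = Suc k\<close>, supplies the missing
        unit.\<close>
      proof (cases "i = k")
        case True
        then have "Suc (count_list w c) < count_list w k" using Cons.prems Suc by auto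
        moreover have "count_list w k = Suc (count_list u1 k)" using IH by auto
        ultimately show ?thesis using b True Suc by simp
      next
        case False
        then have "count_list w i = count_list u1 i" using IH by auto
        then show ?thesis using a b Suc by auto
      qed
    qed simp
    then show ?thesis using IH e ck by auto
  qed
qed

text \<open>A permutation is encoded by the ranks of its letters among the letters to their right. Insertion
  therefore proceeds from right to left, which turns decreasing subsequences into increasing ones, so
  their length is read off the first row.\<close>

fun is_code :: "nat list \<Rightarrow> bool" where
  "is_code [] = True"
| "is_code (p # ps) = (p \<le> length ps \<and> is_code ps)"

fun rsk :: "nat list \<Rightarrow> nat list \<times> nat list" where
  "rsk [] = ([], [])"
| "rsk (p # ps) = (let (u, q) = rsk ps; (u', k) = row_insert p u in (u', k # q))"

lemma rsk_props:
  assumes "rsk ps = (u, q)" "is_code ps"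
  shows "ballot u \<and> ballot q \<and> length u = length ps \<and> length q = length ps \<and> count_list u = count_list q"
  using assms
proof (induction ps arbitrary: u q)
  case Nil
  then show ?case by auto
next
  case (Cons p ps)
  obtain u1 q1 where 1: "rsk ps = (u1, q1)" by fastforce
  obtain u' k where 2: "row_insert p u1 = (u', k)" by fastforce
  have IH: "ballot u1" "ballot q1" "length u1 = length ps" "length q1 = length ps"
    "count_list u1 = count_list q1" using Cons.IH[OF 1] Cons.prems by auto
  have ri: "ballot u'" "length u' = Suc (length u1)"
    "\<And>j. count_list u' j = count_list u1 j + (if j = k then 1 else 0)"
    using row_insert_props[OF 2] IH Cons.prems by auto
  have "k = 0 \<or> count_list u1 k < count_list u1 (k - 1)"
    using ballot_antimono[OF ri(1), of "k - 1"] ri(3) by (cases k) auto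
  moreover have "u = u'" "q = k # q1" using Cons.prems 1 2 by auto
  ultimately show ?case using IH ri by auto
qed

lemma rsk_inj:
  assumes "is_code ps" "is_code ps'" "rsk ps = rsk ps'"
  shows "ps = ps'"
  using assms
proof (induction ps arbitrary: ps')
  case Nil
  then have "rsk ps' = ([], [])" by simp
  from rsk_props[OF this] Nil show ?case by simp
next
  case (Cons p ps)
  obtain u0 q0 where 0: "rsk (p # ps) = (u0, q0)" by fastforce
  have "length q0 = length (p # ps)" "length q0 = length ps'"
    using rsk_props[OF 0] Cons.prems(1) 0 Cons.prems(3) rsk_props[of ps' u0 q0] Cons.prems(2) by auto
  then obtain p' ps'' where ps': "ps' = p' # ps''" by (cases ps') auto
  obtain u1 q1 where 1: "rsk ps = (u1, q1)" by fastforce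
  obtain u2 q2 where 2: "rsk ps'' = (u2, q2)" by fastforce
  obtain u1' k1 where r1: "row_insert p u1 = (u1', k1)" by fastforce
  obtain u2' k2 where r2: "row_insert p' u2 = (u2', k2)" by fastforce
  have e: "u1' = u2'" "k1 = k2" "q1 = q2" using Cons.prems ps' 1 2 r1 r2 by auto
  have "row_delete k1 u1' = (p, u1)"
    using row_insert_props[OF r1] rsk_props[OF 1] Cons.prems by auto
  moreover have "row_delete k2 u2' = (p', u2)"
    using row_insert_props[OF r2] rsk_props[OF 2] Cons.prems ps' by auto
  ultimately have "p = p'" "u1 = u2" using e by auto
  then show ?case using Cons.IH[of ps''] Cons.prems ps' 1 2 e by auto
qed

text \<open>The head of \<open>q\<close> names the box created last, and equality of contents makes
  this box a corner of \<open>u\<close>, so the last insertion can be undone.\<close>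

lemma rsk_surj:
  assumes "ballot u" "ballot q" "count_list u = count_list q" "length u = length q"
  shows "\<exists>ps. is_code ps \<and> rsk ps = (u, q)"
  using assms
proof (induction q arbitrary: u)
  case Nil
  then show ?case by (intro exI[of _ "[]"]) auto
next
  case (Cons k q)
  have "count_list q (Suc k) \<le> count_list q k" using Cons.prems ballot_antimono by auto
  then have lt: "count_list u (Suc k) < count_list u k" using Cons.prems by auto
  obtain p u1 where d: "row_delete k u = (p, u1)" by fastforce
  note rd = row_delete_props[OF d Cons.prems(1) lt]
  have l: "length u = Suc (length u1)" using row_insert_props[of p u1 u k] rd by auto
  have "count_list u1 j = count_list q j" for j
  proof -
    have "count_list u j = count_list u1 j + (if j = k then 1 else 0)" using rd by blast
    then show ?thesis using Cons.prems(3) by (auto split: if_splits)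
  qed
  then have "count_list u1 = count_list q" by blast
  then obtain ps where ps: "is_code ps" "rsk ps = (u1, q)"
    using Cons.IH[of u1] rd Cons.prems l by auto
  then have "length ps = length u1" using rsk_props[OF ps(2)] by auto
  then show ?case using ps rd by (intro exI[of _ "p # ps"]) auto
qed

lemma bij_betw_rsk:
  "bij_betw rsk {ps. is_code ps \<and> length ps = m}
     {(u, q). ballot u \<and> ballot q \<and> length u = m \<and> length q = m \<and> count_list u = count_list q}"
proof (intro bij_betw_imageI equalityI subsetI)
  show "inj_on rsk {ps. is_code ps \<and> length ps = m}"
    by (auto intro!: inj_onI rsk_inj)
next
  fix x assume "x \<in> rsk ` {ps. is_code ps \<and> length ps = m}"
  then obtain ps where ps: "x = rsk ps" "is_code ps" "length ps = m" by auto
  obtain u q where uq: "rsk ps = (u, q)" by fastforce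
  then show "x \<in> {(u, q). ballot u \<and> ballot q \<and> length u = m \<and> length q = m \<and> count_list u = count_list q}"
    using rsk_props[OF uq] ps by simp
next
  fix x :: "nat list \<times> nat list"
  assume "x \<in> {(u, q). ballot u \<and> ballot q \<and> length u = m \<and> length q = m \<and> count_list u = count_list q}"
  then obtain u q where x: "x = (u, q)" "ballot u" "ballot q" "length u = m" "length q = m"
    "count_list u = count_list q" by auto
  then obtain ps where "is_code ps" "rsk ps = (u, q)" using rsk_surj[of u q] by auto
  then show "x \<in> rsk ` {ps. is_code ps \<and> length ps = m}"
    using rsk_props[of ps u q] x by (auto intro!: image_eqI[of _ _ ps])
qed

section \<open>The first row and monotone subsequences\<close>

text \<open>The longest decreasing subsequence among the values below \<open>v\<close>.\<close>

fun code_lds :: "nat list \<Rightarrow> nat \<Rightarrow> nat" where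
  "code_lds [] v = 0"
| "code_lds (p # ps) v =
     (if v \<le> p then code_lds ps v else max (code_lds ps (v - 1)) (Suc (code_lds ps p)))"

text \<open>The smallest entries stand at the end of the word, so this is the length of the first
  row of the subtableau of the \<open>v\<close> smallest entries.\<close>

definition zeros :: "nat \<Rightarrow> nat list \<Rightarrow> nat" where
  "zeros v u = count_list (drop (length u - v) u) 0"

lemma zeros_Cons: "zeros v (c # u) = (if v \<le> length u then zeros v u else zeros (length u) u + (if c = 0 then 1 else 0))"
  by (auto simp: zeros_def Suc_diff_le)

lemma zeros_mono: "v \<le> v' \<Longrightarrow> zeros v u \<le> zeros v' u"
proof -
  assume "v \<le> v'"
  then have "length u - v = (length u - v - (length u - v')) + (length u - v')"
    by simp
  then have "drop (length u - v) u = drop (length u - v - (length u - v')) (drop (length u - v') u)"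
    by (metis drop_drop)
  then show ?thesis unfolding zeros_def
    by (metis append_take_drop_id count_list_append le_add2)
qed

text \<open>Up to rank \<open>p\<close> nothing moves. Beyond it the new 0 counts one extra until
  the first old 0 above rank \<open>p\<close> is bumped, after which the old count returns; the
  maximum expresses both, exactly as in the recursion of \<open>code_lds\<close>. The clause on
  \<open>k = 0\<close> tells whether such a 0 has been met.\<close>

lemma zeros_row_insert:
  assumes "row_insert p u = (u', k)" "p \<le> length u"
  shows "length u' = Suc (length u) \<and> (k = 0 \<longleftrightarrow> zeros (length u) u = zeros p u) \<and>
    (\<forall>v \<le> Suc (length u). zeros v u' = (if v \<le> p then zeros v u else max (zeros (v - 1) u) (Suc (zeros p u))))"
  using assms
proof (induction u arbitrary: u' k)
  case Nil
  then show ?case by (auto simp: zeros_def le_Suc_eq)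
next
  case (Cons c u)
  show ?case
  proof (cases "p \<le> length u")
    case True
    obtain u1 k1 where 1: "row_insert p u = (u1, k1)" by fastforce
    note IH = Cons.IH[OF 1 True]
    have m: "zeros p u \<le> zeros (length u) u" using True by (rule zeros_mono)
    have u': "u' = (if c = k1 then Suc k1 else c) # u1" "k = (if c = k1 then Suc k1 else k1)"
      using Cons.prems 1 True by (auto split: if_splits)
    have z: "zeros v u1 = (if v \<le> p then zeros v u else max (zeros (v - 1) u) (Suc (zeros p u)))"
      if "v \<le> Suc (length u)" for v
      using IH that by blast
    have z1: "zeros (Suc (length u)) u1 = max (zeros (length u) u) (Suc (zeros p u))"
      using z[of "Suc (length u)"] True by simp
    have k1: "k1 = 0 \<longleftrightarrow> zeros (length u) u = zeros p u" and l: "length u1 = Suc (length u)"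
      using IH by auto
    have "zeros v u' = (if v \<le> p then zeros v (c # u) else max (zeros (v - 1) (c # u)) (Suc (zeros p (c # u))))"
      if "v \<le> Suc (Suc (length u))" for v
    proof (cases "v = Suc (Suc (length u))")
      case v: True
      show ?thesis
        using True m k1 unfolding u'(1) v zeros_Cons l z1 by auto
    next
      case False
      then have "v \<le> Suc (length u)" using that by simp
      then show ?thesis using True z[of v] unfolding u'(1) zeros_Cons l by auto
    qed
    then show ?thesis using True m k1 l unfolding u' by (auto simp: zeros_Cons)
  next
    case False
    then show ?thesis using Cons.prems by (auto simp: zeros_Cons le_Suc_eq)
  qed
qed

text \<open>Schensted's theorem for the first row. The bound \<open>v\<close> is what makes the
  recursion of the subsequence lengths and that of the insertion match.\<close>

lemma rsk_zeros:
  assumes "rsk ps = (u, q)" "is_code ps" "v \<le> length ps"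
  shows "code_lds ps v = zeros v u"
  using assms
proof (induction ps arbitrary: u q v)
  case Nil
  then show ?case by (auto simp: zeros_def)
next
  case (Cons p ps)
  obtain u1 q1 where 1: "rsk ps = (u1, q1)" by fastforce
  obtain u' k where 2: "row_insert p u1 = (u', k)" by fastforce
  have l: "length u1 = length ps" using rsk_props[OF 1] Cons.prems by auto
  have "u = u'" using Cons.prems 1 2 by auto
  moreover have "p \<le> length u1" using Cons.prems l by auto
  ultimately show ?case
    using zeros_row_insert[OF 2] Cons.IH[OF 1] Cons.prems l
    by (cases v) (auto)
qed

lemma rsk_zeros_total:
  assumes "rsk ps = (u, q)" "is_code ps"
  shows "code_lds ps (length ps) = count_list u 0"
  using rsk_zeros[OF assms order.refl] rsk_props[OF assms] by (simp add: zeros_def)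

section \<open>Permutations without long decreasing subsequences\<close>

text \<open>Replaces the row index of each entry by its column index, that is, transposes the tableau.\<close>

fun conj_word :: "nat list \<Rightarrow> nat list" where
  "conj_word [] = []"
| "conj_word (x # w) = count_list w x # conj_word w"

lemma finite_count_gt: "finite {r. count_list w r > j}"
  by (rule finite_subset[of _ "set w"]) (auto intro: ccontr)

lemma count_list_conj_word: "count_list (conj_word w) j = card {r. count_list w r > j}"
proof (induction w)
  case (Cons x w)
  have "{r. count_list (x # w) r > j} = (if count_list w x = j then insert x {r. count_list w r > j} else {r. count_list w r > j})"
    by auto
  then show ?case using Cons finite_count_gt[of j w] by auto
qed auto

lemma length_conj_word [simp]: "length (conj_word w) = length w"
  by (induction w) auto

text \<open>Strictness comes from row \<open>x\<close> itself: having exactly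
  \<open>count_list w x\<close> boxes so far, it reaches the preceding column but not the new
  one.\<close>

lemma ballot_conj_word: "ballot (conj_word w)"
proof (induction w)
  case (Cons x w)
  have "card {r. count_list w r > count_list w x} < card {r. count_list w r > count_list w x - 1}"
    if "count_list w x > 0"
  proof (rule psubset_card_mono[OF finite_count_gt])
    have "x \<in> {r. count_list w r > count_list w x - 1}" "x \<notin> {r. count_list w r > count_list w x}"
      using that by auto
    moreover have "{r. count_list w r > count_list w x} \<subseteq> {r. count_list w r > count_list w x - 1}" by auto
    ultimately show "{r. count_list w r > count_list w x} \<subset> {r. count_list w r > count_list w x - 1}"
      by blast
  qed
  then show ?case using Cons by (cases "count_list w x = 0") (simp_all add: count_list_conj_word)
qed auto

lemma conj_word_conj_word: "ballot w \<Longrightarrow> conj_word (conj_word w) = w"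
proof (induction w)
  case (Cons x w)
  \<comment> \<open>When the letter \<open>x\<close> may be added, the rows above \<open>x\<close>
    are already strictly longer than row \<open>x\<close>, and the rows below are not.\<close>
  have "{r. count_list w r > count_list w x} = {..<x}"
  proof (intro equalityI subsetI)
    fix r assume "r \<in> {..<x}"
    then have "r \<le> x - 1" "x > 0" by auto
    then have "count_list w (x - 1) \<le> count_list w r" using Cons ballot_antimono' by auto
    then show "r \<in> {r. count_list w r > count_list w x}" using Cons \<open>x > 0\<close> by auto
  next
    fix r assume "r \<in> {r. count_list w r > count_list w x}"
    then show "r \<in> {..<x}" using ballot_antimono'[of w x r] Cons by (cases "r < x") auto
  qed
  then show ?case using Cons by (simp add: count_list_conj_word)
qed auto

text \<open>Column indices are bounded by the longest row, which is row 0 in a lattice word. A bound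
  on the first row thus becomes a bound on the number of rows of the transposed tableau.\<close>

lemma set_conj_word_less_iff: "ballot w \<Longrightarrow> set (conj_word w) \<subseteq> {..<d} \<longleftrightarrow> count_list w 0 \<le> d"
proof (induction w)
  case (Cons x w)
  have "count_list w (x - 1) \<le> count_list w 0" using Cons ballot_antimono' by auto
  then show ?case using Cons by (cases "x = 0") auto
qed auto

text \<open>Total functions vanishing from \<open>d\<close> on, so that the content
  \<open>count_list w\<close> of a lattice word over \<open>{..<d}\<close> is itself such a
  partition.\<close>

definition partitions :: "nat \<Rightarrow> nat \<Rightarrow> (nat \<Rightarrow> nat) set" where
  "partitions d m = {c. (\<forall>i\<ge>d. c i = 0) \<and> (\<forall>i. c (Suc i) \<le> c i) \<and> sum c {..<d} = m}"

definition ballots :: "(nat \<Rightarrow> nat) \<Rightarrow> nat list set" where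
  "ballots c = {w. ballot w \<and> count_list w = c}"

lemma finite_partitions: "finite (partitions d m)"
proof (rule finite_subset)
  show "partitions d m \<subseteq> {c. \<forall>i. (i \<in> {..<d} \<longrightarrow> c i \<in> {..m}) \<and> (i \<notin> {..<d} \<longrightarrow> c i = 0)}"
  proof (clarsimp simp: partitions_def)
    fix c :: "nat \<Rightarrow> nat" and i assume "i < d"
    then show "c i \<le> sum c {..<d}" by (intro member_le_sum) auto
  qed
qed (rule finite_set_of_finite_funs; simp)

lemma length_ballots:
  assumes "w \<in> ballots c" "\<forall>i\<ge>d. c i = 0"
  shows "set w \<subseteq> {..<d}" "length w = sum c {..<d}"
proof -
  have c: "count_list w = c" using assms by (simp add: ballots_def)
  show "set w \<subseteq> {..<d}"
  proof
    fix x assume "x \<in> set w"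
    then have "c x \<noteq> 0" unfolding c[symmetric] by (simp add: count_list_0_iff)
    then show "x \<in> {..<d}" using assms(2) by (cases "x < d") auto
  qed
  then show "length w = sum c {..<d}" using sum_count_set[of w "{..<d}"] c by simp
qed

lemma finite_ballots:
  assumes "\<forall>i\<ge>d. c i = 0" shows "finite (ballots c)"
proof (rule finite_subset)
  show "ballots c \<subseteq> {w. set w \<subseteq> {..<d} \<and> length w = sum c {..<d}}"
    using length_ballots assms by blast
qed (simp add: finite_lists_length_eq)

lemma ballot_in_partitions:
  assumes "ballot w" "set w \<subseteq> {..<d}"
  shows "count_list w \<in> partitions d (length w)"
proof -
  have "count_list w i = 0" if "i \<ge> d" for i using that assms by (auto simp: count_list_0_iff)
  then show ?thesis using assms sum_count_set[of w "{..<d}"] ballot_antimono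
    by (auto simp: partitions_def)
qed

lemma ballot_pairs_eq_Union:
  "{(u, q). ballot u \<and> ballot q \<and> length u = m \<and> count_list u = count_list q \<and> set u \<subseteq> {..<d}}
   = (\<Union>c\<in>partitions d m. ballots c \<times> ballots c)" (is "?L = ?R")
proof (intro equalityI subsetI)
  fix x assume "x \<in> ?L"
  then obtain u q where x: "x = (u, q)" "ballot u" "ballot q" "length u = m"
    "count_list u = count_list q" "set u \<subseteq> {..<d}" by auto
  then have "count_list u \<in> partitions d m" using ballot_in_partitions by blast
  then show "x \<in> ?R" using x by (auto simp: ballots_def)
next
  fix x assume "x \<in> ?R"
  then obtain c where c: "c \<in> partitions d m" "x \<in> ballots c \<times> ballots c" by auto
  then obtain u q where x: "x = (u, q)" "u \<in> ballots c" "q \<in> ballots c" by auto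
  have "set u \<subseteq> {..<d}" "length u = m"
    using length_ballots[OF x(2), of d] c by (auto simp: partitions_def)
  then show "x \<in> ?L" using x by (auto simp: ballots_def)
qed

lemma card_ballot_pairs:
  "card {(u, q). ballot u \<and> ballot q \<and> length u = m \<and> count_list u = count_list q \<and> set u \<subseteq> {..<d}}
   = (\<Sum>c\<in>partitions d m. card (ballots c) ^ 2)"
  unfolding ballot_pairs_eq_Union
proof (subst card_UN_disjoint)
  have "finite (ballots c)" if "c \<in> partitions d m" for c
    using that finite_ballots[of d c] by (auto simp: partitions_def)
  then show "\<forall>i\<in>partitions d m. finite (ballots i \<times> ballots i)" by blast
qed (auto simp: finite_partitions ballots_def card_cartesian_product power2_eq_square)

lemma bij_betw_conj_word_pairs:
  "bij_betw (map_prod conj_word conj_word)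
     {(u, q). ballot u \<and> ballot q \<and> length u = m \<and> length q = m \<and> count_list u = count_list q \<and> count_list u 0 \<le> d}
     {(u, q). ballot u \<and> ballot q \<and> length u = m \<and> count_list u = count_list q \<and> set u \<subseteq> {..<d}}"
proof (rule bij_betw_byWitness[where f' = "map_prod conj_word conj_word"])
  show "\<forall>a\<in>{(u, q). ballot u \<and> ballot q \<and> length u = m \<and> length q = m \<and> count_list u = count_list q \<and> count_list u 0 \<le> d}.
     map_prod conj_word conj_word (map_prod conj_word conj_word a) = a"
    by (auto simp: conj_word_conj_word)
  show "\<forall>a\<in>{(u, q). ballot u \<and> ballot q \<and> length u = m \<and> count_list u = count_list q \<and> set u \<subseteq> {..<d}}.
     map_prod conj_word conj_word (map_prod conj_word conj_word a) = a"
    by (auto simp: conj_word_conj_word)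
  have "count_list (conj_word u) = count_list (conj_word q)" if "count_list u = count_list q" for u q
    using that by (auto simp: count_list_conj_word fun_eq_iff)
  then show "map_prod conj_word conj_word ` {(u, q). ballot u \<and> ballot q \<and> length u = m \<and> length q = m \<and> count_list u = count_list q \<and> count_list u 0 \<le> d} \<subseteq>
    {(u, q). ballot u \<and> ballot q \<and> length u = m \<and> count_list u = count_list q \<and> set u \<subseteq> {..<d}}"
    using set_conj_word_less_iff[of _ d] by (auto simp: ballot_conj_word)
  show "map_prod conj_word conj_word ` {(u, q). ballot u \<and> ballot q \<and> length u = m \<and> count_list u = count_list q \<and> set u \<subseteq> {..<d}} \<subseteq>
    {(u, q). ballot u \<and> ballot q \<and> length u = m \<and> length q = m \<and> count_list u = count_list q \<and> count_list u 0 \<le> d}"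
  proof (clarsimp, intro conjI)
    fix u q assume *: "ballot u" "ballot q" "count_list u = count_list q" "set u \<subseteq> {..<d}" "m = length u"
    show "ballot (conj_word u)" "ballot (conj_word q)" by (rule ballot_conj_word)+
    show "count_list (conj_word u) = count_list (conj_word q)"
      using * by (auto simp: count_list_conj_word fun_eq_iff)
    show "count_list (conj_word u) 0 \<le> d"
      using set_conj_word_less_iff[of "conj_word u" d] * by (simp add: ballot_conj_word conj_word_conj_word)
    have "sum (count_list u) (set u \<union> set q) = length u" by (rule sum_count_set) auto
    moreover have "sum (count_list q) (set u \<union> set q) = length q" by (rule sum_count_set) auto
    ultimately show "length q = length u" using * by simp
  qed
qed

section \<open>Permutations and their codes\<close>

definition skip_over :: "nat \<Rightarrow> nat \<Rightarrow> nat" where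
  "skip_over p y = (if y < p then y else Suc y)"

text \<open>Inverts the code by ranks: the head takes its rank as value, and the values to its
  right, a permutation of an initial segment, are spread out so as to leave that value free.\<close>

fun decode :: "nat list \<Rightarrow> nat list" where
  "decode [] = []"
| "decode (p # ps) = p # map (skip_over p) (decode ps)"

lemma strict_mono_skip_over: "strict_mono (skip_over p)"
  by (auto simp: strict_mono_def skip_over_def)

lemma skip_over_image: "p \<le> n \<Longrightarrow> skip_over p ` {..<n} = {..<Suc n} - {p}"
proof (intro equalityI subsetI)
  fix y assume "p \<le> n" "y \<in> {..<Suc n} - {p}"
  then show "y \<in> skip_over p ` {..<n}"
    by (intro image_eqI[of _ _ "if y < p then y else y - 1"]) (auto simp: skip_over_def)
qed (auto simp: skip_over_def split: if_splits)

lemma length_decode [simp]: "length (decode ps) = length ps"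
  by (induction ps) auto

lemma decode_perm: "is_code ps \<Longrightarrow> distinct (decode ps) \<and> set (decode ps) = {..<length ps}"
proof (induction ps)
  case (Cons p ps)
  then have "p \<le> length ps" by simp
  moreover have "inj_on (skip_over p) A" for A
    using strict_mono_imp_inj_on[OF strict_mono_skip_over] by (rule inj_on_subset[of _ UNIV]) simp
  ultimately show ?case using skip_over_image[of p "length ps"] Cons
    by (auto simp: distinct_map)
qed auto

lemma decode_inj: "decode ps = decode ps' \<Longrightarrow> ps = ps'"
proof (induction ps arbitrary: ps')
  case Nil
  then show ?case by (cases ps') auto
next
  case (Cons p ps)
  then obtain ps'' where "ps' = p # ps''" by (cases ps') auto
  with Cons show ?case
    using strict_mono_imp_inj_on[OF strict_mono_skip_over, of p] by (auto simp: inj_map_eq_map)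
qed

lemma decode_surj:
  assumes "distinct xs" "set xs = {..<length xs}"
  shows "\<exists>ps. is_code ps \<and> decode ps = xs"
  using assms
proof (induction "length xs" arbitrary: xs)
  case 0
  then show ?case by (intro exI[of _ "[]"]) auto
next
  case (Suc n)
  then obtain x ys where xs: "xs = x # ys" by (cases xs) auto
  have x: "x \<le> n" using Suc xs by auto
  have sys: "set ys = skip_over x ` {..<n}" using Suc xs skip_over_image[OF x] by auto
  define zs where "zs = map (inv_into UNIV (skip_over x)) ys"
  have inj: "inj (skip_over x)" by (rule strict_mono_imp_inj_on[OF strict_mono_skip_over])
  have ys: "map (skip_over x) zs = ys"
    unfolding zs_def map_map
  proof (rule map_idI)
    fix y assume "y \<in> set ys"
    then have "y \<in> range (skip_over x)" using sys by auto
    then show "(skip_over x \<circ> inv_into UNIV (skip_over x)) y = y" by (simp add: f_inv_into_f)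
  qed
  have "set zs = {..<n}" unfolding zs_def using sys inj by (auto simp: image_image)
  moreover have "distinct zs" using ys Suc xs by (metis distinct.simps(2) distinct_map)
  moreover have "length zs = n" using xs Suc by (simp add: zs_def)
  ultimately obtain ps where "is_code ps" "decode ps = zs" using Suc.hyps(1)[of zs] by auto
  then show ?case using ys xs x \<open>length zs = n\<close> by (intro exI[of _ "x # ps"]) auto
qed

lemma bij_betw_decode:
  "bij_betw decode {ps. is_code ps \<and> length ps = m} {xs. distinct xs \<and> set xs = {..<m}}"
proof (intro bij_betw_imageI inj_onI equalityI subsetI)
  fix xs assume "xs \<in> {xs. distinct xs \<and> set xs = {..<m}}"
  then have xs: "distinct xs" "set xs = {..<m}" by auto
  then have "length xs = m" using distinct_card by force
  with xs decode_surj[of xs] show "xs \<in> decode ` {ps. is_code ps \<and> length ps = m}" by force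
qed (auto simp: decode_perm intro: decode_inj)

text \<open>The bound \<open>v\<close> closes the induction: prolonging a subsequence by a new head
  \<open>x\<close> requires the rest to lie below \<open>x\<close>.\<close>

definition dec_below :: "nat list \<Rightarrow> nat \<Rightarrow> nat \<Rightarrow> bool" where
  "dec_below xs v k \<longleftrightarrow>
     (\<exists>ys. subseq ys xs \<and> sorted_wrt (>) ys \<and> length ys = k \<and> (\<forall>y\<in>set ys. y < v))"

lemma dec_below_0 [simp]: "dec_below xs v 0"
  by (auto simp: dec_below_def)

lemma dec_below_Cons:
  "dec_below (x # xs) v (Suc k) \<longleftrightarrow> x < v \<and> dec_below xs x k \<or> dec_below xs v (Suc k)"
proof
  assume "dec_below (x # xs) v (Suc k)"
  then obtain ys where ys: "subseq ys (x # xs)" "sorted_wrt (>) ys" "length ys = Suc k" "\<forall>y\<in>set ys. y < v"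
    unfolding dec_below_def by blast
  then obtain z zs where z: "ys = z # zs" by (cases ys) auto
  show "x < v \<and> dec_below xs x k \<or> dec_below xs v (Suc k)"
  proof (cases "z = x")
    case True
    then show ?thesis using ys z unfolding dec_below_def by auto
  next
    case False
    then have "subseq ys xs" using ys z by auto
    then show ?thesis using ys unfolding dec_below_def by blast
  qed
next
  assume "x < v \<and> dec_below xs x k \<or> dec_below xs v (Suc k)"
  then show "dec_below (x # xs) v (Suc k)"
  proof
    assume "x < v \<and> dec_below xs x k"
    then obtain ys where "x < v" "subseq ys xs" "sorted_wrt (>) ys" "length ys = k" "\<forall>y\<in>set ys. y < x"
      unfolding dec_below_def by blast
    then show ?thesis unfolding dec_below_def by (intro exI[of _ "x # ys"]) auto
  next
    assume "dec_below xs v (Suc k)"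
    then show ?thesis unfolding dec_below_def by (blast intro: list_emb_Cons)
  qed
qed

lemma dec_below_map:
  assumes f: "strict_mono f" and v: "\<And>y. f y < v' \<longleftrightarrow> y < v"
  shows "dec_below (map f xs) v' k \<longleftrightarrow> dec_below xs v k"
proof
  assume "dec_below (map f xs) v' k"
  then obtain ys where ys: "subseq ys (map f xs)" "sorted_wrt (>) ys" "length ys = k" "\<forall>y\<in>set ys. y < v'"
    unfolding dec_below_def by blast
  then obtain N where "ys = map f (nths xs N)" by (auto simp: subseq_conv_nths nths_map)
  with ys v show "dec_below xs v k"
    unfolding dec_below_def
    by (intro exI[of _ "nths xs N"]) (auto simp: sorted_wrt_map strict_mono_less[OF f] subseq_conv_nths)
next
  assume "dec_below xs v k"
  then obtain ys where "subseq ys xs" "sorted_wrt (>) ys" "length ys = k" "\<forall>y\<in>set ys. y < v"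
    unfolding dec_below_def by blast
  then show "dec_below (map f xs) v' k" using v unfolding dec_below_def
    by (intro exI[of _ "map f ys"]) (auto simp: sorted_wrt_map strict_mono_less[OF f] subseq_map)
qed

lemma dec_below_decode: "dec_below (decode ps) v k \<longleftrightarrow> k \<le> code_lds ps v"
proof (induction ps arbitrary: v k)
  case Nil
  then show ?case by (auto simp: dec_below_def)
next
  case (Cons p ps)
  \<comment> \<open>For \<open>v > p\<close> the value \<open>p\<close> is one of those below
    \<open>v\<close> and is skipped, so the bound drops by one.\<close>
  have 1: "dec_below (map (skip_over p) xs) v k \<longleftrightarrow> dec_below xs (if v \<le> p then v else v - 1) k" for xs v k
    by (rule dec_below_map[OF strict_mono_skip_over]) (auto simp: skip_over_def)
  show ?case
    by (cases k) (auto simp: dec_below_Cons 1 Cons.IH le_max_iff_disj)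
qed

lemma bij_betw_perm_word:
  "bij_betw (perm_word m) {\<sigma>. \<sigma> permutes {1..m}} {w. distinct w \<and> set w = {1..m}}"
proof (intro bij_betw_imageI inj_onI equalityI subsetI)
  fix \<sigma> \<tau> assume "\<sigma> \<in> {\<sigma>. \<sigma> permutes {1..m}}" "\<tau> \<in> {\<sigma>. \<sigma> permutes {1..m}}" "perm_word m \<sigma> = perm_word m \<tau>"
  then have *: "\<sigma> permutes {1..m}" "\<tau> permutes {1..m}" "\<forall>i\<in>{1..m}. \<sigma> i = \<tau> i"
    by (auto simp: perm_word_def)
  then show "\<sigma> = \<tau>" by (metis ext permutes_not_in)
next
  fix w assume "w \<in> perm_word m ` {\<sigma>. \<sigma> permutes {1..m}}"
  then obtain \<sigma> where s: "w = perm_word m \<sigma>" "\<sigma> permutes {1..m}" by auto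
  have "set [1..<Suc m] = {1..m}" by auto
  then show "w \<in> {w. distinct w \<and> set w = {1..m}}"
    using s permutes_inj_on[OF s(2), of "{1..m}"] permutes_image[OF s(2)]
    by (auto simp: perm_word_def distinct_map simp del: upt_Suc)
next
  fix w :: "nat list" assume "w \<in> {w. distinct w \<and> set w = {1..m}}"
  then have w: "distinct w" "set w = {1..m}" by auto
  then have l: "length w = m" using distinct_card by force
  define \<sigma> where "\<sigma> = (\<lambda>i. if i \<in> {1..m} then w ! (i - 1) else i)"
  have e: "perm_word m \<sigma> = w"
    by (rule nth_equalityI) (auto simp: perm_word_def l \<sigma>_def nth_append simp del: upt_Suc)
  have "set [1..<Suc m] = {1..m}" by auto
  then have "\<sigma> ` {1..m} = {1..m}" using e w by (auto simp: perm_word_def simp del: upt_Suc)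
  moreover have "inj_on \<sigma> {1..m}"
    using \<open>\<sigma> ` {1..m} = {1..m}\<close> by (simp add: finite_surj_inj)
  ultimately have "\<sigma> permutes {1..m}"
    by (intro bij_imp_permutes) (auto simp: bij_betw_def \<sigma>_def)
  then show "w \<in> perm_word m ` {\<sigma>. \<sigma> permutes {1..m}}" using e by blast
qed

lemma bij_betw_map_Suc:
  "bij_betw (map Suc) {xs. distinct xs \<and> set xs = {..<m}} {w. distinct w \<and> set w = {1..m}}"
proof (intro bij_betw_imageI inj_onI equalityI subsetI)
  fix w :: "nat list" assume "w \<in> {w. distinct w \<and> set w = {1..m}}"
  then have w: "distinct w" "set w = {1..m}" by auto
  define xs where "xs = map (\<lambda>x. x - 1) w"
  have e: "map Suc xs = w" unfolding xs_def map_map by (rule map_idI) (use w in auto)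
  then have "Suc ` set xs = {1..m}" using w(2) by (metis set_map)
  then have "Suc ` set xs = Suc ` {..<m}" by (simp add: image_Suc_lessThan)
  then have "set xs = {..<m}" by (simp add: inj_image_eq_iff)
  moreover have "distinct xs" using w(1) e by (metis distinct_map)
  ultimately show "w \<in> map Suc ` {xs. distinct xs \<and> set xs = {..<m}}"
    by (intro image_eqI[of w "map Suc" xs]) (simp_all only: e mem_Collect_eq conj_absorb simp_thms)
next
  fix w assume "w \<in> map Suc ` {xs. distinct xs \<and> set xs = {..<m}}"
  then obtain xs where "w = map Suc xs" "distinct xs" "set xs = {..<m}" by blast
  then show "w \<in> {w. distinct w \<and> set w = {1..m}}"
    by (simp add: distinct_map image_Suc_lessThan)
next
  fix xs ys :: "nat list" assume "map Suc xs = map Suc ys"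
  then show "xs = ys" by (simp add: inj_map_eq_map)
qed

text \<open>Insertion bounds the first row by \<open>d\<close>; transposing both tableaux turns this
  into at most \<open>d\<close> rows, which is what \<open>partitions d m\<close> describes.\<close>

theorem card_perms_no_decreasing:
  "card (perms_no_decreasing m (Suc d)) = (\<Sum>c\<in>partitions d m. card (ballots c) ^ 2)"
proof -
  let ?C = "{ps. is_code ps \<and> length ps = m}"
  let ?W = "{w. distinct w \<and> set w = {1..m}}"
  have bw: "bij_betw (map Suc \<circ> decode) ?C ?W"
    by (rule bij_betw_trans[OF bij_betw_decode bij_betw_map_Suc])
  have P: "(\<exists>xs. decreasing_subseq xs ((map Suc \<circ> decode) ps) \<and> length xs = Suc d) \<longleftrightarrow> Suc d \<le> code_lds ps m"
    if "ps \<in> ?C" for ps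
  proof -
    \<comment> \<open>All letters are at most \<open>m\<close>, so the bound \<open>Suc m\<close>
      imposes nothing.\<close>
    have "(\<exists>xs. decreasing_subseq xs (map Suc (decode ps)) \<and> length xs = Suc d)
       \<longleftrightarrow> dec_below (map Suc (decode ps)) (Suc m) (Suc d)"
    proof -
      have "y < Suc m" if "subseq xs (map Suc (decode ps))" "y \<in> set xs" for xs y
      proof -
        have "y \<in> set (map Suc (decode ps))" using that by (auto simp: subseq_conv_nths dest: in_set_nthsD)
        then show ?thesis using \<open>ps \<in> ?C\<close> decode_perm[of ps] by auto
      qed
      then show ?thesis unfolding dec_below_def decreasing_subseq_def by blast
    qed
    also have "\<dots> \<longleftrightarrow> dec_below (decode ps) m (Suc d)"
      by (rule dec_below_map) (auto simp: strict_mono_def)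
    finally show ?thesis by (simp add: dec_below_decode)
  qed
  have "card (perms_no_decreasing m (Suc d)) =
      card {w \<in> ?W. \<not> (\<exists>xs. decreasing_subseq xs w \<and> length xs = Suc d)}"
  proof (rule bij_betw_same_card)
    have "perm_word m ` perms_no_decreasing m (Suc d) =
        {w \<in> perm_word m ` {\<sigma>. \<sigma> permutes {1..m}}. \<not> (\<exists>xs. decreasing_subseq xs w \<and> length xs = Suc d)}"
      unfolding perms_no_decreasing_def by blast
    moreover have "inj_on (perm_word m) (perms_no_decreasing m (Suc d))"
      using bij_betw_imp_inj_on[OF bij_betw_perm_word[of m]]
      by (rule inj_on_subset) (auto simp: perms_no_decreasing_def)
    ultimately show "bij_betw (perm_word m) (perms_no_decreasing m (Suc d))
        {w \<in> ?W. \<not> (\<exists>xs. decreasing_subseq xs w \<and> length xs = Suc d)}"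
      using bij_betw_imp_surj_on[OF bij_betw_perm_word[of m]] by (simp add: bij_betw_def)
  qed
  also have "\<dots> = card {ps \<in> ?C. code_lds ps m \<le> d}"
  proof (rule bij_betw_same_card[symmetric])
    have "(map Suc \<circ> decode) ` {ps \<in> ?C. code_lds ps m \<le> d} =
       {w \<in> (map Suc \<circ> decode) ` ?C. \<not> (\<exists>xs. decreasing_subseq xs w \<and> length xs = Suc d)}"
      using P not_less_eq_eq by blast
    moreover have "inj_on (map Suc \<circ> decode) {ps \<in> ?C. code_lds ps m \<le> d}"
      using bij_betw_imp_inj_on[OF bw] by (rule inj_on_subset) auto
    ultimately show "bij_betw (map Suc \<circ> decode) {ps \<in> ?C. code_lds ps m \<le> d}
        {w \<in> ?W. \<not> (\<exists>xs. decreasing_subseq xs w \<and> length xs = Suc d)}"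
      using bij_betw_imp_surj_on[OF bw] by (simp add: bij_betw_def del: o_apply)
  qed
  also have "\<dots> = card {(u, q). ballot u \<and> ballot q \<and> length u = m \<and> length q = m
      \<and> count_list u = count_list q \<and> count_list u 0 \<le> d}" (is "_ = card ?P")
  proof (rule bij_betw_same_card)
    let ?Q = "{(u, q). ballot u \<and> ballot q \<and> length u = m \<and> length q = m \<and> count_list u = count_list q}"
    have "code_lds ps m = count_list (fst (rsk ps)) 0" if "ps \<in> ?C" for ps
      using rsk_zeros_total[of ps "fst (rsk ps)" "snd (rsk ps)"] that by simp
    then have "rsk ` {ps \<in> ?C. code_lds ps m \<le> d} = {x \<in> rsk ` ?C. count_list (fst x) 0 \<le> d}"
      by auto
    also have "rsk ` ?C = ?Q" using bij_betw_rsk[of m] by (simp add: bij_betw_def)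
    finally have "rsk ` {ps \<in> ?C. code_lds ps m \<le> d} = ?P" by auto
    moreover have "inj_on rsk {ps \<in> ?C. code_lds ps m \<le> d}"
      using bij_betw_imp_inj_on[OF bij_betw_rsk[of m]] by (rule inj_on_subset) auto
    ultimately show "bij_betw rsk {ps \<in> ?C. code_lds ps m \<le> d} ?P"
      by (simp add: bij_betw_def)
  qed
  also have "\<dots> = (\<Sum>c\<in>partitions d m. card (ballots c) ^ 2)"
    using bij_betw_same_card[OF bij_betw_conj_word_pairs] by (simp add: card_ballot_pairs)
  finally show ?thesis .
qed

section \<open>Extremal involutions\<close>

definition chain_on :: "(nat \<Rightarrow> nat \<Rightarrow> bool) \<Rightarrow> (nat \<Rightarrow> nat) \<Rightarrow> nat set \<Rightarrow> bool" where
  "chain_on R \<sigma> S \<longleftrightarrow> (\<forall>x\<in>S. \<forall>y\<in>S. x < y \<longrightarrow> R (\<sigma> x) (\<sigma> y))"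

text \<open>Sets of positions replace subsequences from here on, because chains will be united,
  intersected and mapped by the involution.\<close>

lemma subseq_perm_word_lengths:
  "{length xs | xs. subseq xs (perm_word m \<sigma>) \<and> sorted_wrt R xs}
     = card ` {S. S \<subseteq> {1..m} \<and> chain_on R \<sigma> S}" (is "?L = ?R")
proof (intro equalityI subsetI)
  fix k assume "k \<in> ?L"
  then obtain xs where xs: "subseq xs (perm_word m \<sigma>)" "sorted_wrt R xs" "k = length xs" by auto
  then obtain N where N: "xs = map \<sigma> (nths [1..<Suc m] N)"
    by (auto simp: subseq_conv_nths perm_word_def nths_map)
  define ys where "ys = nths [1..<Suc m] N"
  have ys: "sorted_wrt (<) ys" "set ys \<subseteq> {1..m}" "subseq ys [1..<Suc m]"
    unfolding ys_def
    by (auto simp: subseq_conv_nths dest!: in_set_nthsD simp del: upt_Suc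
        intro!: strict_sorted_iff[THEN iffD2] sorted_nths distinct_nthsI)
  have s: "sorted_wrt (\<lambda>x y. R (\<sigma> x) (\<sigma> y)) ys"
    using xs(2) N by (simp add: ys_def sorted_wrt_map)
  have "R (\<sigma> x) (\<sigma> y)" if xy: "x \<in> set ys" "y \<in> set ys" "x < y" for x y
  proof -
    obtain i j where ij: "i < length ys" "j < length ys" "x = ys ! i" "y = ys ! j"
      using xy by (metis in_set_conv_nth)
    have "i < j"
      using sorted_wrt_nth_less[OF ys(1), of j i] ij xy(3) by (metis linorder_neqE_nat order_less_asym)
    then show ?thesis using sorted_wrt_nth_less[OF s, of i j] ij by simp
  qed
  then have "chain_on R \<sigma> (set ys)" by (simp add: chain_on_def)
  moreover have "k = card (set ys)"
    using ys(1) xs(3) N by (simp add: distinct_card strict_sorted_iff ys_def del: upt_Suc)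
  ultimately show "k \<in> ?R" using ys(2) by blast
next
  fix k assume "k \<in> ?R"
  then obtain S where S: "S \<subseteq> {1..m}" "chain_on R \<sigma> S" "k = card S" by auto
  then have fin: "finite S" by (auto intro: finite_subset)
  let ?ys = "sorted_list_of_set S"
  have "sorted_wrt (\<lambda>x y. R (\<sigma> x) (\<sigma> y)) ?ys"
    using S(2) fin by (intro sorted_wrt_mono_rel[OF _ strict_sorted_list_of_set]) (auto simp: chain_on_def)
  moreover have "subseq ?ys [1..<Suc m]"
    using S fin by (intro sorted_subset_imp_subseq) (auto simp del: upt_Suc)
  then have "subseq (map \<sigma> ?ys) (perm_word m \<sigma>)"
    unfolding perm_word_def by (rule subseq_map)
  ultimately show "k \<in> ?L" using S(3) fin
    by (auto simp: sorted_wrt_map intro!: exI[of _ "map \<sigma> ?ys"])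
qed

lemma Max_subseq_eq_iff:
  "Max {length xs | xs. subseq xs (perm_word m \<sigma>) \<and> sorted_wrt R xs} = k \<longleftrightarrow>
     (\<exists>S \<subseteq> {1..m}. chain_on R \<sigma> S \<and> card S = k) \<and> (\<forall>S \<subseteq> {1..m}. chain_on R \<sigma> S \<longrightarrow> card S \<le> k)"
proof -
  have "finite (card ` {S. S \<subseteq> {1..m} \<and> chain_on R \<sigma> S})" by auto
  moreover have "chain_on R \<sigma> {}" by (simp add: chain_on_def)
  then have "card ` {S. S \<subseteq> {1..m} \<and> chain_on R \<sigma> S} \<noteq> {}" by blast
  ultimately show ?thesis
    unfolding subseq_perm_word_lengths by (subst Max_eq_iff) auto
qed

lemma involutions_longest_iff:
  "\<sigma> \<in> involutions_longest m a b \<longleftrightarrow> \<sigma> permutes {1..m} \<and> (\<forall>i. \<sigma> (\<sigma> i) = i) \<and>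
     (\<exists>S \<subseteq> {1..m}. chain_on (>) \<sigma> S \<and> card S = a) \<and> (\<forall>S \<subseteq> {1..m}. chain_on (>) \<sigma> S \<longrightarrow> card S \<le> a) \<and>
     (\<exists>S \<subseteq> {1..m}. chain_on (<) \<sigma> S \<and> card S = b) \<and> (\<forall>S \<subseteq> {1..m}. chain_on (<) \<sigma> S \<longrightarrow> card S \<le> b)"
  unfolding involutions_longest_def longest_increasing_def longest_decreasing_def
    increasing_subseq_def decreasing_subseq_def
  by (auto simp: Max_subseq_eq_iff fun_eq_iff)

definition longest_to :: "(nat \<Rightarrow> nat \<Rightarrow> bool) \<Rightarrow> (nat \<Rightarrow> nat) \<Rightarrow> nat \<Rightarrow> nat" where
  "longest_to R \<sigma> i = Max (card ` {S. S \<subseteq> {1..i} \<and> i \<in> S \<and> chain_on R \<sigma> S})"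

lemma longest_to_ge:
  assumes "S \<subseteq> {1..i}" "i \<in> S" "chain_on R \<sigma> S" shows "card S \<le> longest_to R \<sigma> i"
  unfolding longest_to_def by (rule Max_ge) (use assms in auto)

lemma longest_to_attained:
  assumes "1 \<le> i"
  obtains S where "S \<subseteq> {1..i}" "i \<in> S" "chain_on R \<sigma> S" "card S = longest_to R \<sigma> i"
proof -
  have "{i} \<in> {S. S \<subseteq> {1..i} \<and> i \<in> S \<and> chain_on R \<sigma> S}" using assms by (auto simp: chain_on_def)
  then have "card ` {S. S \<subseteq> {1..i} \<and> i \<in> S \<and> chain_on R \<sigma> S} \<noteq> {}" by blast
  moreover have "finite (card ` {S. S \<subseteq> {1..i} \<and> i \<in> S \<and> chain_on R \<sigma> S})" by auto
  ultimately have "longest_to R \<sigma> i \<in> card ` {S. S \<subseteq> {1..i} \<and> i \<in> S \<and> chain_on R \<sigma> S}"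
    unfolding longest_to_def by (rule Max_in[rotated])
  then show ?thesis using that by auto
qed

lemma longest_to_pos: "1 \<le> i \<Longrightarrow> 1 \<le> longest_to R \<sigma> i"
  using longest_to_ge[of "{i}" i R \<sigma>] by (auto simp: chain_on_def)

text \<open>A longest chain ending at \<open>x\<close> can be prolonged by \<open>y\<close>;
  transitivity carries the relation from \<open>x\<close> to the earlier members.\<close>

lemma longest_to_less:
  assumes R: "transp R" and xy: "1 \<le> x" "x < y" "R (\<sigma> x) (\<sigma> y)"
  shows "longest_to R \<sigma> x < longest_to R \<sigma> y"
proof -
  obtain S where S: "S \<subseteq> {1..x}" "x \<in> S" "chain_on R \<sigma> S" "card S = longest_to R \<sigma> x"
    using longest_to_attained[OF xy(1)] by metis
  have "R (\<sigma> z) (\<sigma> y)" if "z \<in> S" for z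
  proof (cases "z = x")
    case False
    then have "R (\<sigma> z) (\<sigma> x)" using S that by (force simp: chain_on_def)
    then show ?thesis using xy(3) R by (meson transpD)
  qed (use xy in simp)
  moreover have "y \<notin> S" using S(1) xy(2) by auto
  moreover have "\<forall>z\<in>S. z < y" using S(1) xy(2) by auto
  ultimately have "chain_on R \<sigma> (insert y S)" using S(3) by (auto simp: chain_on_def)
  moreover have "insert y S \<subseteq> {1..y}" using S(1) xy by auto
  ultimately have "card (insert y S) \<le> longest_to R \<sigma> y" by (intro longest_to_ge) auto
  moreover have "card (insert y S) = Suc (card S)"
    using \<open>y \<notin> S\<close> finite_subset[OF S(1)] by simp
  ultimately show ?thesis using S(4) by simp
qed

text \<open>Inverses of standard tableaux of shape \<open>d \<times> b\<close>: the entry \<open>i\<close> is sent to its cell.\<close>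

definition grid_labellings :: "nat \<Rightarrow> nat \<Rightarrow> (nat \<Rightarrow> nat \<times> nat) set" where
  "grid_labellings d b = {g. bij_betw g {1..d * b} ({..<d} \<times> {..<b}) \<and>
     (\<forall>i\<in>{1..d * b}. \<forall>j\<in>{1..d * b}. fst (g i) \<le> fst (g j) \<and> snd (g i) \<le> snd (g j) \<longrightarrow> i \<le> j) \<and>
     (\<forall>i. i \<notin> {1..d * b} \<longrightarrow> g i = (0, 0))}"

text \<open>The row is the decreasing label and the column the increasing one, both lowered by 1
  because chain lengths start at 1. The default \<open>(0, 0)\<close> agrees with
  \<open>grid_labellings\<close>, where it makes a labelling determined by its values on the
  entries.\<close>

definition cell_of :: "nat \<Rightarrow> (nat \<Rightarrow> nat) \<Rightarrow> nat \<Rightarrow> nat \<times> nat" where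
  "cell_of m \<sigma> i = (if i \<in> {1..m} then (longest_to (>) \<sigma> i - 1, longest_to (<) \<sigma> i - 1) else (0, 0))"

text \<open>For \<open>j < i\<close> the values at the two positions compare one way or the other,
  so one of the two labels grows strictly from \<open>j\<close> to \<open>i\<close>. This gives the
  order condition, and injectivity with it.\<close>

lemma cell_of_in_labellings:
  assumes "\<sigma> \<in> involutions_longest (d * b) d b"
  shows "cell_of (d * b) \<sigma> \<in> grid_labellings d b"
proof -
  let ?m = "d * b" let ?g = "cell_of ?m \<sigma>"
  have perm: "\<sigma> permutes {1..?m}" using assms by (simp add: involutions_longest_iff)
  have D: "longest_to (>) \<sigma> i \<le> d" if i: "i \<in> {1..?m}" for i
  proof -
    obtain S where S: "S \<subseteq> {1..i}" "i \<in> S" "chain_on (>) \<sigma> S" "card S = longest_to (>) \<sigma> i"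
      using longest_to_attained[of i "(>)" \<sigma>] i unfolding atLeastAtMost_iff by blast
    moreover have "S \<subseteq> {1..?m}" using S(1) i by auto
    moreover have "\<forall>S \<subseteq> {1..?m}. chain_on (>) \<sigma> S \<longrightarrow> card S \<le> d"
      using assms unfolding involutions_longest_iff by blast
    ultimately show ?thesis by metis
  qed
  have I: "longest_to (<) \<sigma> i \<le> b" if i: "i \<in> {1..?m}" for i
  proof -
    obtain S where S: "S \<subseteq> {1..i}" "i \<in> S" "chain_on (<) \<sigma> S" "card S = longest_to (<) \<sigma> i"
      using longest_to_attained[of i "(<)" \<sigma>] i unfolding atLeastAtMost_iff by blast
    moreover have "S \<subseteq> {1..?m}" using S(1) i by auto
    moreover have "\<forall>S \<subseteq> {1..?m}. chain_on (<) \<sigma> S \<longrightarrow> card S \<le> b"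
      using assms unfolding involutions_longest_iff by blast
    ultimately show ?thesis by metis
  qed
  have pos: "1 \<le> longest_to R \<sigma> i" if "i \<in> {1..?m}" for i R using that longest_to_pos by auto
  have ord: "i \<le> j"
    if "i \<in> {1..?m}" "j \<in> {1..?m}" "fst (?g i) \<le> fst (?g j)" "snd (?g i) \<le> snd (?g j)" for i j
  proof (rule ccontr)
    assume "\<not> i \<le> j"
    then have ji: "j < i" by simp
    then have "\<sigma> j \<noteq> \<sigma> i" using permutes_inj[OF perm] by (auto dest: injD)
    then consider "\<sigma> j < \<sigma> i" | "\<sigma> j > \<sigma> i" by linarith
    then show False
    proof cases
      case 1
      then have "longest_to (<) \<sigma> j < longest_to (<) \<sigma> i"
        using that ji by (intro longest_to_less) (auto simp: transp_def)
      then show False using that pos[of j "(<)"] by (simp add: cell_of_def)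
    next
      case 2
      then have "longest_to (>) \<sigma> j < longest_to (>) \<sigma> i"
        using that ji by (intro longest_to_less) (auto simp: transp_def)
      then show False using that pos[of j "(>)"] by (simp add: cell_of_def)
    qed
  qed
  have inj: "inj_on ?g {1..?m}"
  proof (rule inj_onI)
    fix i j assume "i \<in> {1..?m}" "j \<in> {1..?m}" "?g i = ?g j"
    then show "i = j" using ord[of i j] ord[of j i] by simp
  qed
  have sub: "?g ` {1..?m} \<subseteq> {..<d} \<times> {..<b}"
  proof (rule image_subsetI)
    fix i assume i: "i \<in> {1..?m}"
    then show "?g i \<in> {..<d} \<times> {..<b}"
      using D[OF i] I[OF i] pos[OF i, of "(<)"] pos[OF i, of "(>)"] by (auto simp: cell_of_def)
  qed
  \<comment> \<open>Extremality enters here: \<open>d * b\<close> distinct labels lie in a box of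
    \<open>d * b\<close> cells, so every cell is taken.\<close>
  have "?g ` {1..?m} = {..<d} \<times> {..<b}"
    by (rule card_subset_eq[OF _ sub]) (simp_all only: card_image[OF inj], simp_all)
  then have "bij_betw ?g {1..?m} ({..<d} \<times> {..<b})" using inj by (simp only: bij_betw_def)
  moreover have "\<forall>i. i \<notin> {1..?m} \<longrightarrow> ?g i = (0, 0)" unfolding cell_of_def by meson
  ultimately show ?thesis using ord unfolding grid_labellings_def by blast
qed

section \<open>The effect of an involution on its labels\<close>

definition flip_row :: "nat \<Rightarrow> nat \<times> nat \<Rightarrow> nat \<times> nat" where
  "flip_row d c = (d - 1 - fst c, snd c)"

text \<open>The graph of an involution is symmetric in the diagonal, and this reflection preserves
  both increasing and decreasing sets of points.\<close>

lemma chain_on_involution_image: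
  assumes R: "R = (<) \<or> R = (>)" and inv: "\<And>i. \<sigma> (\<sigma> i) = (i::nat)" and S: "chain_on R \<sigma> S"
  shows "chain_on R \<sigma> (\<sigma> ` S)"
proof -
  have "R (\<sigma> (\<sigma> x)) (\<sigma> (\<sigma> y))" if "x \<in> S" "y \<in> S" "\<sigma> x < \<sigma> y" for x y
  proof -
    have "x < y \<Longrightarrow> R (\<sigma> x) (\<sigma> y)" "y < x \<Longrightarrow> R (\<sigma> y) (\<sigma> x)"
      using S that by (auto simp: chain_on_def)
    moreover have "x \<noteq> y" using that(3) by auto
    ultimately show ?thesis using that(3) R unfolding inv by (auto simp: neq_iff)
  qed
  then show ?thesis unfolding chain_on_def by blast
qed

text \<open>Reflection in the diagonal keeps the last point of an increasing chain last. It
  exchanges the ends of a decreasing chain, which is why the other label is flipped instead.\<close>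

lemma longest_inc_involution:
  assumes perm: "\<sigma> permutes {1..m}" and inv: "\<And>i. \<sigma> (\<sigma> i) = i" and i: "i \<in> {1..m}"
  shows "longest_to (<) \<sigma> (\<sigma> i) = longest_to (<) \<sigma> i"
proof -
  have le: "longest_to (<) \<sigma> i \<le> longest_to (<) \<sigma> (\<sigma> i)" if i: "i \<in> {1..m}" for i
  proof -
    obtain S where S: "S \<subseteq> {1..i}" "i \<in> S" "chain_on (<) \<sigma> S" "card S = longest_to (<) \<sigma> i"
      using longest_to_attained[of i "(<)" \<sigma>] i unfolding atLeastAtMost_iff by blast
    have "\<sigma> x \<in> {1..\<sigma> i}" if "x \<in> S" for x
    proof -
      have "x \<in> {1..m}" "x \<le> i" using S(1) that i by auto
      then have "\<sigma> x \<in> {1..m}" using permutes_in_image[OF perm] by blast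
      moreover have "\<sigma> x \<le> \<sigma> i"
        using S(2,3) that \<open>x \<le> i\<close> by (cases "x = i") (auto simp: chain_on_def less_imp_le)
      ultimately show ?thesis by auto
    qed
    then have "\<sigma> ` S \<subseteq> {1..\<sigma> i}" by blast
    moreover have "chain_on (<) \<sigma> (\<sigma> ` S)" using inv S(3) by (intro chain_on_involution_image) auto
    ultimately have "card (\<sigma> ` S) \<le> longest_to (<) \<sigma> (\<sigma> i)" using S(2) by (intro longest_to_ge) auto
    moreover have "card (\<sigma> ` S) = card S"
      by (rule card_image) (metis inj_onI inv)
    ultimately show ?thesis using S(4) by simp
  qed
  have "\<sigma> i \<in> {1..m}" using permutes_in_image[OF perm] i by blast
  from le[OF i] le[OF this] show ?thesis by (simp add: inv)
qed

lemma cell_of_involution: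
  assumes \<sigma>: "\<sigma> \<in> involutions_longest (d * b) d b" and i: "i \<in> {1..d * b}"
  shows "cell_of (d * b) \<sigma> (\<sigma> i) = flip_row d (cell_of (d * b) \<sigma> i)"
proof -
  let ?m = "d * b" let ?g = "cell_of ?m \<sigma>"
  have perm: "\<sigma> permutes {1..?m}" and inv: "\<And>i. \<sigma> (\<sigma> i) = i"
    using \<sigma> by (auto simp: involutions_longest_iff)
  have \<sigma>i: "\<sigma> i \<in> {1..?m}" using permutes_in_image[OF perm] i by blast
  have inj: "inj_on \<sigma> A" for A by (metis inj_onI inv)
  note g = cell_of_in_labellings[OF \<sigma>]
  then have bij: "bij_betw ?g {1..?m} ({..<d} \<times> {..<b})"
    and ord: "\<And>i j. i \<in> {1..?m} \<Longrightarrow> j \<in> {1..?m} \<Longrightarrow> fst (?g i) \<le> fst (?g j) \<Longrightarrow> snd (?g i) \<le> snd (?g j) \<Longrightarrow> i \<le> j"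
    unfolding grid_labellings_def by blast+
  have pos: "1 \<le> longest_to R \<sigma> i" if "i \<in> {1..?m}" for i R using that longest_to_pos by auto
  \<comment> \<open>A decreasing chain ending at \<open>i\<close> and the image of one ending at
    \<open>\<sigma> i\<close>, which starts at \<open>i\<close>, join to a decreasing chain and
    share only \<open>i\<close>. Its size is at most \<open>d\<close>.\<close>
  have le: "longest_to (>) \<sigma> i + longest_to (>) \<sigma> (\<sigma> i) \<le> Suc d"
  proof -
    obtain S where S: "S \<subseteq> {1..i}" "i \<in> S" "chain_on (>) \<sigma> S" "card S = longest_to (>) \<sigma> i"
      using longest_to_attained[of i "(>)" \<sigma>] i unfolding atLeastAtMost_iff by blast
    obtain S' where S': "S' \<subseteq> {1..\<sigma> i}" "\<sigma> i \<in> S'" "chain_on (>) \<sigma> S'" "card S' = longest_to (>) \<sigma> (\<sigma> i)"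
      using longest_to_attained[of "\<sigma> i" "(>)" \<sigma>] \<sigma>i unfolding atLeastAtMost_iff by blast
    have c': "chain_on (>) \<sigma> (\<sigma> ` S')" using inv S'(3) by (intro chain_on_involution_image) auto
    have ge: "i \<le> x" if x: "x \<in> \<sigma> ` S'" for x
    proof -
      obtain y where y: "y \<in> S'" "x = \<sigma> y" using x by blast
      show ?thesis
      proof (cases "y = \<sigma> i")
        case False
        then have "y < \<sigma> i" using S'(1) y(1) by force
        then have "\<sigma> y > \<sigma> (\<sigma> i)" using S'(2,3) y(1) unfolding chain_on_def by blast
        then show ?thesis using inv[of i] y(2) by simp
      qed (simp add: y inv)
    qed
    have sub: "\<sigma> ` S' \<subseteq> {1..?m}"
    proof (rule image_subsetI)
      fix y assume "y \<in> S'"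
      then have "y \<in> {1..?m}" using S'(1) \<sigma>i by auto
      then show "\<sigma> y \<in> {1..?m}" using permutes_in_image[OF perm] by blast
    qed
    have iS': "i \<in> \<sigma> ` S'" using S'(2) inv by (metis image_eqI)
    have "\<sigma> x > \<sigma> y" if "x \<in> S" "y \<in> \<sigma> ` S'" "x < y" for x y
    proof -
      have "x \<le> i" "i \<le> y" using that S(1) ge by auto
      then have "x = i \<or> \<sigma> x > \<sigma> i" "y = i \<or> \<sigma> i > \<sigma> y"
        using S(2,3) c' iS' that unfolding chain_on_def by (auto simp: le_less)
      then show ?thesis using that(3) by auto
    qed
    moreover have "\<not> y < x" if "x \<in> S" "y \<in> \<sigma> ` S'" for x y
      using that S(1) ge[of y] by auto
    ultimately have "chain_on (>) \<sigma> (S \<union> \<sigma> ` S')" using S(3) c' unfolding chain_on_def by blast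
    moreover have "S \<union> \<sigma> ` S' \<subseteq> {1..?m}" using S(1) sub i by auto
    ultimately have "card (S \<union> \<sigma> ` S') \<le> d" using \<sigma> unfolding involutions_longest_iff by blast
    moreover have "S \<inter> \<sigma> ` S' = {i}"
    proof -
      have "x = i" if "x \<in> S" "x \<in> \<sigma> ` S'" for x
        using ge[OF that(2)] S(1) that(1) by auto
      then show ?thesis using S(2) iS' by blast
    qed
    moreover have "finite S" "finite S'" using S(1) S'(1) by (auto intro: finite_subset)
    ultimately show ?thesis using card_Un_Int[of S "\<sigma> ` S'"] S(4) S'(4) card_image[OF inj, of S'] by simp
  qed
  have ge: "longest_to (>) \<sigma> i + longest_to (>) \<sigma> (\<sigma> i) \<ge> Suc d"
  proof -
    \<comment> \<open>The entries in the column of \<open>i\<close> from its own row downwards.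
      Every cell is occupied, and equal increasing labels force a decreasing chain; it starts at
      \<open>i\<close>, so its image ends at \<open>\<sigma> i\<close>.\<close>
    define C where "C = {j \<in> {1..?m}. snd (?g j) = snd (?g i) \<and> fst (?g i) \<le> fst (?g j)}"
    have iC: "i \<in> C" using i by (simp add: C_def)
    have gi: "fst (?g i) < d" "snd (?g i) < b" using bij_betw_apply[OF bij i] by (simp_all add: mem_Times_iff)
    have "?g ` C = {fst (?g i)..<d} \<times> {snd (?g i)}"
    proof (intro equalityI subsetI)
      fix c assume "c \<in> ?g ` C"
      then obtain j where j: "j \<in> C" "c = ?g j" by blast
      then have "?g j \<in> {..<d} \<times> {..<b}" using bij_betw_apply[OF bij, of j] by (simp add: C_def)
      then show "c \<in> {fst (?g i)..<d} \<times> {snd (?g i)}"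
        using j by (simp add: C_def mem_Times_iff)
    next
      fix c assume c: "c \<in> {fst (?g i)..<d} \<times> {snd (?g i)}"
      then have "c \<in> {..<d} \<times> {..<b}" using gi by (auto simp: mem_Times_iff)
      then obtain j where "j \<in> {1..?m}" "c = ?g j" using bij_betw_imp_surj_on[OF bij] by blast
      then show "c \<in> ?g ` C" using c by (intro image_eqI[of _ _ j]) (simp_all add: C_def mem_Times_iff)
    qed
    moreover have "inj_on ?g C" using bij by (auto simp: bij_betw_def C_def intro: inj_on_subset)
    ultimately have cC: "card C = d - fst (?g i)"
      using card_image[of ?g C] by (simp add: card_cartesian_product)
    have "chain_on (>) \<sigma> C"
    proof -
      have "\<sigma> x > \<sigma> y" if "x \<in> C" "y \<in> C" "x < y" for x y
      proof (rule ccontr)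
        assume "\<not> \<sigma> x > \<sigma> y"
        moreover have "\<sigma> x \<noteq> \<sigma> y" using inv that(3) by (metis less_irrefl)
        ultimately have "longest_to (<) \<sigma> x < longest_to (<) \<sigma> y"
          using that by (intro longest_to_less) (auto simp: transp_def C_def)
        then show False using that pos[of x "(<)"] by (auto simp: C_def cell_of_def)
      qed
      then show ?thesis by (simp add: chain_on_def)
    qed
    then have "chain_on (>) \<sigma> (\<sigma> ` C)" using inv by (intro chain_on_involution_image) auto
    moreover have "\<sigma> ` C \<subseteq> {1..\<sigma> i}"
    proof (rule image_subsetI)
      fix x assume x: "x \<in> C"
      then have "i \<le> x" using ord[of i x] i by (auto simp: C_def)
      then have "\<sigma> x \<le> \<sigma> i" using \<open>chain_on (>) \<sigma> C\<close> x iC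
        by (cases "x = i") (auto simp: chain_on_def less_imp_le)
      then show "\<sigma> x \<in> {1..\<sigma> i}" using permutes_in_image[OF perm, of x] x by (auto simp: C_def)
    qed
    ultimately have "card (\<sigma> ` C) \<le> longest_to (>) \<sigma> (\<sigma> i)" using iC by (intro longest_to_ge) auto
    moreover have "card (\<sigma> ` C) = card C" by (rule card_image[OF inj])
    ultimately show ?thesis using gi i cC pos[OF i, of "(>)"] by (auto simp: cell_of_def)
  qed
  show ?thesis
    using le ge i \<sigma>i longest_inc_involution[OF perm inv i] pos[OF i, of "(>)"] pos[OF \<sigma>i, of "(>)"]
    by (auto simp: cell_of_def flip_row_def)
qed

section \<open>From a labelling back to an involution\<close>

definition involution_of :: "nat \<Rightarrow> nat \<Rightarrow> (nat \<Rightarrow> nat \<times> nat) \<Rightarrow> nat \<Rightarrow> nat" where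
  "involution_of d b g i =
     (if i \<in> {1..d * b} then inv_into {1..d * b} g (flip_row d (g i)) else i)"

context
  fixes d b m :: nat and g :: "nat \<Rightarrow> nat \<times> nat" and \<sigma> :: "nat \<Rightarrow> nat"
  assumes g: "g \<in> grid_labellings d b"
  defines "m \<equiv> d * b" and "\<sigma> \<equiv> involution_of d b g"
begin

lemma labelling_bij: "bij_betw g {1..m} ({..<d} \<times> {..<b})"
  and labelling_order: "\<And>i j. i \<in> {1..m} \<Longrightarrow> j \<in> {1..m} \<Longrightarrow> fst (g i) \<le> fst (g j) \<Longrightarrow> snd (g i) \<le> snd (g j) \<Longrightarrow> i \<le> j"
  using g unfolding grid_labellings_def m_def by blast+

lemma labelling_range: "i \<in> {1..m} \<Longrightarrow> fst (g i) < d \<and> snd (g i) < b"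
  using bij_betw_apply[OF labelling_bij, of i] by (simp add: mem_Times_iff)

lemma labelling_inj: "i \<in> {1..m} \<Longrightarrow> j \<in> {1..m} \<Longrightarrow> g i = g j \<Longrightarrow> i = j"
  using bij_betw_imp_inj_on[OF labelling_bij] by (auto dest: inj_onD)

lemma involution_of_props:
  assumes "i \<in> {1..m}" shows "\<sigma> i \<in> {1..m}" "g (\<sigma> i) = flip_row d (g i)"
proof -
  have "flip_row d (g i) \<in> g ` {1..m}"
    using labelling_range[OF assms] labelling_bij by (auto simp: flip_row_def bij_betw_def)
  moreover have "\<sigma> i = inv_into {1..m} g (flip_row d (g i))"
    using assms by (simp add: \<sigma>_def involution_of_def m_def)
  ultimately show "\<sigma> i \<in> {1..m}" "g (\<sigma> i) = flip_row d (g i)"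
    using inv_into_into f_inv_into_f by metis+
qed

lemma involution_of_involution: "\<sigma> (\<sigma> i) = i"
proof (cases "i \<in> {1..m}")
  case True
  have "g (\<sigma> (\<sigma> i)) = g i"
    using involution_of_props[OF True] involution_of_props(2)[of "\<sigma> i"] labelling_range[OF True] by (auto simp: flip_row_def prod_eq_iff)
  then show ?thesis using labelling_inj involution_of_props True by metis
qed (auto simp: \<sigma>_def involution_of_def m_def)

lemma involution_of_permutes: "\<sigma> permutes {1..m}"
proof (rule bij_imp_permutes)
  show "bij_betw \<sigma> {1..m} {1..m}"
    by (rule bij_betw_byWitness[where f' = \<sigma>]) (use involution_of_props involution_of_involution in auto)
qed (auto simp: \<sigma>_def involution_of_def m_def)

text \<open>If the row did not grow, the column would, since the labelling respects the order of
  cells. Flipping the rows then puts the cell of \<open>\<sigma> x\<close> weakly above and to the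
  left of that of \<open>\<sigma> y\<close>, which forces
  \<open>\<sigma> x \<le> \<sigma> y\<close>.\<close>

lemma involution_of_descent:
  assumes "x \<in> {1..m}" "y \<in> {1..m}" "x < y" "\<sigma> x > \<sigma> y" shows "fst (g x) < fst (g y)"
proof (rule ccontr)
  assume *: "\<not> ?thesis"
  then have "snd (g x) < snd (g y)" using labelling_order[OF assms(2,1)] assms(3) by linarith
  then have "fst (g (\<sigma> x)) \<le> fst (g (\<sigma> y))" "snd (g (\<sigma> x)) \<le> snd (g (\<sigma> y))"
    using * by (simp_all add: involution_of_props(2)[OF assms(1)] involution_of_props(2)[OF assms(2)] flip_row_def)
  then have "\<sigma> x \<le> \<sigma> y" by (rule labelling_order[OF involution_of_props(1)[OF assms(1)] involution_of_props(1)[OF assms(2)]])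
  then show False using assms by simp
qed

lemma involution_of_ascent:
  assumes "x \<in> {1..m}" "y \<in> {1..m}" "x < y" "\<sigma> x < \<sigma> y" shows "snd (g x) < snd (g y)"
proof (rule ccontr)
  assume *: "\<not> ?thesis"
  then have "fst (g x) < fst (g y)" using labelling_order[OF assms(2,1)] assms(3) by linarith
  then have "fst (g (\<sigma> y)) \<le> fst (g (\<sigma> x))" "snd (g (\<sigma> y)) \<le> snd (g (\<sigma> x))"
    using * by (simp_all add: involution_of_props(2)[OF assms(1)] involution_of_props(2)[OF assms(2)] flip_row_def)
  then have "\<sigma> y \<le> \<sigma> x" by (rule labelling_order[OF involution_of_props(1)[OF assms(2)] involution_of_props(1)[OF assms(1)]])
  then show False using assms by simp
qed

lemma involution_of_neq: "x \<noteq> y \<Longrightarrow> \<sigma> x \<noteq> \<sigma> y"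
  using involution_of_involution by metis

lemma column_chain:
  assumes S: "S \<subseteq> {1..m}" "\<And>x y. x \<in> S \<Longrightarrow> y \<in> S \<Longrightarrow> snd (g x) = snd (g y)"
  shows "chain_on (>) \<sigma> S"
proof -
  have "\<sigma> x > \<sigma> y" if "x \<in> S" "y \<in> S" "x < y" for x y
  proof -
    have "x \<in> {1..m}" "y \<in> {1..m}" using S(1) that by auto
    then show ?thesis using involution_of_ascent[of x y] involution_of_neq[of x y] S(2)[OF that(1,2)] that(3) by linarith
  qed
  then show ?thesis by (simp add: chain_on_def)
qed

lemma row_chain:
  assumes S: "S \<subseteq> {1..m}" "\<And>x y. x \<in> S \<Longrightarrow> y \<in> S \<Longrightarrow> fst (g x) = fst (g y)"
  shows "chain_on (<) \<sigma> S"
proof -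
  have "\<sigma> x < \<sigma> y" if "x \<in> S" "y \<in> S" "x < y" for x y
  proof -
    have "x \<in> {1..m}" "y \<in> {1..m}" using S(1) that by auto
    then show ?thesis using involution_of_descent[of x y] involution_of_neq[of x y] S(2)[OF that(1,2)] that(3) by linarith
  qed
  then show ?thesis by (simp add: chain_on_def)
qed

lemma labelling_card_preimage:
  assumes "A \<subseteq> {..<d} \<times> {..<b}" shows "card {x \<in> {1..m}. g x \<in> A} = card A"
proof -
  have "g ` {x \<in> {1..m}. g x \<in> A} = g ` {1..m} \<inter> A" by blast
  then have "g ` {x \<in> {1..m}. g x \<in> A} = A" using bij_betw_imp_surj_on[OF labelling_bij] assms by auto
  moreover have "inj_on g {x \<in> {1..m}. g x \<in> A}" using labelling_inj by (intro inj_onI) auto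
  ultimately show ?thesis by (metis card_image)
qed

text \<open>Rows grow strictly along a decreasing chain, by \<open>involution_of_descent\<close>. A
  variable bound \<open>k\<close> serves the whole box as well as chains that end at a given
  cell.\<close>

lemma dec_chain_card:
  assumes S: "S \<subseteq> {1..m}" "chain_on (>) \<sigma> S" "\<And>x. x \<in> S \<Longrightarrow> fst (g x) < k"
  shows "card S \<le> k"
proof -
  have "inj_on (\<lambda>x. fst (g x)) S"
  proof (rule inj_onI, rule ccontr)
    fix x y assume *: "x \<in> S" "y \<in> S" "fst (g x) = fst (g y)" "x \<noteq> y"
    have lt: "fst (g x) < fst (g y)" if "x \<in> S" "y \<in> S" "x < y" for x y
      using that S(1,2) by (intro involution_of_descent) (auto simp: chain_on_def)
    show False using lt[of x y] lt[of y x] * by linarith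
  qed
  then have "card S \<le> card {..<k}" using S(3) by (intro card_inj_on_le) auto
  then show ?thesis by simp
qed

lemma inc_chain_card:
  assumes S: "S \<subseteq> {1..m}" "chain_on (<) \<sigma> S" "\<And>x. x \<in> S \<Longrightarrow> snd (g x) < k"
  shows "card S \<le> k"
proof -
  have "inj_on (\<lambda>x. snd (g x)) S"
  proof (rule inj_onI, rule ccontr)
    fix x y assume *: "x \<in> S" "y \<in> S" "snd (g x) = snd (g y)" "x \<noteq> y"
    have lt: "snd (g x) < snd (g y)" if "x \<in> S" "y \<in> S" "x < y" for x y
      using that S(1,2) by (intro involution_of_ascent) (auto simp: chain_on_def)
    show False using lt[of x y] lt[of y x] * by linarith
  qed
  then have "card S \<le> card {..<k}" using S(3) by (intro card_inj_on_le) auto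
  then show ?thesis by simp
qed

lemma involution_of_in_involutions:
  assumes "0 < d" "0 < b"
  shows "\<sigma> \<in> involutions_longest m d b"
proof -
  have "chain_on (>) \<sigma> {x \<in> {1..m}. g x \<in> {..<d} \<times> {0}}"
    by (rule column_chain) (auto simp: mem_Times_iff)
  moreover have "card {x \<in> {1..m}. g x \<in> {..<d} \<times> {0}} = card ({..<d} \<times> {0::nat})"
    by (rule labelling_card_preimage) (use assms(1,2) in blast)
  moreover have "card ({..<d} \<times> {0::nat}) = d" by (simp add: card_cartesian_product)
  ultimately have 1: "\<exists>S\<subseteq>{1..m}. chain_on (>) \<sigma> S \<and> card S = d"
    by (intro exI[of _ "{x \<in> {1..m}. g x \<in> {..<d} \<times> {0}}"]) auto
  have "chain_on (<) \<sigma> {x \<in> {1..m}. g x \<in> {0} \<times> {..<b}}"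
    by (rule row_chain) (auto simp: mem_Times_iff)
  moreover have "card {x \<in> {1..m}. g x \<in> {0} \<times> {..<b}} = card ({0::nat} \<times> {..<b})"
    by (rule labelling_card_preimage) (use assms(1,2) in blast)
  moreover have "card ({0::nat} \<times> {..<b}) = b" by (simp add: card_cartesian_product)
  ultimately have 2: "\<exists>S\<subseteq>{1..m}. chain_on (<) \<sigma> S \<and> card S = b"
    by (intro exI[of _ "{x \<in> {1..m}. g x \<in> {0} \<times> {..<b}}"]) auto
  have "card S \<le> d" if "S \<subseteq> {1..m}" "chain_on (>) \<sigma> S" for S
    using dec_chain_card[OF that] labelling_range that(1) by blast
  moreover have "card S \<le> b" if "S \<subseteq> {1..m}" "chain_on (<) \<sigma> S" for S
    using inc_chain_card[OF that] labelling_range that(1) by blast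
  ultimately show ?thesis using 1 2 involution_of_permutes involution_of_involution by (simp add: involutions_longest_iff)
qed

text \<open>A decreasing chain ending at \<open>i\<close> meets each row at most once and stays in
  rows up to that of \<open>g i\<close>, which bounds the label from above; the column of
  \<open>g i\<close> down to this cell attains the bound. Increasing chains are treated in the same
  way with rows and columns exchanged.\<close>

lemma cell_of_involution_of: "cell_of m \<sigma> = g"
proof
  fix i show "cell_of m \<sigma> i = g i"
  proof (cases "i \<in> {1..m}")
    case False
    have "\<forall>i. i \<notin> {1..d * b} \<longrightarrow> g i = (0, 0)"
      using g unfolding grid_labellings_def mem_Collect_eq by (elim conjE)
    then have "g i = (0, 0)" using False unfolding m_def by blast
    moreover have "cell_of m \<sigma> i = (0, 0)" unfolding cell_of_def using False by (rule if_not_P)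
    ultimately show ?thesis by simp
  next
    case True
    then have i: "1 \<le> i" "i \<le> m" by auto
    have "longest_to (>) \<sigma> i \<le> Suc (fst (g i))"
    proof -
      obtain S where S: "S \<subseteq> {1..i}" "i \<in> S" "chain_on (>) \<sigma> S" "card S = longest_to (>) \<sigma> i"
        using longest_to_attained[OF i(1), of "(>)" \<sigma>] by metis
      have Sm: "S \<subseteq> {1..m}" using S(1) i by auto
      have "fst (g x) < Suc (fst (g i))" if "x \<in> S" for x
      proof (cases "x = i")
        case False
        moreover have "x \<le> i" using S(1) that by auto
        ultimately have "x < i" by simp
        moreover from this have "\<sigma> x > \<sigma> i" using S(2,3) that unfolding chain_on_def by blast
        ultimately have "fst (g x) < fst (g i)" using involution_of_descent[of x i] Sm that True by blast
        then show ?thesis by simp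
      qed simp
      then show ?thesis using dec_chain_card[OF Sm S(3)] S(4) by auto
    qed
    moreover have "longest_to (<) \<sigma> i \<le> Suc (snd (g i))"
    proof -
      obtain S where S: "S \<subseteq> {1..i}" "i \<in> S" "chain_on (<) \<sigma> S" "card S = longest_to (<) \<sigma> i"
        using longest_to_attained[OF i(1), of "(<)" \<sigma>] by metis
      have Sm: "S \<subseteq> {1..m}" using S(1) i by auto
      have "snd (g x) < Suc (snd (g i))" if "x \<in> S" for x
      proof (cases "x = i")
        case False
        moreover have "x \<le> i" using S(1) that by auto
        ultimately have "x < i" by simp
        moreover from this have "\<sigma> x < \<sigma> i" using S(2,3) that unfolding chain_on_def by blast
        ultimately have "snd (g x) < snd (g i)" using involution_of_ascent[of x i] Sm that True by blast
        then show ?thesis by simp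
      qed simp
      then show ?thesis using inc_chain_card[OF Sm S(3)] S(4) by auto
    qed
    moreover have "Suc (fst (g i)) \<le> longest_to (>) \<sigma> i"
    proof -
      let ?A = "{..fst (g i)} \<times> {snd (g i)}" let ?S = "{x \<in> {1..m}. g x \<in> ?A}"
      have "chain_on (>) \<sigma> ?S" by (rule column_chain) (auto simp: mem_Times_iff)
      moreover have "?S \<subseteq> {1..i}" using labelling_order[of _ i] True by (auto simp: mem_Times_iff)
      moreover have "i \<in> ?S" using True by (auto simp: mem_Times_iff)
      ultimately have "card ?S \<le> longest_to (>) \<sigma> i" by (intro longest_to_ge)
      moreover have "card ?S = card ?A" using labelling_range[OF True] by (intro labelling_card_preimage) auto
      ultimately show ?thesis by (simp add: card_cartesian_product)
    qed
    moreover have "Suc (snd (g i)) \<le> longest_to (<) \<sigma> i"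
    proof -
      let ?A = "{fst (g i)} \<times> {..snd (g i)}" let ?S = "{x \<in> {1..m}. g x \<in> ?A}"
      have "chain_on (<) \<sigma> ?S" by (rule row_chain) (auto simp: mem_Times_iff)
      moreover have "?S \<subseteq> {1..i}" using labelling_order[of _ i] True by (auto simp: mem_Times_iff)
      moreover have "i \<in> ?S" using True by (auto simp: mem_Times_iff)
      ultimately have "card ?S \<le> longest_to (<) \<sigma> i" by (intro longest_to_ge)
      moreover have "card ?S = card ?A" using labelling_range[OF True] by (intro labelling_card_preimage) auto
      ultimately show ?thesis by (simp add: card_cartesian_product)
    qed
    ultimately show ?thesis using True by (simp add: cell_of_def prod_eq_iff)
  qed
qed

end

lemma bij_betw_cell_of:
  assumes "0 < d" "0 < b"
  shows "bij_betw (cell_of (d * b)) (involutions_longest (d * b) d b) (grid_labellings d b)"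
proof (intro bij_betw_imageI inj_onI equalityI subsetI)
  fix \<sigma> \<tau> assume *: "\<sigma> \<in> involutions_longest (d * b) d b" "\<tau> \<in> involutions_longest (d * b) d b"
    "cell_of (d * b) \<sigma> = cell_of (d * b) \<tau>"
  let ?g = "cell_of (d * b) \<sigma>"
  have perm: "\<sigma> permutes {1..d * b}" "\<tau> permutes {1..d * b}" using * by (auto simp: involutions_longest_iff)
  have inj: "inj_on ?g {1..d * b}"
    using cell_of_in_labellings[OF *(1)] bij_betw_imp_inj_on unfolding grid_labellings_def by blast
  show "\<sigma> = \<tau>"
  proof
    fix i show "\<sigma> i = \<tau> i"
    proof (cases "i \<in> {1..d * b}")
      case True
      \<comment> \<open>Both involutions send \<open>i\<close> to the entry in the flipped cell of
        one and the same labelling.\<close>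
      have "?g (\<sigma> i) = ?g (\<tau> i)"
        using cell_of_involution[OF *(1) True] cell_of_involution[OF *(2) True] unfolding *(3) by metis
      moreover have "\<sigma> i \<in> {1..d * b}" "\<tau> i \<in> {1..d * b}"
        using True permutes_in_image[OF perm(1)] permutes_in_image[OF perm(2)] by blast+
      ultimately show ?thesis by (rule inj_onD[OF inj])
    next
      case False
      then show ?thesis using permutes_not_in[OF perm(1)] permutes_not_in[OF perm(2)] by metis
    qed
  qed
next
  fix g assume "g \<in> grid_labellings d b"
  then show "g \<in> cell_of (d * b) ` involutions_longest (d * b) d b"
    using involution_of_in_involutions[of g d b] cell_of_involution_of[of g d b, symmetric] assms by (intro image_eqI)
qed (use cell_of_in_labellings in auto)

section \<open>Labellings of a rectangle as lattice words\<close>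

lemma count_list_rev_map:
  "count_list (rev (map f [1..<Suc t])) r = card {i \<in> {1..t}. f i = r}"
proof (induction t)
  case (Suc t)
  have "{i \<in> {1..Suc t}. f i = r} =
      (if f (Suc t) = r then insert (Suc t) {i \<in> {1..t}. f i = r} else {i \<in> {1..t}. f i = r})"
    by (auto simp: le_Suc_eq)
  with Suc show ?case by simp
qed simp

lemma rev_map_upt_Suc: "rev (map f [1..<Suc (Suc t)]) = f (Suc t) # rev (map f [1..<Suc t])"
  by simp

text \<open>The largest entry stands at the head, so the suffixes of the word are the initial
  segments \<open>{1..t}\<close> of the entries.\<close>

lemma ballot_rev_map_iff:
  "ballot (rev (map f [1..<Suc m])) \<longleftrightarrow>
     (\<forall>t\<le>m. \<forall>r. card {i \<in> {1..t}. f i = Suc r} \<le> card {i \<in> {1..t}. f i = r})"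
proof (induction m)
  case (Suc m)
  have A: "ballot (rev (map f [1..<Suc (Suc m)])) \<longleftrightarrow> ballot (rev (map f [1..<Suc m])) \<and>
      (f (Suc m) = 0 \<or> count_list (rev (map f [1..<Suc m])) (f (Suc m)) < count_list (rev (map f [1..<Suc m])) (f (Suc m) - 1))"
    unfolding rev_map_upt_Suc by simp
  have B: "count_list (rev (map f [1..<Suc (Suc m)])) r
      = count_list (rev (map f [1..<Suc m])) r + (if f (Suc m) = r then 1 else 0)" for r
    unfolding rev_map_upt_Suc by simp
  show ?case
  proof
    assume b: "ballot (rev (map f [1..<Suc (Suc m)]))"
    then have "count_list (rev (map f [1..<Suc (Suc m)])) (Suc r) \<le> count_list (rev (map f [1..<Suc (Suc m)])) r" for r
      by (rule ballot_antimono)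
    then have "card {i \<in> {1..Suc m}. f i = Suc r} \<le> card {i \<in> {1..Suc m}. f i = r}" for r
      by (simp only: count_list_rev_map)
    moreover have "\<forall>t\<le>m. \<forall>r. card {i \<in> {1..t}. f i = Suc r} \<le> card {i \<in> {1..t}. f i = r}"
      using A b Suc by blast
    ultimately show "\<forall>t\<le>Suc m. \<forall>r. card {i \<in> {1..t}. f i = Suc r} \<le> card {i \<in> {1..t}. f i = r}"
      unfolding le_Suc_eq by blast
  next
    assume h: "\<forall>t\<le>Suc m. \<forall>r. card {i \<in> {1..t}. f i = Suc r} \<le> card {i \<in> {1..t}. f i = r}"
    then have 1: "ballot (rev (map f [1..<Suc m]))" using Suc le_SucI by blast
    have "count_list (rev (map f [1..<Suc (Suc m)])) (Suc r) \<le> count_list (rev (map f [1..<Suc (Suc m)])) r" for r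
      unfolding count_list_rev_map using h by blast
    then have h1: "count_list (rev (map f [1..<Suc m])) (Suc r) + (if f (Suc m) = Suc r then 1 else 0)
        \<le> count_list (rev (map f [1..<Suc m])) r + (if f (Suc m) = r then 1 else 0)" for r
      unfolding B .
    have "count_list (rev (map f [1..<Suc m])) (Suc r) < count_list (rev (map f [1..<Suc m])) r"
      if "f (Suc m) = Suc r" for r
    proof -
      have "x < y" if "x + (if F = Suc r then 1 else 0) \<le> y + (if F = r then 1 else 0)" "F = Suc r"
        for x y F :: nat using that by simp
      from this[OF h1 that] show ?thesis .
    qed
    then have "f (Suc m) = 0 \<or> count_list (rev (map f [1..<Suc m])) (f (Suc m)) < count_list (rev (map f [1..<Suc m])) (f (Suc m) - 1)"
      by (cases "f (Suc m)") (simp_all del: upt_Suc)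
    with 1 A show "ballot (rev (map f [1..<Suc (Suc m)]))" by blast
  qed
qed auto

definition rect :: "nat \<Rightarrow> nat \<Rightarrow> nat \<Rightarrow> nat" where
  "rect d b r = (if r < d then b else 0)"

definition word_of :: "nat \<Rightarrow> (nat \<Rightarrow> nat \<times> nat) \<Rightarrow> nat list" where
  "word_of m g = rev (map (\<lambda>i. fst (g i)) [1..<Suc m])"

lemma labelling_word:
  assumes g: "g \<in> grid_labellings d b"
  shows "word_of (d * b) g \<in> ballots (rect d b)"
proof -
  let ?X = "{1..d * b}"
  note bij = labelling_bij[OF g] note ord = labelling_order[OF g] note range = labelling_range[OF g]
  have "card {i \<in> {1..t}. fst (g i) = Suc r} \<le> card {i \<in> {1..t}. fst (g i) = r}"
    if t: "t \<le> d * b" for t r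
  proof -
    \<comment> \<open>The entry in the cell directly above that of \<open>i\<close>. It is smaller
      than \<open>i\<close>, so it also belongs to \<open>{1..t}\<close>.\<close>
    define \<phi> where "\<phi> i = inv_into ?X g (r, snd (g i))" for i
    have \<phi>: "\<phi> i \<in> ?X" "g (\<phi> i) = (r, snd (g i))" "\<phi> i \<le> i"
      if i: "i \<in> ?X" "fst (g i) = Suc r" for i
    proof -
      have "(r, snd (g i)) \<in> g ` ?X"
        unfolding bij_betw_imp_surj_on[OF bij] using range[OF i(1)] i(2) by simp
      then show 1: "\<phi> i \<in> ?X" "g (\<phi> i) = (r, snd (g i))"
        unfolding \<phi>_def by (rule inv_into_into, rule f_inv_into_f)
      show "\<phi> i \<le> i" using i(2) 1 by (intro ord[OF 1(1) i(1)]) simp_all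
    qed
    have X: "i \<in> ?X" if "i \<in> {1..t}" for i using that t by simp
    show ?thesis
    proof (rule card_inj_on_le[of \<phi>])
      show "inj_on \<phi> {i \<in> {1..t}. fst (g i) = Suc r}"
      proof (rule inj_onI)
        fix i j assume *: "i \<in> {i \<in> {1..t}. fst (g i) = Suc r}" "j \<in> {i \<in> {1..t}. fst (g i) = Suc r}" "\<phi> i = \<phi> j"
        then have "g i = g j" using \<phi>(2)[of i] \<phi>(2)[of j] X by (simp add: prod_eq_iff)
        then show "i = j" using * X labelling_inj[OF g] by blast
      qed
      show "\<phi> ` {i \<in> {1..t}. fst (g i) = Suc r} \<subseteq> {i \<in> {1..t}. fst (g i) = r}"
      proof (rule image_subsetI)
        fix i assume "i \<in> {i \<in> {1..t}. fst (g i) = Suc r}"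
        then have i: "i \<in> {1..t}" "fst (g i) = Suc r" by auto
        show "\<phi> i \<in> {i \<in> {1..t}. fst (g i) = r}"
          using \<phi>[OF X[OF i(1)] i(2)] i(1) by auto
      qed
    qed simp
  qed
  then have "ballot (word_of (d * b) g)" unfolding word_of_def ballot_rev_map_iff by blast
  moreover have "count_list (word_of (d * b) g) r = rect d b r" for r
  proof (cases "r < d")
    case True
    have "{i \<in> ?X. fst (g i) = r} = {i \<in> ?X. g i \<in> {r} \<times> {..<b}}"
      using range by (auto simp: mem_Times_iff)
    also have "card \<dots> = card ({r} \<times> {..<b})" by (rule labelling_card_preimage[OF g]) (use True in auto)
    finally show ?thesis using True unfolding word_of_def count_list_rev_map rect_def
      by (simp add: card_cartesian_product)
  next
    case False
    then have "{i \<in> ?X. fst (g i) = r} = {}" using range by auto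
    then have "card {i \<in> ?X. fst (g i) = r} = 0" by (simp only: card.empty)
    then show ?thesis using False unfolding word_of_def count_list_rev_map rect_def by simp
  qed
  ultimately show ?thesis by (auto simp: ballots_def)
qed

text \<open>Rows are filled from left to right, so the column of an entry counts its predecessors in
  the row. The word of rows therefore determines the labelling.\<close>

lemma labelling_rank:
  assumes g: "g \<in> grid_labellings d b" and i: "i \<in> {1..d * b}"
  shows "snd (g i) = card {j \<in> {1..<i}. fst (g j) = fst (g i)}"
proof -
  let ?X = "{1..d * b}"
  note ord = labelling_order[OF g] note range = labelling_range[OF g]
  have "{j \<in> {1..<i}. fst (g j) = fst (g i)} = {j \<in> ?X. g j \<in> {fst (g i)} \<times> {..<snd (g i)}}"
  proof (intro equalityI subsetI)
    fix j assume "j \<in> {j \<in> {1..<i}. fst (g j) = fst (g i)}"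
    then have j: "j \<in> ?X" "j < i" "fst (g j) = fst (g i)" using i by auto
    have "snd (g j) < snd (g i)"
    proof (rule ccontr)
      assume "\<not> snd (g j) < snd (g i)"
      then have "i \<le> j" using j(3) by (intro ord[OF i j(1)]) simp_all
      then show False using j(2) by simp
    qed
    then show "j \<in> {j \<in> ?X. g j \<in> {fst (g i)} \<times> {..<snd (g i)}}" using j by (simp add: mem_Times_iff)
  next
    fix j assume "j \<in> {j \<in> ?X. g j \<in> {fst (g i)} \<times> {..<snd (g i)}}"
    then have j: "j \<in> ?X" "fst (g j) = fst (g i)" "snd (g j) < snd (g i)" by (auto simp: mem_Times_iff)
    then have "j \<le> i" "j \<noteq> i" using ord[OF j(1) i] by auto
    then show "j \<in> {j \<in> {1..<i}. fst (g j) = fst (g i)}" using j by auto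
  qed
  also have "card \<dots> = card ({fst (g i)} \<times> {..<snd (g i)})"
    by (rule labelling_card_preimage[OF g]) (use range[OF i] in auto)
  finally show ?thesis by (simp add: card_cartesian_product)
qed

lemma ballot_word_labelling:
  assumes w: "w \<in> ballots (rect d b)"
  shows "\<exists>g \<in> grid_labellings d b. word_of (d * b) g = w"
proof -
  let ?X = "{1..d * b}"
  have len: "length w = d * b"
    using length_ballots[OF w, of d] by (simp add: rect_def)
  have setw: "set w \<subseteq> {..<d}" using length_ballots[OF w, of d] by (simp add: rect_def)
  define f where "f i = rev w ! (i - 1)" for i
  define g where "g i = (if i \<in> ?X then (f i, card {j \<in> {1..<i}. f j = f i}) else (0, 0))" for i
  have wf: "w = rev (map f [1..<Suc (d * b)])"
  proof -
    have "rev w = map f [1..<Suc (d * b)]"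
      by (rule nth_equalityI) (auto simp: len f_def simp del: upt_Suc)
    then show ?thesis by (metis rev_rev_ident)
  qed
  have fd: "f i < d" if "i \<in> ?X" for i
  proof -
    have "rev w ! (i - 1) \<in> set (rev w)" by (rule nth_mem) (use that len in auto)
    then show ?thesis using setw by (auto simp: f_def)
  qed
  have cnt: "card {i \<in> ?X. f i = r} = b" if "r < d" for r
    using w that unfolding ballots_def wf count_list_rev_map[symmetric] by (simp add: rect_def del: upt_Suc)
  have bal: "card {i \<in> {1..t}. f i = Suc r} \<le> card {i \<in> {1..t}. f i = r}" if "t \<le> d * b" for t r
    using w that ballot_rev_map_iff[of f "d * b"] unfolding ballots_def wf by blast
  have bal': "card {i \<in> {1..t}. f i = s} \<le> card {i \<in> {1..t}. f i = r}" if "t \<le> d * b" "r \<le> s" for t r s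
    using lift_Suc_antimono_le[of "\<lambda>r. card {i \<in> {1..t}. f i = r}", OF bal[OF that(1)] that(2)] .
  have ord: "i \<le> j" if ij: "i \<in> ?X" "j \<in> ?X" "fst (g i) \<le> fst (g j)" "snd (g i) \<le> snd (g j)" for i j
  proof (rule ccontr)
    assume "\<not> i \<le> j"
    then have ji: "j < i" by simp
    have le: "f i \<le> f j" "card {k \<in> {1..<i}. f k = f i} \<le> card {k \<in> {1..<j}. f k = f j}"
      using ij by (simp_all add: g_def)
    \<comment> \<open>Row lengths at time \<open>j\<close> are compared: row \<open>f j\<close> then
      exceeds the rank of \<open>j\<close> by one, the row \<open>f i\<close> above or equal to it
      is at least as long, and its entries so far all precede \<open>i\<close>. Hence the rank of
      \<open>i\<close> exceeds that of \<open>j\<close>.\<close>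
    have "{k \<in> {1..j}. f k = f j} = insert j {k \<in> {1..<j}. f k = f j}" using ij(2) by auto
    then have "Suc (card {k \<in> {1..<j}. f k = f j}) = card {k \<in> {1..j}. f k = f j}" by simp
    also have "\<dots> \<le> card {k \<in> {1..j}. f k = f i}" using ij(2) le(1) by (intro bal') auto
    also have "\<dots> \<le> card {k \<in> {1..<i}. f k = f i}" using ji by (intro card_mono) auto
    finally show False using le(2) by simp
  qed
  have inj: "inj_on g ?X"
  proof (rule inj_onI)
    fix i j assume "i \<in> ?X" "j \<in> ?X" "g i = g j"
    then show "i = j" using ord[of i j] ord[of j i] by simp
  qed
  have "g ` ?X \<subseteq> {..<d} \<times> {..<b}"
  proof (rule image_subsetI)
    fix i assume i: "i \<in> ?X"
    have "card {j \<in> {1..<i}. f j = f i} < card {j \<in> ?X. f j = f i}"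
      using i by (intro psubset_card_mono) auto
    then show "g i \<in> {..<d} \<times> {..<b}" using fd[OF i] cnt[OF fd[OF i]] i by (simp add: g_def)
  qed
  then have "g ` ?X = {..<d} \<times> {..<b}"
    by (rule card_subset_eq[rotated]) (simp_all only: card_image[OF inj], simp_all)
  then have "bij_betw g ?X ({..<d} \<times> {..<b})" using inj by (simp only: bij_betw_def)
  moreover have "\<forall>i. i \<notin> ?X \<longrightarrow> g i = (0, 0)" unfolding g_def by meson
  ultimately have "g \<in> grid_labellings d b" using ord unfolding grid_labellings_def by blast
  moreover have "word_of (d * b) g = w"
  proof -
    have "fst (g i) = f i" if "i \<in> {1..d * b}" for i
      unfolding g_def if_P[OF that] by simp
    then have "map (\<lambda>i. fst (g i)) [1..<Suc (d * b)] = map f [1..<Suc (d * b)]"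
      by (intro map_cong[OF refl]) (simp only: set_upt atLeastLessThanSuc_atLeastAtMost)
    then show ?thesis unfolding wf word_of_def by (simp only:)
  qed
  ultimately show ?thesis by blast
qed

lemma bij_betw_word_of:
  "bij_betw (word_of (d * b)) (grid_labellings d b) (ballots (rect d b))"
proof (intro bij_betw_imageI equalityI subsetI inj_onI)
  fix g h assume gh: "g \<in> grid_labellings d b" "h \<in> grid_labellings d b" "word_of (d * b) g = word_of (d * b) h"
  have "map (\<lambda>i. fst (g i)) [1..<Suc (d * b)] = map (\<lambda>i. fst (h i)) [1..<Suc (d * b)]"
    using gh(3) unfolding word_of_def by (simp only: rev_is_rev_conv)
  then have f: "fst (g i) = fst (h i)" if "i \<in> {1..d * b}" for i
    unfolding map_eq_conv using that by (simp del: upt_Suc)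
  show "g = h"
  proof
    fix i show "g i = h i"
    proof (cases "i \<in> {1..d * b}")
      case True
      have "{j \<in> {1..<i}. fst (g j) = fst (g i)} = {j \<in> {1..<i}. fst (h j) = fst (h i)}"
        using f True by auto
      then have "snd (g i) = snd (h i)"
        by (simp only: labelling_rank[OF gh(1) True] labelling_rank[OF gh(2) True])
      then show ?thesis using f[OF True] by (simp add: prod_eq_iff)
    next
      case False
      then show ?thesis using gh(1,2) unfolding grid_labellings_def mem_Collect_eq by metis
    qed
  qed
next
  fix w assume "w \<in> word_of (d * b) ` grid_labellings d b"
  then show "w \<in> ballots (rect d b)" using labelling_word by blast
next
  fix w assume "w \<in> ballots (rect d b)"
  then show "w \<in> word_of (d * b) ` grid_labellings d b" using ballot_word_labelling by blast
qed

theorem card_involutions_longest: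
  assumes "0 < d" "0 < b"
  shows "card (involutions_longest (d * b) d b) = card (ballots (rect d b))"
  using bij_betw_same_card[OF bij_betw_cell_of[OF assms]] bij_betw_same_card[OF bij_betw_word_of] by simp

section \<open>Cutting a rectangular tableau in half\<close>

text \<open>Suffix by suffix, the lattice condition takes a form that can be complemented inside the
  rectangle.\<close>

lemma ballot_append:
  "ballot (v @ u) \<longleftrightarrow> ballot u \<and>
     (\<forall>v1 v2. v = v1 @ v2 \<longrightarrow> (\<forall>j. count_list (v2 @ u) (Suc j) \<le> count_list (v2 @ u) j))"
proof (induction v)
  case Nil
  then show ?case using ballot_antimono by auto
next
  case (Cons x v)
  have 1: "(\<forall>v1 v2. x # v = v1 @ v2 \<longrightarrow> P v2) \<longleftrightarrow> P (x # v) \<and> (\<forall>v1 v2. v = v1 @ v2 \<longrightarrow> P v2)" for P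
    by (auto simp: Cons_eq_append_conv)
  have 2: "ballot (x # v @ u) \<longleftrightarrow>
      ballot (v @ u) \<and> (\<forall>j. count_list (x # v @ u) (Suc j) \<le> count_list (x # v @ u) j)"
  proof
    assume *: "ballot (v @ u) \<and> (\<forall>j. count_list (x # v @ u) (Suc j) \<le> count_list (x # v @ u) j)"
    then have "count_list (x # v @ u) x \<le> count_list (x # v @ u) (x - 1)" if "x \<noteq> 0"
      using that by (metis Suc_pred not_gr_zero One_nat_def)
    then show "ballot (x # v @ u)" using * by (cases x) auto
  next
    assume b: "ballot (x # v @ u)"
    then show "ballot (v @ u) \<and> (\<forall>j. count_list (x # v @ u) (Suc j) \<le> count_list (x # v @ u) j)"
      using ballot_antimono[OF b] by (auto simp del: count_list.simps)
  qed
  show ?case unfolding append_Cons 1 2 Cons.IH by blast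
qed

lemma ballot_iff_suffixes:
  "ballot v \<longleftrightarrow> (\<forall>v1 v2. v = v1 @ v2 \<longrightarrow> (\<forall>j. count_list v2 (Suc j) \<le> count_list v2 j))"
  using ballot_append[of v "[]"] by simp

text \<open>Rotation of a tableau by 180 degrees: the order of the entries and the order of the rows
  are both reversed.\<close>

definition dual_word :: "nat \<Rightarrow> nat list \<Rightarrow> nat list" where
  "dual_word d v = rev (map (\<lambda>r. d - 1 - r) v)"

lemma length_dual_word [simp]: "length (dual_word d v) = length v"
  by (simp add: dual_word_def)

lemma set_dual_word: "0 < d \<Longrightarrow> set (dual_word d v) \<subseteq> {..<d}"
  by (auto simp: dual_word_def)

lemma dual_word_dual_word: "set v \<subseteq> {..<d} \<Longrightarrow> dual_word d (dual_word d v) = v"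
  unfolding dual_word_def rev_map[symmetric] rev_rev_ident map_map by (rule map_idI) auto

lemma count_list_dual_word:
  assumes "set v \<subseteq> {..<d}" "r < d"
  shows "count_list (dual_word d v) r = count_list v (d - 1 - r)"
  using assms(1)
proof (induction v)
  case (Cons x v)
  then have "d - 1 - x = r \<longleftrightarrow> x = d - 1 - r" using assms(2) by auto
  with Cons show ?case by (auto simp: dual_word_def)
qed (simp add: dual_word_def)

text \<open>In every row the letters of a prefix \<open>v1\<close> are those that the rest
  \<open>v2 @ u\<close> lacks to reach \<open>b\<close>. The rest therefore has weakly decreasing
  row lengths iff the counts of \<open>v1\<close> increase weakly, that is, iff those of its
  rotation decrease weakly; and the rotated prefixes are the suffixes of
  \<open>dual_word d v\<close>. The middle condition is \<open>C v1\<close>.\<close>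

lemma ballot_append_dual:
  assumes v: "set v \<subseteq> {..<d}" and u: "set u \<subseteq> {..<d}"
    and b: "\<And>r. r < d \<Longrightarrow> count_list v r + count_list u r = b"
  shows "ballot (v @ u) \<longleftrightarrow> ballot u \<and> ballot (dual_word d v)"
proof -
  define C where "C v1 \<longleftrightarrow> (\<forall>j. Suc j < d \<longrightarrow> count_list v1 j \<le> count_list v1 (Suc j))" for v1
  have 1: "(\<forall>j. count_list (v2 @ u) (Suc j) \<le> count_list (v2 @ u) j) \<longleftrightarrow> C v1" if "v = v1 @ v2" for v1 v2
  proof -
    have e: "count_list (v2 @ u) j + count_list v1 j = b" if "j < d" for j
      using b[OF that] \<open>v = v1 @ v2\<close> by simp
    have z: "count_list (v2 @ u) j = 0" if "j \<ge> d" for j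
      using that u v \<open>v = v1 @ v2\<close> by (auto simp: count_list_0_iff)
    have "count_list (v2 @ u) (Suc j) \<le> count_list (v2 @ u) j \<longleftrightarrow>
        (Suc j < d \<longrightarrow> count_list v1 j \<le> count_list v1 (Suc j))" for j
      using e[of j] e[of "Suc j"] z[of "Suc j"] by (cases "Suc j < d") auto
    then show ?thesis unfolding C_def by blast
  qed
  have 2: "(\<forall>j. count_list (dual_word d v1) (Suc j) \<le> count_list (dual_word d v1) j) \<longleftrightarrow> C v1"
    if "v = v1 @ v2" for v1 v2
  proof -
    have v1: "set v1 \<subseteq> {..<d}" using that v by simp
    note c = count_list_dual_word[OF v1]
    have z: "count_list (dual_word d v1) j = 0" if "j \<ge> d" for j
      using that v1 set_dual_word[of d v1] by (cases "d = 0") (simp add: dual_word_def, auto simp: count_list_0_iff)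
    show ?thesis
    proof
      assume h: "\<forall>j. count_list (dual_word d v1) (Suc j) \<le> count_list (dual_word d v1) j"
      have "count_list v1 j \<le> count_list v1 (Suc j)" if j: "Suc j < d" for j
      proof -
        let ?i = "d - 1 - Suc j"
        have "d - 1 - Suc ?i = j" "d - 1 - ?i = Suc j" "Suc ?i < d" "?i < d" using j by auto
        then show ?thesis using h[rule_format, of ?i] c by metis
      qed
      then show "C v1" by (simp add: C_def)
    next
      assume C: "C v1"
      show "\<forall>j. count_list (dual_word d v1) (Suc j) \<le> count_list (dual_word d v1) j"
      proof
        fix j show "count_list (dual_word d v1) (Suc j) \<le> count_list (dual_word d v1) j"
        proof (cases "Suc j < d")
          case True
          then have "d - 1 - j = Suc (d - 1 - Suc j)" "Suc (d - 1 - Suc j) < d" by auto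
          then show ?thesis using C c[of j] c[of "Suc j"] True unfolding C_def by simp
        qed (simp add: z)
      qed
    qed
  qed
  have split: "(\<forall>w1 w2. dual_word d v = w1 @ w2 \<longrightarrow> Q w2) \<longleftrightarrow>
      (\<forall>v1 v2. v = v1 @ v2 \<longrightarrow> Q (dual_word d v1))" for Q
  proof (intro iffI allI impI)
    fix v1 v2 assume "\<forall>w1 w2. dual_word d v = w1 @ w2 \<longrightarrow> Q w2" "v = v1 @ v2"
    then show "Q (dual_word d v1)" by (simp add: dual_word_def)
  next
    fix w1 w2 assume *: "\<forall>v1 v2. v = v1 @ v2 \<longrightarrow> Q (dual_word d v1)" "dual_word d v = w1 @ w2"
    have "v = dual_word d (w1 @ w2)" using dual_word_dual_word[OF v] *(2) by simp
    also have "\<dots> = dual_word d w2 @ dual_word d w1" by (simp add: dual_word_def)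
    finally have "Q (dual_word d (dual_word d w2))" using *(1) by blast
    moreover have "set w2 \<subseteq> {..<d}"
    proof (cases "d = 0")
      case True
      then have "v = []" using v by simp
      then show ?thesis using *(2) by (simp add: dual_word_def)
    next
      case False
      then show ?thesis using set_dual_word[of d v] *(2) by simp
    qed
    ultimately show "Q w2" by (simp add: dual_word_dual_word)
  qed
  have "(\<forall>v1 v2. v = v1 @ v2 \<longrightarrow> (\<forall>j. count_list (v2 @ u) (Suc j) \<le> count_list (v2 @ u) j)) \<longleftrightarrow>
      (\<forall>v1 v2. v = v1 @ v2 \<longrightarrow> C v1)"
    by (intro iff_allI imp_cong refl 1)
  moreover have "(\<forall>v1 v2. v = v1 @ v2 \<longrightarrow> (\<forall>j. count_list (dual_word d v1) (Suc j) \<le> count_list (dual_word d v1) j)) \<longleftrightarrow>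
      (\<forall>v1 v2. v = v1 @ v2 \<longrightarrow> C v1)"
    by (intro iff_allI imp_cong refl 2)
  ultimately show ?thesis
    unfolding ballot_append[of v u] ballot_iff_suffixes[of "dual_word d v"] split by argo
qed

definition box_complement :: "nat \<Rightarrow> nat \<Rightarrow> (nat \<Rightarrow> nat) \<Rightarrow> nat \<Rightarrow> nat" where
  "box_complement d b c i = (if i < d then b - c (d - 1 - i) else 0)"

definition box_partitions :: "nat \<Rightarrow> nat \<Rightarrow> nat \<Rightarrow> (nat \<Rightarrow> nat) set" where
  "box_partitions d b m = {c \<in> partitions d m. c 0 \<le> b}"

lemma partitions_le_first: "c \<in> partitions d m \<Longrightarrow> c i \<le> c 0"
  using lift_Suc_antimono_le[of c 0 i] by (auto simp: partitions_def)

lemma bij_betw_cut: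
  assumes d: "0 < d" and m: "m \<le> d * b"
  shows "bij_betw (\<lambda>(u, v). dual_word d v @ u)
     (\<Union>c\<in>box_partitions d b m. ballots c \<times> ballots (box_complement d b c)) (ballots (rect d b))"
\<comment> \<open>Words grow at the head, so the \<open>m\<close> smallest entries are found at the
  tail.\<close>
proof (rule bij_betw_byWitness[where f' = "\<lambda>w. (drop (d * b - m) w, dual_word d (take (d * b - m) w))"])
  let ?P = "\<Union>c\<in>box_partitions d b m. ballots c \<times> ballots (box_complement d b c)"
  let ?f = "\<lambda>(u, v). dual_word d v @ u"
  let ?f' = "\<lambda>w. (drop (d * b - m) w, dual_word d (take (d * b - m) w))"
  have P: "set u \<subseteq> {..<d} \<and> set v \<subseteq> {..<d} \<and> length u = m \<and> length v = d * b - m \<and> dual_word d v @ u \<in> ballots (rect d b)"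
    if c: "c \<in> box_partitions d b m" "u \<in> ballots c" "v \<in> ballots (box_complement d b c)" for c u v
  proof -
    have c0: "c 0 \<le> b" "\<forall>i\<ge>d. c i = 0" "sum c {..<d} = m"
      and cb: "c i \<le> b" for i
      using c(1) partitions_le_first[of c d m i] by (auto simp: box_partitions_def partitions_def)
    have cc: "\<forall>i\<ge>d. box_complement d b c i = 0" by (simp add: box_complement_def)
    note u = length_ballots[OF c(2) c0(2)] and v = length_ballots[OF c(3) cc]
    have "sum (box_complement d b c) {..<d} = (\<Sum>i<d. b - c (d - Suc i))"
      by (rule sum.cong) (auto simp: box_complement_def)
    also have "\<dots> = (\<Sum>i<d. b - c i)" by (rule sum.nat_diff_reindex)
    also have "\<dots> = (\<Sum>i<d. b) - (\<Sum>i<d. c i)" using cb by (intro sum_subtractf_nat) auto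
    finally have lv: "length v = d * b - m" using v(2) c0(3) by simp
    have du: "set (dual_word d v) \<subseteq> {..<d}" by (rule set_dual_word[OF d])
    have cu: "count_list u = c" "ballot u" using c(2) by (auto simp: ballots_def)
    have cv: "count_list v = box_complement d b c" "ballot v" using c(3) by (auto simp: ballots_def)
    have e: "count_list (dual_word d v) r + count_list u r = b" if "r < d" for r
    proof -
      have "d - 1 - (d - 1 - r) = r" "d - 1 - r < d" using that by auto
      then show ?thesis using cb[of r] unfolding count_list_dual_word[OF v(1) that] cu cv
        by (simp add: box_complement_def)
    qed
    have "ballot (dual_word d v @ u)"
      using ballot_append_dual[OF du u(1), of b] e cu cv by (simp add: dual_word_dual_word[OF v(1)])
    moreover have "count_list (dual_word d v @ u) r = rect d b r" for r
    proof (cases "r < d")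
      case False
      then have "r \<notin> set (dual_word d v @ u)" using du u(1) by auto
      then show ?thesis using False by (simp add: rect_def count_list_0_iff)
    qed (use e in \<open>simp add: rect_def\<close>)
    ultimately show ?thesis using u v(1) lv c0(3) by (auto simp: ballots_def)
  qed
  show "?f ` ?P \<subseteq> ballots (rect d b)" using P by fast
  have PP: "?f' (?f (u, v)) = (u, v)"
    if c: "c \<in> box_partitions d b m" "u \<in> ballots c" "v \<in> ballots (box_complement d b c)" for c u v
    using P[OF that] by (simp add: dual_word_dual_word)
  show "\<forall>x\<in>?P. ?f' (?f x) = x" using PP by fast
  have R: "?f' w \<in> ?P \<and> ?f (?f' w) = w" if w: "w \<in> ballots (rect d b)" for w
  proof -
    define u v where "u = drop (d * b - m) w" and "v = take (d * b - m) w"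
    have w': "w = v @ u" by (simp add: u_def v_def)
    have lw: "length w = d * b" "set w \<subseteq> {..<d}"
      using length_ballots[OF w, of d] by (auto simp: rect_def)
    have sets: "set u \<subseteq> {..<d}" "set v \<subseteq> {..<d}" using lw(2) w' by auto
    have lu: "length u = m" using lw m by (simp add: u_def)
    have cw: "count_list (v @ u) = rect d b" "ballot (v @ u)" using w w' by (auto simp: ballots_def)
    have e: "count_list v r + count_list u r = b" if "r < d" for r
      using fun_cong[OF cw(1), of r] that by (simp add: rect_def)
    have b: "ballot u" "ballot (dual_word d v)"
      using ballot_append_dual[OF sets(2,1) e] cw(2) by auto
    have "count_list u \<in> box_partitions d b m"
      using ballot_in_partitions[OF b(1) sets(1)] e[OF d] lu by (auto simp: box_partitions_def)
    moreover have "count_list (dual_word d v) r = box_complement d b (count_list u) r" for r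
    proof (cases "r < d")
      case True
      then have "d - 1 - r < d" by auto
      then show ?thesis using e[of "d - 1 - r"] True
        unfolding count_list_dual_word[OF sets(2) True] by (simp add: box_complement_def)
    next
      case False
      then have "r \<notin> set (dual_word d v)" using set_dual_word[OF d, of v] by auto
      then show ?thesis using False by (simp add: box_complement_def count_list_0_iff)
    qed
    ultimately have "(u, dual_word d v) \<in> ?P" using b by (auto simp: ballots_def)
    then show ?thesis using dual_word_dual_word[OF sets(2)]
      by (simp add: u_def[symmetric] v_def[symmetric] w'[symmetric])
  qed
  show "\<forall>w\<in>ballots (rect d b). ?f (?f' w) = w" using R by blast
  show "?f' ` ballots (rect d b) \<subseteq> ?P" using R by blast
qed

theorem card_ballots_rect:
  assumes d: "0 < d" and m: "m \<le> d * b"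
  shows "card (ballots (rect d b)) =
    (\<Sum>c\<in>box_partitions d b m. card (ballots c) * card (ballots (box_complement d b c)))"
proof -
  have "card (ballots (rect d b)) = card (\<Union>c\<in>box_partitions d b m. ballots c \<times> ballots (box_complement d b c))"
    using bij_betw_same_card[OF bij_betw_cut[OF d m]] by simp
  also have "\<dots> = (\<Sum>c\<in>box_partitions d b m. card (ballots c \<times> ballots (box_complement d b c)))"
  proof (rule card_UN_disjoint)
    show "finite (box_partitions d b m)" by (simp add: box_partitions_def finite_partitions)
    have "finite (ballots c \<times> ballots (box_complement d b c))" if "c \<in> box_partitions d b m" for c
      using that finite_ballots[of d c] finite_ballots[of d "box_complement d b c"]
      by (auto simp: box_partitions_def partitions_def box_complement_def)
    then show "\<forall>c\<in>box_partitions d b m. finite (ballots c \<times> ballots (box_complement d b c))" by blast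
  qed (auto simp: ballots_def)
  finally show ?thesis by (simp add: card_cartesian_product)
qed

section \<open>The determinantal formula\<close>

definition falling :: "int \<Rightarrow> nat \<Rightarrow> int" where
  "falling x j = (\<Prod>t<j. x - int t)"

text \<open>Both sides are \<open>x (x - 1) ... (x - j)\<close>. In a Leibniz term this exchanges
  lowering a part \<open>l k\<close>, weighted by \<open>l k\<close>, for a scalar factor.\<close>

lemma falling_shift: "x * falling (x - 1) j = falling x j * (x - int j)"
proof -
  have "falling x (Suc j) = x * falling (x - 1) j"
    unfolding falling_def prod.lessThan_Suc_shift by (simp add: algebra_simps)
  then show ?thesis by (simp add: falling_def)
qed

lemma falling_self: "falling (int n) n = fact n"
proof -
  have "falling (int n) n = (\<Prod>t<n. int n - int (n - Suc t))"
    unfolding falling_def by (rule prod.nat_diff_reindex[symmetric])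
  also have "\<dots> = (\<Prod>t<n. int (Suc t))" by (rule prod.cong) auto
  also have "\<dots> = fact n" by (simp add: fact_prod_Suc atLeast0LessThan)
  finally show ?thesis .
qed

lemma falling_eq_0: "m < n \<Longrightarrow> falling (int m) n = 0"
  unfolding falling_def by (rule prod_zero) auto

text \<open>The columns run through decreasing degrees so that the staircase gives an upper triangular matrix
  and no sign appears.\<close>

definition alternant :: "nat \<Rightarrow> (nat \<Rightarrow> int) \<Rightarrow> int" where
  "alternant d l = det (mat d d (\<lambda>(i, j). falling (l i) (d - 1 - j)))"

lemma alternant_Leibniz:
  "alternant d l = (\<Sum>p | p permutes {0..<d}. signof p * (\<Prod>i=0..<d. falling (l i) (d - 1 - p i)))"
  unfolding alternant_def
  by (subst det_def'[of _ d]) (auto intro!: sum.cong prod.cong dest: permutes_in_image)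

text \<open>Lowering \<open>l k\<close> multiplies the Leibniz term of \<open>p\<close> by
  \<open>l k - (d - 1 - p k)\<close>, and the sum of these factors over \<open>k\<close> is
  independent of \<open>p\<close>. This is the algebraic counterpart of removing a corner from a
  tableau.\<close>

lemma alternant_recurrence:
  "(\<Sum>k=0..<d. l k * alternant d (l(k := l k - 1))) = ((\<Sum>k=0..<d. l k) - (\<Sum>k=0..<d. int k)) * alternant d l"
proof -
  let ?S = "\<Sum>k=0..<d. l k" and ?T = "\<Sum>k=0..<d. int k"
  have summand: "l k * (\<Prod>i=0..<d. falling ((l(k := l k - 1)) i) (d - 1 - p i))
      = (l k - int (d - 1 - p k)) * (\<Prod>i=0..<d. falling (l i) (d - 1 - p i))" if "k < d" for k p
  proof -
    have k: "k \<in> {0..<d}" using that by simp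
    have "(\<Prod>i\<in>{0..<d} - {k}. falling ((l(k := l k - 1)) i) (d - 1 - p i)) = (\<Prod>i\<in>{0..<d} - {k}. falling (l i) (d - 1 - p i))"
      by (rule prod.cong) auto
    then show ?thesis
      unfolding prod.remove[OF finite_atLeastLessThan k] fun_upd_same mult.assoc[symmetric] falling_shift
      by (simp only: mult.commute)
  qed
  have T: "(\<Sum>k=0..<d. int (d - 1 - p k)) = ?T" if p: "p permutes {0..<d}" for p
  proof -
    have "(\<Sum>k=0..<d. int (d - 1 - p k)) = (\<Sum>k=0..<d. int (d - 1 - k))"
      using sum.reindex_bij_betw[OF permutes_imp_bij[OF p], of "\<lambda>k. int (d - 1 - k)"] by simp
    also have "\<dots> = ?T"
      using sum.nat_diff_reindex[of int d] by (simp add: atLeast0LessThan)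
    finally show ?thesis .
  qed
  have "(\<Sum>k=0..<d. l k * alternant d (l(k := l k - 1))) =
      (\<Sum>k=0..<d. \<Sum>p | p permutes {0..<d}. signof p * (l k * (\<Prod>i=0..<d. falling ((l(k := l k - 1)) i) (d - 1 - p i))))"
    unfolding alternant_Leibniz sum_distrib_left by (simp add: mult.left_commute)
  also have "\<dots> = (\<Sum>k=0..<d. \<Sum>p | p permutes {0..<d}. signof p * ((l k - int (d - 1 - p k)) * (\<Prod>i=0..<d. falling (l i) (d - 1 - p i))))"
    by (intro sum.cong refl) (simp only: summand atLeastLessThan_iff)
  also have "\<dots> = (\<Sum>p | p permutes {0..<d}. \<Sum>k=0..<d. signof p * ((l k - int (d - 1 - p k)) * (\<Prod>i=0..<d. falling (l i) (d - 1 - p i))))"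
    by (rule sum.swap)
  also have "\<dots> = (\<Sum>p | p permutes {0..<d}. (?S - ?T) * (signof p * (\<Prod>i=0..<d. falling (l i) (d - 1 - p i))))"
  proof (rule sum.cong[OF refl])
    fix p assume "p \<in> {p. p permutes {0..<d}}"
    then have p: "p permutes {0..<d}" by simp
    have "(\<Sum>k=0..<d. signof p * ((l k - int (d - 1 - p k)) * (\<Prod>i=0..<d. falling (l i) (d - 1 - p i))))
       = (\<Sum>k=0..<d. l k - int (d - 1 - p k)) * (signof p * (\<Prod>i=0..<d. falling (l i) (d - 1 - p i)))"
      unfolding sum_distrib_right by (rule sum.cong) (simp_all add: mult_ac)
    also have "(\<Sum>k=0..<d. l k - int (d - 1 - p k)) = ?S - ?T" unfolding sum_subtractf T[OF p] ..
    finally show "(\<Sum>k=0..<d. signof p * ((l k - int (d - 1 - p k)) * (\<Prod>i=0..<d. falling (l i) (d - 1 - p i))))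
       = (?S - ?T) * (signof p * (\<Prod>i=0..<d. falling (l i) (d - 1 - p i)))" .
  qed
  also have "\<dots> = (?S - ?T) * alternant d l"
    unfolding alternant_Leibniz sum_distrib_left ..
  finally show ?thesis .
qed

lemma alternant_eq_0:
  assumes "i < d" "j < d" "i \<noteq> j" "l i = l j" shows "alternant d l = 0"
  unfolding alternant_def
  by (rule det_identical_rows[of _ d i j]) (use assms in \<open>auto intro!: eq_vecI\<close>)

lemma alternant_staircase: "alternant d (\<lambda>i. int (d - 1 - i)) = (\<Prod>i=0..<d. fact (d - 1 - i))"
proof -
  let ?A = "mat d d (\<lambda>(i, j). falling (int (d - 1 - i)) (d - 1 - j))"
  have "det ?A = prod_list (diag_mat ?A)"
  proof (rule det_upper_triangular[of _ d])
    have "falling (int (d - 1 - i)) (d - 1 - j) = 0" if "i < d" "j < i" for i j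
      by (rule falling_eq_0) (use that in linarith)
    then show "upper_triangular ?A" by (simp add: upper_triangular_def del: of_nat_diff)
  qed simp
  also have "\<dots> = (\<Prod>i=0..<d. fact (d - 1 - i))"
    unfolding prod_list_diag_prod by (auto simp: falling_self simp del: of_nat_diff intro!: prod.cong)
  finally show ?thesis by (simp add: alternant_def)
qed

text \<open>The matrix factors into the matrix of powers and the triangular matrix of coefficients,
  whose diagonal consists of the coefficients of degree \<open>j\<close> in
  \<open>P j\<close>.\<close>

lemma det_poly_entries:
  fixes P :: "nat \<Rightarrow> 'a :: comm_ring_1 poly"
  assumes deg: "\<And>j. degree (P j) \<le> j"
  shows "det (mat d d (\<lambda>(i, j). poly (P (d - 1 - j)) (x i))) =
    det (mat d d (\<lambda>(i, j). x i ^ (d - 1 - j))) * (\<Prod>j<d. coeff (P j) j)"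
proof -
  let ?V = "mat d d (\<lambda>(i, j). x i ^ (d - 1 - j))"
  let ?T = "mat d d (\<lambda>(s, j). coeff (P (d - 1 - j)) (d - 1 - s))"
  have "poly (P (d - 1 - j)) (x i) = (\<Sum>s=0..<d. x i ^ (d - 1 - s) * coeff (P (d - 1 - j)) (d - 1 - s))" if "j < d" for i j
  proof -
    have "poly (P (d - 1 - j)) (x i) = (\<Sum>s<d. coeff (P (d - 1 - j)) s * x i ^ s)"
      unfolding poly_altdef
      using deg[of "d - 1 - j"] that by (intro sum.mono_neutral_left) (auto simp: coeff_eq_0)
    also have "\<dots> = (\<Sum>s<d. coeff (P (d - 1 - j)) (d - Suc s) * x i ^ (d - Suc s))"
      by (rule sum.nat_diff_reindex[symmetric])
    finally show ?thesis by (simp add: atLeast0LessThan mult.commute)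
  qed
  then have "mat d d (\<lambda>(i, j). poly (P (d - 1 - j)) (x i)) = ?V * ?T"
    by (intro eq_matI) (auto simp: scalar_prod_def intro!: sum.cong)
  then have "det (mat d d (\<lambda>(i, j). poly (P (d - 1 - j)) (x i))) = det ?V * det ?T"
    by (simp add: det_mult[of _ d])
  also have "det ?T = prod_list (diag_mat ?T)"
  proof (rule det_lower_triangular[of d])
    fix i j assume "i < j" "j < d"
    then have "degree (P (d - 1 - j)) < d - 1 - i" using deg[of "d - 1 - j"] by linarith
    then show "?T $$ (i, j) = 0" using \<open>i < j\<close> \<open>j < d\<close> by (simp add: coeff_eq_0)
  qed simp
  also have "\<dots> = (\<Prod>j=0..<d. coeff (P (d - 1 - j)) (d - 1 - j))"
    unfolding prod_list_diag_prod by (auto intro!: prod.cong)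
  also have "\<dots> = (\<Prod>j<d. coeff (P j) j)"
    using prod.nat_diff_reindex[of "\<lambda>j. coeff (P j) j" d] by (simp add: atLeast0LessThan)
  finally show ?thesis .
qed

text \<open>The sign \<open>e\<close> is 1 for \<open>falling x j\<close> and -1 for
  \<open>falling (K - x) j\<close>, both being products of \<open>j\<close> linear factors in
  \<open>x\<close>.\<close>

lemma prod_linear_poly:
  fixes a :: "nat \<Rightarrow> 'a :: comm_ring_1"
  shows "degree (\<Prod>t<j. [:a t, e:]) \<le> j \<and> coeff (\<Prod>t<j. [:a t, e:]) j = e ^ j"
proof (induction j)
  case (Suc j)
  let ?p = "\<Prod>t<j. [:a t, e:]"
  have e: "(\<Prod>t<Suc j. [:a t, e:]) = smult (a j) ?p + pCons 0 (smult e ?p)"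
    by (simp add: mult.commute[of ?p])
  have "degree (smult (a j) ?p) \<le> Suc j" "degree (pCons 0 (smult e ?p)) \<le> Suc j"
    using Suc degree_smult_le[of "a j" ?p] degree_smult_le[of e ?p] degree_pCons_le[of 0 "smult e ?p"] by linarith+
  then have "degree (\<Prod>t<Suc j. [:a t, e:]) \<le> Suc j" unfolding e by (rule degree_add_le)
  moreover have "coeff ?p (Suc j) = 0" using Suc by (intro coeff_eq_0) simp
  then have "coeff (\<Prod>t<Suc j. [:a t, e:]) (Suc j) = e ^ Suc j" unfolding e using Suc by simp
  ultimately show ?case by blast
qed simp

text \<open>As polynomials in \<open>x\<close>, \<open>falling x j\<close> and
  \<open>falling (K - x) j\<close> have degree \<open>j\<close> and leading coefficients 1 and
  \<open>(-1)^j\<close>, so both determinants agree with the same determinant \<open>?V\<close> of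
  powers up to sign.\<close>

lemma abs_alternant_reflect: "\<bar>alternant d (\<lambda>i. K - l i)\<bar> = \<bar>alternant d l\<bar>"
proof -
  let ?V = "det (mat d d (\<lambda>(i, j). l i ^ (d - 1 - j)))"
  have 1: "falling x j = poly (\<Prod>t<j. [:- int t, 1:]) x" for x j
    by (simp add: falling_def poly_prod)
  have 2: "falling (K - x) j = poly (\<Prod>t<j. [:K - int t, - 1:]) x" for x j
    by (simp add: falling_def poly_prod algebra_simps)
  have "alternant d l = ?V * (\<Prod>j<d. coeff (\<Prod>t<j. [:- int t, 1:]) j)"
    unfolding alternant_def 1
    by (rule det_poly_entries) (rule prod_linear_poly[of "\<lambda>t. - int t" 1, THEN conjunct1])
  also have "\<dots> = ?V" using prod_linear_poly[of "\<lambda>t. - int t" 1] by simp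
  finally have A: "alternant d l = ?V" .
  have "alternant d (\<lambda>i. K - l i) = ?V * (\<Prod>j<d. coeff (\<Prod>t<j. [:K - int t, - 1:]) j)"
    unfolding alternant_def 2
    by (rule det_poly_entries) (rule prod_linear_poly[of "\<lambda>t. K - int t" "- 1", THEN conjunct1])
  also have "\<dots> = ?V * (\<Prod>j<d. (- 1) ^ j)" using prod_linear_poly[of "\<lambda>t. K - int t" "- 1"] by simp
  also have "\<bar>\<dots>\<bar> = \<bar>?V\<bar>" by (simp add: abs_mult abs_prod power_abs)
  finally show ?thesis using A by simp
qed

lemma abs_alternant_reverse: "\<bar>alternant d (\<lambda>i. l (d - 1 - i))\<bar> = \<bar>alternant d l\<bar>"
proof -
  define p where "p i = (if i < d then d - 1 - i else i)" for i
  have p: "p permutes {0..<d}"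
    by (rule bij_imp_permutes, rule bij_betw_byWitness[where f' = p]) (auto simp: p_def)
  let ?A = "mat d d (\<lambda>(i, j). falling (l i) (d - 1 - j))"
  have "mat d d (\<lambda>(i, j). falling (l (d - 1 - i)) (d - 1 - j)) = mat d d (\<lambda>(i, j). ?A $$ (p i, j))"
    by (rule eq_matI) (auto simp: p_def)
  then have "alternant d (\<lambda>i. l (d - 1 - i)) = signof p * alternant d l"
    unfolding alternant_def using det_permute_rows[of ?A d p] p by simp
  then show ?thesis by (simp add: abs_mult sign_def)
qed

section \<open>The branching rule and the number of tableaux\<close>

lemma ballots_Cons:
  assumes c: "c \<in> partitions d (Suc m)"
  shows "ballots c = (\<Union>k\<in>{k. k < d \<and> 0 < c k}. (#) k ` ballots (c(k := c k - 1)))"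
proof (intro equalityI subsetI)
  fix w assume w: "w \<in> ballots c"
  have "length w = Suc m" using length_ballots[OF w, of d] c by (simp add: partitions_def)
  then obtain k v where kv: "w = k # v" by (cases w) auto
  have cw: "count_list (k # v) = c" "ballot v" using w kv by (auto simp: ballots_def)
  have "set w \<subseteq> {..<d}" using length_ballots[OF w, of d] c by (simp add: partitions_def)
  then have "k < d" using kv by simp
  moreover have "0 < c k" unfolding cw(1)[symmetric] by simp
  moreover have "count_list v = c(k := c k - 1)" unfolding cw(1)[symmetric] by auto
  ultimately show "w \<in> (\<Union>k\<in>{k. k < d \<and> 0 < c k}. (#) k ` ballots (c(k := c k - 1)))"
    using kv cw(2) by (auto simp: ballots_def)
next
  fix w assume "w \<in> (\<Union>k\<in>{k. k < d \<and> 0 < c k}. (#) k ` ballots (c(k := c k - 1)))"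
  then obtain k v where kv: "w = k # v" "k < d" "0 < c k" "v \<in> ballots (c(k := c k - 1))" by auto
  then have v: "ballot v" "count_list v = c(k := c k - 1)" by (auto simp: ballots_def)
  have "count_list v k < count_list v (k - 1)" if "0 < k"
  proof -
    have "c k \<le> c (k - 1)" using c that by (cases k) (auto simp: partitions_def)
    then show ?thesis using that kv(3) unfolding v(2) by (cases k) auto
  qed
  then have "ballot w" using v(1) kv(1) by auto
  moreover have "count_list w = c" using v(2) kv(1,3) by (auto simp: fun_eq_iff)
  ultimately show "w \<in> ballots c" by (simp add: ballots_def)
qed

lemma card_ballots_recurrence:
  assumes c: "c \<in> partitions d (Suc m)"
  shows "card (ballots c) = (\<Sum>k=0..<d. if 0 < c k then card (ballots (c(k := c k - 1))) else 0)"
proof -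
  have fin: "finite (ballots (c(k := c k - 1)))" for k
    using c by (intro finite_ballots[of d]) (auto simp: partitions_def)
  have "card (ballots c) = (\<Sum>k\<in>{k. k < d \<and> 0 < c k}. card ((#) k ` ballots (c(k := c k - 1))))"
    unfolding ballots_Cons[OF c] by (rule card_UN_disjoint) (use fin in auto)
  also have "\<dots> = (\<Sum>k\<in>{k. k < d \<and> 0 < c k}. card (ballots (c(k := c k - 1))))"
    by (intro sum.cong refl card_image) auto
  also have "\<dots> = (\<Sum>k=0..<d. if 0 < c k then card (ballots (c(k := c k - 1))) else 0)"
    by (rule sum.mono_neutral_cong_left) auto
  finally show ?thesis .
qed

lemma partitions_decrement:
  assumes c: "c \<in> partitions d (Suc m)" and k: "c (Suc k) < c k"
  shows "c(k := c k - 1) \<in> partitions d m"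
proof -
  let ?G = "c(k := c k - 1)"
  have c': "\<And>i. c (Suc i) \<le> c i" "\<And>i. i \<ge> d \<Longrightarrow> c i = 0" "sum c {..<d} = Suc m"
    using c by (auto simp: partitions_def)
  have kd: "k < d" using c'(2)[of k] k by (cases "k < d") auto
  have "sum c {..<d} = c k + sum c ({..<d} - {k})" using kd by (intro sum.remove) auto
  moreover have "sum ?G {..<d} = ?G k + sum ?G ({..<d} - {k})" using kd by (intro sum.remove) auto
  moreover have "sum ?G ({..<d} - {k}) = sum c ({..<d} - {k})" by (rule sum.cong) auto
  ultimately have "sum ?G {..<d} = m" using c'(3) k by simp
  moreover have "?G (Suc i) \<le> ?G i" for i using c'(1)[of i] k by auto
  ultimately show ?thesis using c'(2) by (auto simp: partitions_def)
qed

text \<open>Rows that do not end in a corner contribute nothing, so the branching recurrence may run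
  over all nonempty rows.\<close>

lemma ballots_decrement_empty:
  assumes "c (Suc k) = c k" "0 < c k"
  shows "ballots (c(k := c k - 1)) = {}"
proof -
  have "w \<notin> ballots (c(k := c k - 1))" for w
  proof
    assume "w \<in> ballots (c(k := c k - 1))"
    then have "(c(k := c k - 1)) (Suc k) \<le> (c(k := c k - 1)) k"
      using ballot_antimono[of w k] by (simp add: ballots_def)
    then show False using assms by simp
  qed
  then show ?thesis by blast
qed

lemma ballots_partitions_0:
  assumes "c \<in> partitions d 0" shows "ballots c = {[]}"
proof (intro equalityI subsetI)
  have c: "c i = 0" for i using assms by (cases "i < d") (auto simp: partitions_def)
  show "w \<in> {[]}" if "w \<in> ballots c" for w
  proof -
    have "i \<notin> set w" for i using c that by (simp add: ballots_def flip: count_list_0_iff)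
    then show "w \<in> {[]}" by (cases w) auto
  qed
  show "w \<in> ballots c" if "w \<in> {[]}" for w using that c by (auto simp: ballots_def)
qed

definition shifted :: "nat \<Rightarrow> (nat \<Rightarrow> nat) \<Rightarrow> nat \<Rightarrow> nat" where
  "shifted d c i = c i + (d - 1 - i)"

theorem card_ballots_formula:
  assumes "c \<in> partitions d m"
  shows "int (card (ballots c)) * (\<Prod>i=0..<d. fact (shifted d c i)) = fact m * alternant d (\<lambda>i. int (shifted d c i))"
  using assms
proof (induction m arbitrary: c)
  case 0
  then have c: "c i = 0" for i by (cases "i < d") (auto simp: partitions_def)
  have "ballots c = {[]}" using 0 by (rule ballots_partitions_0)
  then have "card (ballots c) = 1" by simp
  then show ?case using alternant_staircase[of d] unfolding shifted_def c by simp
next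
  case (Suc m)
  define l where "l i = int (shifted d c i)" for i
  define G where "G k = c(k := c k - 1)" for k
  have c: "\<And>i. c (Suc i) \<le> c i" "\<And>i. i \<ge> d \<Longrightarrow> c i = 0" "sum c {..<d} = Suc m"
    using Suc.prems by (auto simp: partitions_def)
  have main: "int (if 0 < c k then card (ballots (G k)) else 0) * (\<Prod>i=0..<d. fact (shifted d c i))
      = fact m * (l k * alternant d (l(k := l k - 1)))" if k: "k < d" for k
  proof (cases "c (Suc k) < c k")
    case True
    then have pos: "0 < c k" by simp
    have "G k \<in> partitions d m" unfolding G_def by (rule partitions_decrement[OF Suc.prems True])
    note IH = Suc.IH[OF this]
    have e: "(\<lambda>i. int (shifted d (G k) i)) = l(k := l k - 1)"
      using pos by (auto simp: fun_eq_iff l_def G_def shifted_def)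
    have kk: "k \<in> {0..<d}" using k by simp
    have "(\<Prod>i\<in>{0..<d} - {k}. fact (shifted d (G k) i)) = (\<Prod>i\<in>{0..<d} - {k}. fact (shifted d c i) :: int)"
      by (rule prod.cong) (auto simp: G_def shifted_def)
    moreover have "fact (shifted d c k) = l k * fact (shifted d (G k) k)"
      using pos by (cases "c k") (auto simp: l_def G_def shifted_def)
    ultimately have "(\<Prod>i=0..<d. fact (shifted d c i)) = l k * (\<Prod>i=0..<d. fact (shifted d (G k) i))"
      unfolding prod.remove[OF finite_atLeastLessThan kk] by simp
    then show ?thesis using IH pos unfolding e by (simp add: algebra_simps)
  next
    case False
    then have eq: "c (Suc k) = c k" using c(1)[of k] by simp
    \<comment> \<open>Lowering a row that is not a corner makes two shifted parts equal, and the
      determinant vanishes. An empty last row has shifted part \<open>l k = 0\<close>.\<close>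
    have "l k * alternant d (l(k := l k - 1)) = 0"
    proof (cases "Suc k < d")
      case True
      then have "l k - 1 = l (Suc k)" using eq by (simp add: l_def shifted_def)
      then have "alternant d (l(k := l k - 1)) = 0"
        using True k by (intro alternant_eq_0[of k d "Suc k"]) auto
      then show ?thesis by simp
    next
      case False
      then have "c k = 0" "d = Suc k" using eq c(2)[of "Suc k"] k by auto
      then show ?thesis by (simp add: l_def shifted_def)
    qed
    moreover have "0 < c k \<Longrightarrow> ballots (G k) = {}" unfolding G_def by (rule ballots_decrement_empty[OF eq])
    ultimately show ?thesis by simp
  qed
  have "int (card (ballots c)) * (\<Prod>i=0..<d. fact (shifted d c i)) =
     (\<Sum>k=0..<d. int (if 0 < c k then card (ballots (G k)) else 0) * (\<Prod>i=0..<d. fact (shifted d c i)))"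
    unfolding card_ballots_recurrence[OF Suc.prems] G_def by (simp only: of_nat_sum sum_distrib_right)
  also have "\<dots> = (\<Sum>k=0..<d. fact m * (l k * alternant d (l(k := l k - 1))))"
    by (rule sum.cong) (use main in auto)
  also have "\<dots> = fact m * (((\<Sum>k=0..<d. l k) - (\<Sum>k=0..<d. int k)) * alternant d l)"
    unfolding sum_distrib_left[symmetric] alternant_recurrence ..
  \<comment> \<open>The staircase shifts add up to the subtracted sum, so the factor left is the
    size of \<open>c\<close>, and it turns \<open>fact m\<close> into
    \<open>fact (Suc m)\<close>.\<close>
  also have "(\<Sum>k=0..<d. l k) - (\<Sum>k=0..<d. int k) = int (Suc m)"
  proof -
    have "(\<Sum>k=0..<d. int (d - 1 - k)) = (\<Sum>k=0..<d. int k)"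
      using sum.nat_diff_reindex[of int d] by (simp add: atLeast0LessThan)
    moreover have "(\<Sum>k=0..<d. int (c k)) = int (Suc m)" using c(3) by (simp add: atLeast0LessThan flip: of_nat_sum)
    ultimately show ?thesis unfolding l_def shifted_def of_nat_add sum.distrib by linarith
  qed
  finally show ?case by (simp add: l_def mult_ac)
qed

lemma box_complement_partition:
  assumes c: "c \<in> box_partitions d b m"
  shows "box_complement d b c \<in> box_partitions d b (d * b - m)"
proof -
  have p: "c (Suc i) \<le> c i" "c i \<le> b" "i \<ge> d \<Longrightarrow> c i = 0" "sum c {..<d} = m" for i
    using c partitions_le_first[of c d m i] by (auto simp: box_partitions_def partitions_def)
  have "sum (box_complement d b c) {..<d} = (\<Sum>i<d. b - c (d - Suc i))"
    by (rule sum.cong) (auto simp: box_complement_def)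
  also have "\<dots> = (\<Sum>i<d. b - c i)" by (rule sum.nat_diff_reindex)
  also have "\<dots> = (\<Sum>i<d. b) - (\<Sum>i<d. c i)" using p by (intro sum_subtractf_nat) auto
  finally have s: "sum (box_complement d b c) {..<d} = d * b - m" using p by simp
  have "box_complement d b c (Suc i) \<le> box_complement d b c i" for i
  proof (cases "Suc i < d")
    case True
    then have "d - 1 - i = Suc (d - 1 - Suc i)" by auto
    then show ?thesis using p(1)[of "d - 1 - Suc i"] True by (simp add: box_complement_def)
  qed (simp add: box_complement_def)
  then show ?thesis using s by (auto simp: box_partitions_def partitions_def box_complement_def)
qed

text \<open>The shifted parts of the complement are \<open>b + d - 1 - l\<close> in reverse order,
  so the determinants agree up to sign. Since \<open>c\<close> fills half of the box,
  \<open>fact m\<close> is common to both formulas as well, and nonnegativity removes the absolute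
  values.\<close>

theorem card_ballots_box_complement:
  assumes c: "c \<in> box_partitions d b m" and m: "2 * m = d * b"
  shows "card (ballots (box_complement d b c)) * (\<Prod>i=0..<d. fact (b + d - 1 - shifted d c i))
       = card (ballots c) * (\<Prod>i=0..<d. fact (shifted d c i))"
proof -
  let ?c' = "box_complement d b c"
  have cp: "c \<in> partitions d m" and cb: "c i \<le> b" for i
    using c partitions_le_first[of c d m i] by (auto simp: box_partitions_def)
  have "d * b - m = m" using m by simp
  then have cp': "?c' \<in> partitions d m" using box_complement_partition[OF c] by (simp add: box_partitions_def)
  have s: "shifted d ?c' i = b + d - 1 - shifted d c (d - 1 - i)" if "i < d" for i
    using cb[of "d - 1 - i"] that by (auto simp: shifted_def box_complement_def)
  have le: "shifted d c i \<le> b + d - 1" if "i < d" for i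
    using cb[of i] that by (simp add: shifted_def)
  have "(\<Prod>i=0..<d. fact (shifted d ?c' i) :: int) = (\<Prod>i=0..<d. fact (b + d - 1 - shifted d c (d - 1 - i)))"
    by (rule prod.cong) (simp_all add: s)
  also have "\<dots> = (\<Prod>i=0..<d. fact (b + d - 1 - shifted d c i))"
    using prod.nat_diff_reindex[of "\<lambda>i. fact (b + d - 1 - shifted d c i) :: int" d] by (simp add: atLeast0LessThan)
  finally have f': "(\<Prod>i=0..<d. fact (shifted d ?c' i) :: int) = (\<Prod>i=0..<d. fact (b + d - 1 - shifted d c i))" .
  have "\<bar>alternant d (\<lambda>i. int (shifted d ?c' i))\<bar> = \<bar>alternant d (\<lambda>i. int (shifted d c i))\<bar>"
  proof -
    have "alternant d (\<lambda>i. int (shifted d ?c' i)) =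
       alternant d (\<lambda>i. int (b + d - 1) - int (shifted d c (d - 1 - i)))"
    proof -
      have "int (shifted d ?c' i) = int (b + d - 1) - int (shifted d c (d - 1 - i))" if "i < d" for i
        using s[OF that] le[of "d - 1 - i"] that by (simp add: of_nat_diff)
      then have "mat d d (\<lambda>(i, j). falling (int (shifted d ?c' i)) (d - 1 - j)) =
         mat d d (\<lambda>(i, j). falling (int (b + d - 1) - int (shifted d c (d - 1 - i))) (d - 1 - j))"
        by (intro eq_matI) auto
      then show ?thesis by (simp only: alternant_def)
    qed
    then show ?thesis
      using abs_alternant_reflect[of d "int (b + d - 1)" "\<lambda>i. int (shifted d c (d - 1 - i))"]
        abs_alternant_reverse[of d "\<lambda>i. int (shifted d c i)"] by simp
  qed
  then have "\<bar>fact m * alternant d (\<lambda>i. int (shifted d ?c' i))\<bar> = \<bar>fact m * alternant d (\<lambda>i. int (shifted d c i))\<bar>"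
    by (simp add: abs_mult)
  then have "\<bar>int (card (ballots ?c')) * (\<Prod>i=0..<d. fact (shifted d ?c' i))\<bar> =
      \<bar>int (card (ballots c)) * (\<Prod>i=0..<d. fact (shifted d c i))\<bar>"
    unfolding card_ballots_formula[OF cp] card_ballots_formula[OF cp'] .
  then have "int (card (ballots ?c')) * (\<Prod>i=0..<d. fact (b + d - 1 - shifted d c i)) =
      int (card (ballots c)) * (\<Prod>i=0..<d. fact (shifted d c i))"
    unfolding f' by (simp add: prod_nonneg)
  then have "int (card (ballots ?c') * (\<Prod>i=0..<d. fact (b + d - 1 - shifted d c i))) =
      int (card (ballots c) * (\<Prod>i=0..<d. fact (shifted d c i)))" by simp
  then show ?thesis by (simp only: of_nat_eq_iff)
qed

section \<open>Factorial estimates\<close>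

text \<open>Up to a factor these are Poisson weights with mean \<open>n\<close>. A step from
  \<open>n + z\<close> to \<open>n + z + 1\<close> multiplies by \<open>n / (n + z + 1)\<close>,
  which is at most \<open>exp (- (z + 1) / (2 n))\<close> because
  \<open>n + z + 1 \<le> 2 n\<close>; the exponents add up to
  \<open>z (z + 1) / (4 n)\<close>.\<close>

lemma power_fact_ratio_above:
  assumes n: "0 < n" and z: "z \<le> n"
  shows "real n ^ (n + z) / fact (n + z) \<le> real n ^ n / fact n * exp (- (real z * (real z + 1) / (4 * real n)))"
  using z
proof (induction z)
  case (Suc z)
  have np: "0 < real n" "Suc z \<le> n" using n Suc.prems by auto
  have "real n / real (n + Suc z) = 1 - real (Suc z) / real (n + Suc z)"
    using n by (simp add: field_simps)
  also have "\<dots> \<le> 1 - real (Suc z) / (2 * real n)"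
    using np by (intro diff_left_mono divide_left_mono) auto
  also have "\<dots> \<le> exp (- (real (Suc z) / (2 * real n)))"
    using exp_ge_add_one_self[of "- (real (Suc z) / (2 * real n))"] by simp
  finally have r: "real n / real (n + Suc z) \<le> exp (- (real (Suc z) / (2 * real n)))" .
  have "real n ^ (n + Suc z) / fact (n + Suc z) = real n ^ (n + z) / fact (n + z) * (real n / real (n + Suc z))"
    by (simp add: mult_ac)
  also have "\<dots> \<le> (real n ^ n / fact n * exp (- (real z * (real z + 1) / (4 * real n)))) * exp (- (real (Suc z) / (2 * real n)))"
    using Suc by (intro mult_mono r) auto
  also have "\<dots> = real n ^ n / fact n * exp (- (real z * (real z + 1) / (4 * real n)) + - (real (Suc z) / (2 * real n)))"
    by (simp only: exp_add mult.assoc)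
  also have "- (real z * (real z + 1) / (4 * real n)) + - (real (Suc z) / (2 * real n)) = - (real (Suc z) * (real (Suc z) + 1) / (4 * real n))"
    using n by (simp add: field_simps)
  finally show ?case .
qed simp

lemma power_fact_ratio_antimono:
  assumes n: "0 < n" and "n \<le> a" "a \<le> b"
  shows "real n ^ b / fact b \<le> real n ^ a / fact a"
  using assms(3)
proof (induction b rule: dec_induct)
  case (step b)
  have "real n ^ Suc b / fact (Suc b) = real n ^ b / fact b * (real n / real (Suc b))" by (simp add: mult_ac)
  also have "\<dots> \<le> real n ^ b / fact b * 1"
    using step assms by (intro mult_left_mono) auto
  finally show ?case using step by simp
qed simp

text \<open>Here a step multiplies by exactly \<open>1 - z / n\<close>, so the exponents add up to
  \<open>z (z - 1) / (2 n)\<close>.\<close>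

lemma power_fact_ratio_below:
  assumes n: "0 < n" and z: "z \<le> n"
  shows "real n ^ (n - z) / fact (n - z) \<le> real n ^ n / fact n * exp (- (real z * (real z - 1) / (2 * real n)))"
  using z
proof (induction z)
  case (Suc z)
  then have e: "n - z = Suc (n - Suc z)" by simp
  have "real n ^ (n - Suc z) / fact (n - Suc z) = real n ^ (n - z) / fact (n - z) * (real (n - z) / real n)"
    unfolding e using n by (simp add: fact_Suc del: of_nat_Suc)
  also have "real (n - z) / real n = 1 - real z / real n" using Suc.prems n by (simp add: of_nat_diff field_simps)
  also have "real n ^ (n - z) / fact (n - z) * (1 - real z / real n) \<le>
      (real n ^ n / fact n * exp (- (real z * (real z - 1) / (2 * real n)))) * exp (- (real z / real n))"
    using Suc exp_ge_add_one_self[of "- (real z / real n)"] n by (intro mult_mono) auto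
  also have "\<dots> = real n ^ n / fact n * exp (- (real z * (real z - 1) / (2 * real n)) + - (real z / real n))"
    by (simp only: exp_add mult.assoc)
  also have "- (real z * (real z - 1) / (2 * real n)) + - (real z / real n) = - (real (Suc z) * (real (Suc z) - 1) / (2 * real n))"
    using n by (simp add: field_simps)
  finally show ?case .
qed simp

lemma power_fact_ratio_le:
  assumes n: "0 < n"
  shows "real n ^ c / fact c \<le> real n ^ n / fact n"
proof (cases "n \<le> c")
  case True
  then show ?thesis using power_fact_ratio_antimono[OF n order.refl] by blast
next
  case False
  have "0 \<le> real (n - c) * (real (n - c) - 1) / (2 * real n)" using False by auto
  then have "real n ^ n / fact n * exp (- (real (n - c) * (real (n - c) - 1) / (2 * real n))) \<le> real n ^ n / fact n * 1"
    by (intro mult_left_mono) auto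
  then show ?thesis using power_fact_ratio_below[OF n, of "n - c"] False by simp
qed

text \<open>The exponent combines the worse numerator and the worse denominator of the two one-sided
  estimates.\<close>

lemma power_fact_ratio_far:
  assumes n: "0 < n" and s: "1 \<le> s" "s \<le> n" and c: "n + s \<le> c \<or> c + s \<le> n"
  shows "real n ^ c / fact c \<le> real n ^ n / fact n * exp (- (real s * (real s - 1) / (4 * real n)))"
  using c
proof
  assume "n + s \<le> c"
  then have "real n ^ c / fact c \<le> real n ^ (n + s) / fact (n + s)"
    by (intro power_fact_ratio_antimono[OF n]) auto
  also have "\<dots> \<le> real n ^ n / fact n * exp (- (real s * (real s + 1) / (4 * real n)))"
    by (rule power_fact_ratio_above[OF n s(2)])
  also have "\<dots> \<le> real n ^ n / fact n * exp (- (real s * (real s - 1) / (4 * real n)))"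
    using n s by (intro mult_left_mono) (auto intro!: divide_right_mono mult_left_mono)
  finally show ?thesis .
next
  assume c: "c + s \<le> n"
  define z where "z = n - c"
  have z: "s \<le> z" "z \<le> n" "n - z = c" using c by (auto simp: z_def)
  have "real s * (real s - 1) \<le> real z * (real z - 1)" using z s by (intro mult_mono) auto
  moreover have "0 \<le> real s * (real s - 1)" using s by simp
  ultimately have "real s * (real s - 1) / (4 * real n) \<le> real z * (real z - 1) / (2 * real n)"
    using n by (intro frac_le) auto
  then have "real n ^ n / fact n * exp (- (real z * (real z - 1) / (2 * real n)))
      \<le> real n ^ n / fact n * exp (- (real s * (real s - 1) / (4 * real n)))"
    by (intro mult_left_mono) auto
  then show ?thesis using power_fact_ratio_below[OF n z(2)] z(3) by simp
qed

section \<open>Quotients of factorials near the centre\<close>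

lemma fact_ratio_square:
  "((fact (e + u) / fact e) :: real)\<^sup>2 = (\<Prod>j=1..u. real (e + j) * real (e + (Suc u - j)))"
proof -
  have p: "fact (e + u) / fact e = (\<Prod>j=1..u. real (e + j))" for u
    by (induction u) (simp_all add: field_simps)
  \<comment> \<open>Reversing one copy of the product supplies the partners; with the square no
    middle factor has to be singled out.\<close>
  have "(\<Prod>j=1..u. real (e + j)) = (\<Prod>j=1..u. real (e + (Suc u - j)))"
    by (rule prod.reindex_bij_witness[of _ "\<lambda>j. Suc u - j" "\<lambda>j. Suc u - j"]) auto
  then show ?thesis unfolding p power2_eq_square by (simp add: prod.distrib)
qed

text \<open>Pairing the factors of \<open>(e+1)\<cdots>(e+u)\<close> symmetrically around their mean \<open>x = e + (u+1)/2\<close>.\<close>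

lemma fact_ratio_bounds:
  fixes e u :: nat
  defines "x \<equiv> real e + (real u + 1) / 2"
  shows "fact (e + u) \<le> fact e * x ^ u"
    and "fact e * x ^ u * (1 - (real u / (2 * x))\<^sup>2) ^ u \<le> fact (e + u)"
proof -
  define r where "r = (fact (e + u) / fact e :: real)"
  have "0 \<le> real e" "0 \<le> real u" by simp_all
  then have x: "0 < x" "real u / 2 \<le> x" unfolding x_def by (simp_all add: field_simps)
  define \<theta> where "\<theta> = 1 - (real u / (2 * x))\<^sup>2"
  have "real u / (2 * x) \<le> 1" "0 \<le> real u / (2 * x)" using x by (auto simp: field_simps)
  then have \<theta>: "0 \<le> \<theta>" "\<theta> \<le> 1" by (auto simp: \<theta>_def power_le_one)
  have r0: "0 \<le> r" by (simp add: r_def)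
  have fac: "real (e + j) * real (e + (Suc u - j)) = x\<^sup>2 - (x - real (e + j))\<^sup>2" if "j \<in> {1..u}" for j
    using that by (simp add: x_def of_nat_diff power2_eq_square field_simps)
  have sq: "(x - real (e + j))\<^sup>2 \<le> (real u / 2)\<^sup>2" if "j \<in> {1..u}" for j
  proof -
    have "\<bar>x - real (e + j)\<bar> \<le> real u / 2" using that by (auto simp: x_def abs_le_iff field_simps)
    then show ?thesis by (metis abs_ge_zero power2_abs power_mono)
  qed
  have "r\<^sup>2 \<le> (\<Prod>j=1..u. x\<^sup>2)"
    unfolding r_def fact_ratio_square
  proof (rule prod_mono)
    fix j assume j: "j \<in> {1..u}"
    have "real (e + j) * real (e + (Suc u - j)) \<le> x\<^sup>2" unfolding fac[OF j] by simp
    then show "0 \<le> real (e + j) * real (e + (Suc u - j)) \<and> real (e + j) * real (e + (Suc u - j)) \<le> x\<^sup>2"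
      by (intro conjI mult_nonneg_nonneg of_nat_0_le_iff)
  qed
  also have "\<dots> = (x ^ u)\<^sup>2" by (simp add: power_mult[symmetric] mult.commute)
  finally have "r \<le> x ^ u" using x by (auto intro: power2_le_imp_le)
  then show "fact (e + u) \<le> fact e * x ^ u" by (simp add: r_def field_simps)
  \<comment> \<open>The pairing gives \<open>\<theta>\<close> to the power \<open>u / 2\<close>;
    passing to the smaller \<open>\<theta> ^ u\<close> avoids half-integral exponents.\<close>
  have "(x ^ u * \<theta> ^ u)\<^sup>2 \<le> (\<Prod>j=1..u. x\<^sup>2 * \<theta>)"
  proof -
    have "(x ^ u * \<theta> ^ u)\<^sup>2 = (x ^ u)\<^sup>2 * (\<theta> ^ u * \<theta> ^ u)" by (simp add: power2_eq_square)
    also have "\<dots> \<le> (x ^ u)\<^sup>2 * (\<theta> ^ u * 1)"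
      using \<theta> by (intro mult_left_mono) (auto simp: power_le_one)
    also have "\<dots> = (\<Prod>j=1..u. x\<^sup>2 * \<theta>)"
      by (simp add: power_mult_distrib power_mult[symmetric] mult.commute)
    finally show ?thesis .
  qed
  also have "\<dots> \<le> r\<^sup>2"
    unfolding r_def fact_ratio_square
  proof (rule prod_mono)
    fix j assume j: "j \<in> {1..u}"
    have "x\<^sup>2 * \<theta> = x\<^sup>2 - (real u / 2)\<^sup>2" using x by (simp add: \<theta>_def field_simps power2_eq_square)
    then have "x\<^sup>2 * \<theta> \<le> real (e + j) * real (e + (Suc u - j))"
      unfolding fac[OF j] using sq[OF j] by linarith
    then show "0 \<le> x\<^sup>2 * \<theta> \<and> x\<^sup>2 * \<theta> \<le> real (e + j) * real (e + (Suc u - j))"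
      using \<theta>(1) by simp
  qed
  finally have "x ^ u * \<theta> ^ u \<le> r" using r0 by (rule power2_le_imp_le)
  then show "fact e * x ^ u * (1 - (real u / (2 * x))\<^sup>2) ^ u \<le> fact (e + u)"
    by (simp add: r_def \<theta>_def field_simps)
qed

text \<open>Between \<open>K - a\<close> and \<open>a\<close> the factors average to
  \<open>x\<close>, so \<open>fact a / fact (K - a)\<close> is close to \<open>x\<close> to the
  power \<open>2 a - K\<close>. For \<open>K - a \<le> a\<close> the loss is at most
  \<open>u (u / (K + 1))^2\<close> by Bernoulli's inequality, where \<open>u = 2 a - K\<close>; for
  smaller \<open>a\<close> the upper bound on factorials already suffices. The powers of
  \<open>x\<close> are kept on separate sides so that they can cancel in a product over the
  parts.\<close>

lemma fact_reflect_bound: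
  fixes a K U :: nat
  assumes a: "a \<le> K" and U: "\<bar>2 * real a - real K\<bar> \<le> real U" "U \<le> K"
  defines "x \<equiv> (real K + 1) / 2"
  shows "fact (K - a) * x ^ a * (1 - real U ^ 3 / (real K + 1)\<^sup>2) \<le> fact a * x ^ (K - a)"
proof (cases "K - a \<le> a")
  case True
  define e u where "e = K - a" and "u = a - (K - a)"
  have au: "a = e + u" "K = 2 * e + u" using a True by (auto simp: e_def u_def)
  have uU: "u \<le> U" using U a unfolding au by simp
  have x: "x = real e + (real u + 1) / 2" unfolding x_def au by (simp add: field_simps)
  have xp: "0 < x" by (simp add: x_def)
  have K: "2 * x = real K + 1" by (simp add: x_def)
  have q: "(real u / (2 * x))\<^sup>2 \<le> 1" unfolding K au by (simp add: power_le_one)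
  have "1 - real U ^ 3 / (real K + 1)\<^sup>2 \<le> 1 - real u ^ 3 / (real K + 1)\<^sup>2"
    using uU by (intro diff_left_mono divide_right_mono power_mono) auto
  also have "\<dots> = 1 + real u * (- (real u / (2 * x))\<^sup>2)"
    unfolding K by (simp add: power_divide power2_eq_square power3_eq_cube)
  also have "\<dots> \<le> (1 + - (real u / (2 * x))\<^sup>2) ^ u"
    by (rule Bernoulli_inequality) (use q in simp)
  finally have B: "1 - real U ^ 3 / (real K + 1)\<^sup>2 \<le> (1 - (real u / (2 * x))\<^sup>2) ^ u" by simp
  have "fact (K - a) * x ^ a * (1 - real U ^ 3 / (real K + 1)\<^sup>2)
      \<le> fact (K - a) * x ^ a * (1 - (real u / (2 * x))\<^sup>2) ^ u"
    using xp by (intro mult_left_mono B) auto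
  also have "\<dots> = x ^ e * (fact e * x ^ u * (1 - (real u / (2 * x))\<^sup>2) ^ u)"
    unfolding au by (simp add: power_add)
  also have "\<dots> \<le> x ^ e * fact (e + u)"
    using xp fact_ratio_bounds(2)[of e u] unfolding x[symmetric] by (intro mult_left_mono) auto
  also have "\<dots> = fact a * x ^ (K - a)" unfolding au by simp
  finally show ?thesis .
next
  case False
  define e u where "e = a" and "u = K - a - a"
  have au: "a = e" "K = 2 * e + u" using a False by (auto simp: e_def u_def)
  have Ka: "K - a = e + u" using au by simp
  have x: "x = real e + (real u + 1) / 2" unfolding x_def au by (simp add: field_simps)
  have xp: "0 < x" by (simp add: x_def)
  have "fact (K - a) * x ^ a * (1 - real U ^ 3 / (real K + 1)\<^sup>2) \<le> fact (K - a) * x ^ a * 1"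
    using xp by (intro mult_left_mono) auto
  also have "\<dots> = x ^ e * fact (e + u)" unfolding Ka by (simp add: au(1))
  also have "\<dots> \<le> x ^ e * (fact e * x ^ u)"
    using xp fact_ratio_bounds(1)[of e u] unfolding x[symmetric] by (intro mult_left_mono) auto
  also have "\<dots> = fact a * x ^ (K - a)" unfolding Ka by (simp add: power_add au(1))
  finally show ?thesis .
qed

text \<open>Eventually both bases are at most \<open>n^2\<close>, which leaves the power
  \<open>n ^ (2 * d + 4 * (d * d))\<close> against an exponential whose exponent is of order
  \<open>- n^(1/5)\<close>.\<close>

lemma limit_tail:
  fixes d :: nat
  shows "(\<lambda>n. (real d * real n + 1) ^ d * ((real n + real d) ^ (d * d) * exp (- ((real n powr (3/5) - 1) * (real n powr (3/5) - 2) / (4 * real n))))\<^sup>2) \<longlonglongrightarrow> 0"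
    (is "?f \<longlonglongrightarrow> 0")
proof -
  let ?E = "\<lambda>n. (real n powr (3/5) - 1) * (real n powr (3/5) - 2) / (4 * real n)"
  let ?g = "\<lambda>n. real n ^ (2 * d + 4 * (d * d)) * exp (- (2 * ?E n))"
  have "\<forall>\<^sub>F n in sequentially. real d * real n + 1 \<le> real n ^ 2" by real_asymp
  moreover have "\<forall>\<^sub>F n in sequentially. real n + real d \<le> real n ^ 2" by real_asymp
  ultimately have "\<forall>\<^sub>F n in sequentially. ?f n \<le> ?g n"
  proof eventually_elim
    case (elim n)
    have "(real d * real n + 1) ^ d * ((real n + real d) ^ (d * d))\<^sup>2 \<le> (real n ^ 2) ^ d * ((real n ^ 2) ^ (d * d))\<^sup>2"
      using elim by (intro mult_mono power_mono) auto
    also have "\<dots> = real n ^ (2 * d + 4 * (d * d))"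
      by (simp add: power_mult[symmetric] power_add mult_ac)
    finally have "(real d * real n + 1) ^ d * ((real n + real d) ^ (d * d))\<^sup>2 * (exp (- ?E n))\<^sup>2
        \<le> real n ^ (2 * d + 4 * (d * d)) * (exp (- ?E n))\<^sup>2"
      by (intro mult_right_mono) auto
    moreover have "(exp (- ?E n))\<^sup>2 = exp (- (2 * ?E n))"
      unfolding exp_double[symmetric] by simp
    ultimately show ?case unfolding power_mult_distrib by (simp only: mult.assoc)
  qed
  moreover have "?g \<longlonglongrightarrow> 0" by real_asymp
  moreover have "\<forall>\<^sub>F n in sequentially. 0 \<le> ?f n" by (intro always_eventually allI) simp
  ultimately show ?thesis using tendsto_sandwich[of "\<lambda>_. 0" ?f sequentially ?g 0] by simp
qed

lemma limit_bulk:
  fixes d :: nat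
  shows "(\<lambda>n. (2 * real n powr (3/5) + real d) ^ 3 / (2 * real n + real d)\<^sup>2) \<longlonglongrightarrow> 0"
  by real_asymp

section \<open>Asymptotic comparison\<close>

lemma card_ballots_pos: "c \<in> partitions d m \<Longrightarrow> 0 < card (ballots c)"
proof (induction m arbitrary: c)
  case 0
  then show ?case using ballots_partitions_0 by simp
next
  case (Suc m)
  have c: "\<forall>i\<ge>d. c i = 0" "sum c {..<d} = Suc m" using Suc.prems by (auto simp: partitions_def)
  define X where "X = {i. i < d \<and> 0 < c i}"
  have X: "finite X" "X \<noteq> {}" using c(2) by (auto simp: X_def intro: ccontr)
  \<comment> \<open>The lowest nonempty row always ends in a corner.\<close>
  define k where "k = Max X"
  have k: "k \<in> X" unfolding k_def using X by (rule Max_in)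
  have "Suc k \<notin> X" using Max_ge[OF X(1), of "Suc k"] by (auto simp: k_def)
  then have "c (Suc k) = 0" using c(1) by (cases "Suc k < d") (auto simp: X_def)
  then have "c(k := c k - 1) \<in> partitions d m"
    using k by (intro partitions_decrement[OF Suc.prems]) (simp add: X_def)
  then have "ballots (c(k := c k - 1)) \<noteq> {}" using Suc.IH by fastforce
  then have "ballots c \<noteq> {}" using k unfolding ballots_Cons[OF Suc.prems] X_def by blast
  then show ?case using finite_ballots[OF c(1)] by (simp add: card_gt_0_iff)
qed

text \<open>Lattice words are some of the words with content \<open>c\<close>. Inductively, the
  summand of row \<open>k\<close> in the branching rule is at most \<open>c k * fact m\<close>, and
  the parts add up to \<open>Suc m\<close>.\<close>

lemma card_ballots_le_multinomial:
  "c \<in> partitions d m \<Longrightarrow> card (ballots c) * (\<Prod>i<d. fact (c i)) \<le> fact m"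
proof (induction m arbitrary: c)
  case 0
  then have "c i = 0" for i by (cases "i < d") (auto simp: partitions_def)
  then show ?case using ballots_partitions_0[OF 0] by simp
next
  case (Suc m)
  have c: "\<And>i. c (Suc i) \<le> c i" "sum c {..<d} = Suc m" using Suc.prems by (auto simp: partitions_def)
  have main: "(if 0 < c k then card (ballots (c(k := c k - 1))) else 0) * (\<Prod>i<d. fact (c i)) \<le> c k * fact m"
    if k: "k < d" for k
  proof (cases "c (Suc k) < c k")
    case True
    let ?G = "c(k := c k - 1)"
    have kk: "k \<in> {..<d}" using k by simp
    have "(\<Prod>i\<in>{..<d} - {k}. fact (?G i)) = (\<Prod>i\<in>{..<d} - {k}. fact (c i) :: nat)"
      by (rule prod.cong) auto
    moreover have "fact (c k) = c k * fact (?G k)" using True by (cases "c k") auto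
    ultimately have "(\<Prod>i<d. fact (c i)) = c k * (\<Prod>i<d. fact (?G i))"
      unfolding prod.remove[OF finite_lessThan kk] by simp
    moreover have "card (ballots ?G) * (\<Prod>i<d. fact (?G i)) \<le> fact m"
      by (rule Suc.IH[OF partitions_decrement[OF Suc.prems True]])
    ultimately show ?thesis using True by (simp add: mult.left_commute)
  next
    case False
    then have "c (Suc k) = c k" using c(1)[of k] by simp
    then show ?thesis using ballots_decrement_empty by simp
  qed
  have "card (ballots c) * (\<Prod>i<d. fact (c i)) \<le> (\<Sum>k=0..<d. c k * fact m)"
    unfolding card_ballots_recurrence[OF Suc.prems] sum_distrib_right using main by (intro sum_mono) auto
  also have "\<dots> = fact (Suc m)" using c(2) by (simp add: atLeast0LessThan flip: sum_distrib_right)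
  finally show ?case .
qed

section \<open>Shapes far from the rectangle\<close>

lemma rect_partition: "rect d b \<in> partitions d (d * b)"
  by (auto simp: partitions_def rect_def)

lemma fact_add_le: "n + j \<le> B \<Longrightarrow> fact (n + j) \<le> fact n * B ^ j"
proof (induction j)
  case (Suc j)
  have "fact (n + Suc j) = Suc (n + j) * fact (n + j)" by simp
  also have "\<dots> \<le> B * (fact n * B ^ j)" using Suc by (intro mult_mono) auto
  finally show ?case by (simp add: mult_ac)
qed simp

text \<open>The determinant is a positive integer, hence at least 1. Replacing the shifted
  factorials by \<open>fact n\<close> costs at most \<open>(n + d) ^ d\<close> per row.\<close>

lemma card_ballots_rect_lower:
  assumes d: "0 < d"
  shows "fact (d * n) \<le> card (ballots (rect d n)) * (fact n ^ d * (n + d) ^ (d * d))"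
proof -
  let ?F = "card (ballots (rect d n))" and ?a = "alternant d (\<lambda>i. int (shifted d (rect d n) i))"
  have F: "0 < ?F" by (rule card_ballots_pos[OF rect_partition])
  note eq = card_ballots_formula[OF rect_partition, of d n]
  have "0 < int ?F * (\<Prod>i=0..<d. fact (shifted d (rect d n) i))" using F by (simp add: prod_pos)
  then have "0 < ?a" unfolding eq by (simp add: zero_less_mult_iff)
  then have "fact (d * n) * 1 \<le> fact (d * n) * ?a" by (intro mult_left_mono) auto
  then have "int (fact (d * n)) \<le> int (?F * (\<Prod>i=0..<d. fact (shifted d (rect d n) i)))"
    unfolding eq[symmetric] by simp
  then have "fact (d * n) \<le> ?F * (\<Prod>i=0..<d. fact (shifted d (rect d n) i))" by (simp only: of_nat_le_iff)
  also have "(\<Prod>i=0..<d. fact (shifted d (rect d n) i)) \<le> (\<Prod>i=0..<d. fact n * (n + d) ^ d)"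
  proof (rule prod_mono)
    fix i assume "i \<in> {0..<d}"
    then have i: "shifted d (rect d n) i = n + (d - 1 - i)" "n + (d - 1 - i) \<le> n + d" "d - 1 - i \<le> d"
      by (auto simp: shifted_def rect_def)
    have "fact (shifted d (rect d n) i) \<le> fact n * (n + d) ^ (d - 1 - i)"
      unfolding i(1) by (rule fact_add_le[OF i(2)])
    also have "\<dots> \<le> fact n * (n + d) ^ d" using d i(3) by (intro mult_left_mono power_increasing) auto
    finally show "(0::nat) \<le> fact (shifted d (rect d n) i) \<and> fact (shifted d (rect d n) i) \<le> fact n * (n + d) ^ d"
      by (intro conjI le0)
  qed
  also have "(\<Prod>i=0..<d. fact n * (n + d) ^ d) = fact n ^ d * (n + d) ^ (d * d)"
    by (simp add: power_mult_distrib power_mult)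
  finally show ?thesis by simp
qed

text \<open>In the multinomial bound each \<open>n ^ c j / fact (c j)\<close> is at most its value
  at \<open>n\<close>, and the factor of the distant part \<open>i\<close> is smaller by the
  exponential. The result is measured against the rectangle with \<open>n\<close> columns, which is
  itself one of the shapes.\<close>

lemma card_ballots_far:
  assumes d: "0 < d" and n: "0 < n" and s: "1 \<le> s" "s \<le> n"
    and c: "c \<in> partitions d (d * n)" and far: "i < d" "n + s \<le> c i \<or> c i + s \<le> n"
  shows "real (card (ballots c)) \<le> real (card (ballots (rect d n))) *
    ((real n + real d) ^ (d * d) * exp (- (real s * (real s - 1) / (4 * real n))))"
proof -
  define q where "q = real s * (real s - 1) / (4 * real n)"
  have ii: "i \<in> {..<d}" using far by simp
  have card: "card ({..<d} - {i}) = d - 1" using ii by simp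
  have "(\<Prod>j<d. real n ^ c j / fact (c j)) \<le> (real n ^ n / fact n * exp (- q)) * (real n ^ n / fact n) ^ (d - 1)"
    unfolding prod.remove[OF finite_lessThan ii] card[symmetric] prod_constant[symmetric] q_def
    by (intro mult_mono prod_mono conjI power_fact_ratio_far[OF n s far(2)] power_fact_ratio_le[OF n] prod_nonneg)
      (auto intro!: mult_nonneg_nonneg)
  also have "\<dots> = (real n ^ n / fact n) ^ d * exp (- q)"
    using d by (cases d) auto
  \<comment> \<open>The parts add up to \<open>d * n\<close>, so the powers of \<open>n\<close> are
    the same on both sides and cancel.\<close>
  also have "(\<Prod>j<d. real n ^ c j / fact (c j)) = real n ^ (d * n) / (\<Prod>j<d. fact (c j))"
    using c by (simp add: prod_dividef partitions_def flip: power_sum)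
  also have "(real n ^ n / fact n) ^ d = real n ^ (d * n) / fact n ^ d"
    by (simp add: power_divide power_mult[symmetric] mult.commute)
  finally have "real n ^ (d * n) * (1 / (\<Prod>j<d. fact (c j))) \<le> real n ^ (d * n) * (exp (- q) / fact n ^ d)" by simp
  moreover have "0 < real n ^ (d * n)" using n by simp
  ultimately have 1: "1 / (\<Prod>j<d. fact (c j)) \<le> exp (- q) / fact n ^ d" by (rule mult_left_le_imp_le)
  have pos: "0 < (\<Prod>j<d. fact (c j) :: real)" by (simp add: prod_pos)
  have "real (card (ballots c) * (\<Prod>j<d. fact (c j))) \<le> real (fact (d * n))"
    using card_ballots_le_multinomial[OF c] by (simp only: of_nat_le_iff)
  then have "real (card (ballots c)) \<le> fact (d * n) * (1 / (\<Prod>j<d. fact (c j)))"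
    using pos by (simp add: field_simps)
  also have "\<dots> \<le> fact (d * n) * (exp (- q) / fact n ^ d)" by (intro mult_left_mono 1) auto
  also have "\<dots> \<le> (real (card (ballots (rect d n))) * (fact n ^ d * (real n + real d) ^ (d * d))) * (exp (- q) / fact n ^ d)"
  proof (rule mult_right_mono)
    have "real (fact (d * n)) \<le> real (card (ballots (rect d n)) * (fact n ^ d * (n + d) ^ (d * d)))"
      using card_ballots_rect_lower[OF d, of n] by (simp only: of_nat_le_iff)
    then show "fact (d * n) \<le> real (card (ballots (rect d n))) * (fact n ^ d * (real n + real d) ^ (d * d))" by simp
  qed simp
  finally show ?thesis unfolding q_def by (simp add: mult_ac)
qed

section \<open>Shapes near the rectangle\<close>

lemma card_ballots_near:
  assumes s: "s < n" and c: "c \<in> partitions d (d * n)"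
    and near: "\<And>i. i < d \<Longrightarrow> c i < n + s \<and> n < c i + s" and d: "0 < d"
    and \<delta>: "(2 * real s + real d) ^ 3 / (2 * real n + real d)\<^sup>2 \<le> 1"
  shows "c \<in> box_partitions d (2 * n) (d * n)"
    and "real (card (ballots c)) * (1 - (2 * real s + real d) ^ 3 / (2 * real n + real d)\<^sup>2) ^ d
      \<le> real (card (ballots (box_complement d (2 * n) c)))"
proof -
  show box: "c \<in> box_partitions d (2 * n) (d * n)"
    using c near[OF d] s by (simp add: box_partitions_def)
  \<comment> \<open>Reflection sends \<open>l i\<close> to \<open>K - l i\<close>, and
    \<open>K + 1 = 2 n + d\<close> is the denominator in \<open>\<delta>\<close>. A part within
    \<open>s\<close> of \<open>n\<close>, together with its staircase shift, keeps
    \<open>2 * l i\<close> within \<open>2 * s + d\<close> of \<open>K\<close>.\<close>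
  define K l x \<delta> where "K = 2 * n + d - 1" and "l = shifted d c" and "x = (real K + 1) / 2"
    and "\<delta> = (2 * real s + real d) ^ 3 / (2 * real n + real d)\<^sup>2"
  have K: "real K = 2 * real n + real d - 1" using d by (simp add: K_def of_nat_diff)
  have x: "0 < x" by (simp add: x_def)
  have l: "l i \<le> K" "real (l i) = real (c i) + (real d - 1 - real i)" if "i < d" for i
    using near[OF that] s that by (auto simp: l_def shifted_def K_def of_nat_diff)
  have b: "fact (K - l i) * x ^ l i * (1 - \<delta>) \<le> fact (l i) * x ^ (K - l i)" if i: "i < d" for i
  proof -
    have c_i: "real (c i) < real n + real s" "real n < real (c i) + real s"
      using near[OF i] by linarith+
    have "real i + 1 \<le> real d" using i by linarith
    then have 1: "\<bar>2 * real (l i) - real K\<bar> \<le> real (2 * s + d)"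
      unfolding l(2)[OF i] K using c_i by (simp add: abs_le_iff)
    have "2 * s + d \<le> K" using s by (simp add: K_def)
    from fact_reflect_bound[OF l(1)[OF i] 1 this]
    show ?thesis unfolding x_def \<delta>_def K by simp
  qed
  \<comment> \<open>The shifted parts have mean \<open>K / 2\<close>, so reflection preserves their
    sum and the powers of \<open>x\<close> cancel in the product over all rows.\<close>
  have S: "(\<Sum>i=0..<d. l i) = (\<Sum>i=0..<d. K - l i)"
  proof -
    have r: "(\<Sum>i=0..<d. real (d - 1 - i)) = (\<Sum>i=0..<d. real i)"
      using sum.nat_diff_reindex[of real d] by (simp add: atLeast0LessThan)
    have "(\<Sum>i=0..<d. real (d - 1 - i)) + (\<Sum>i=0..<d. real i) = (\<Sum>i=0..<d. real d - 1)"
      unfolding sum.distrib[symmetric] by (rule sum.cong) (auto simp: of_nat_diff)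
    then have r2: "2 * (\<Sum>i=0..<d. real (d - 1 - i)) = real d * (real d - 1)" using r by simp
    have "(\<Sum>i=0..<d. real (c i)) = real (d * n)"
      using c by (simp add: partitions_def atLeast0LessThan flip: of_nat_sum)
    then have sl: "2 * (\<Sum>i=0..<d. real (l i)) = 2 * real d * real n + real d * (real d - 1)"
      using r2 unfolding l_def shifted_def of_nat_add sum.distrib by simp
    have "(\<Sum>i=0..<d. real (K - l i)) = (\<Sum>i=0..<d. real K - real (l i))"
      using l(1) by (intro sum.cong) (auto simp: of_nat_diff)
    also have "\<dots> = real d * real K - (\<Sum>i=0..<d. real (l i))" by (simp add: sum_subtractf)
    also have "\<dots> = (\<Sum>i=0..<d. real (l i))" using sl unfolding K by (simp add: algebra_simps)
    finally have "real (\<Sum>i=0..<d. K - l i) = real (\<Sum>i=0..<d. l i)" by simp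
    then show ?thesis by (simp only: of_nat_eq_iff)
  qed
  have "(\<Prod>i=0..<d. fact (K - l i) * x ^ l i * (1 - \<delta>)) \<le> (\<Prod>i=0..<d. fact (l i) * x ^ (K - l i))"
    using b x \<delta> by (intro prod_mono) (auto simp: \<delta>_def)
  then have "x ^ (\<Sum>i=0..<d. l i) * ((\<Prod>i=0..<d. fact (K - l i)) * (1 - \<delta>) ^ d)
      \<le> x ^ (\<Sum>i=0..<d. l i) * (\<Prod>i=0..<d. fact (l i))"
    unfolding prod.distrib power_sum[symmetric] S[symmetric] by (simp add: mult_ac)
  then have p: "(\<Prod>i=0..<d. fact (K - l i)) * (1 - \<delta>) ^ d \<le> (\<Prod>i=0..<d. fact (l i))"
    using x by simp
  have e: "real (card (ballots (box_complement d (2 * n) c))) * (\<Prod>i=0..<d. fact (K - l i))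
      = real (card (ballots c)) * (\<Prod>i=0..<d. fact (l i))"
  proof -
    have "2 * (d * n) = d * (2 * n)" by simp
    from arg_cong[OF card_ballots_box_complement[OF box this], of real]
    show ?thesis unfolding K_def l_def by simp
  qed
  have "(\<Prod>i=0..<d. fact (K - l i)) * (real (card (ballots c)) * (1 - \<delta>) ^ d)
      \<le> (\<Prod>i=0..<d. fact (K - l i)) * real (card (ballots (box_complement d (2 * n) c)))"
    using mult_left_mono[OF p, of "real (card (ballots c))"] e by (simp add: mult_ac)
  moreover have "0 < (\<Prod>i=0..<d. fact (K - l i) :: real)" by (simp add: prod_pos)
  ultimately have "real (card (ballots c)) * (1 - \<delta>) ^ d \<le> real (card (ballots (box_complement d (2 * n) c)))"
    by (simp only: mult_le_cancel_left_pos)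
  then show "real (card (ballots c)) * (1 - (2 * real s + real d) ^ 3 / (2 * real n + real d)\<^sup>2) ^ d
      \<le> real (card (ballots (box_complement d (2 * n) c)))" by (simp only: \<delta>_def)
qed

lemma card_partitions_le: "card (partitions d m) \<le> (m + 1) ^ d"
proof -
  have "card (partitions d m) \<le> card ({..<d} \<rightarrow>\<^sub>E {..m})"
  proof (rule card_inj_on_le[of "\<lambda>c. restrict c {..<d}"])
    show "inj_on (\<lambda>c. restrict c {..<d}) (partitions d m)"
    proof (rule inj_onI)
      fix a b assume *: "a \<in> partitions d m" "b \<in> partitions d m" "restrict a {..<d} = restrict b {..<d}"
      show "a = b"
      proof
        fix i
        have "restrict a {..<d} i = restrict b {..<d} i" by (simp only: *(3))
        then show "a i = b i" using *(1,2) by (cases "i < d") (auto simp: partitions_def)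
      qed
    qed
    show "(\<lambda>c. restrict c {..<d}) ` partitions d m \<subseteq> {..<d} \<rightarrow>\<^sub>E {..m}"
    proof (rule image_subsetI)
      fix c assume "c \<in> partitions d m"
      then have "c i \<le> m" if "i < d" for i
        using that member_le_sum[of i "{..<d}" c] by (auto simp: partitions_def)
      then show "restrict c {..<d} \<in> {..<d} \<rightarrow>\<^sub>E {..m}" by auto
    qed
  qed (auto intro: finite_PiE)
  then show ?thesis by (simp add: card_PiE)
qed

section \<open>Comparison of the two sums\<close>

definition sum_squares :: "nat \<Rightarrow> nat \<Rightarrow> real" where
  "sum_squares d n = (\<Sum>c\<in>partitions d (d * n). (real (card (ballots c)))\<^sup>2)"

definition sum_dual :: "nat \<Rightarrow> nat \<Rightarrow> real" where
  "sum_dual d n = (\<Sum>c\<in>box_partitions d (2 * n) (d * n).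
     real (card (ballots c)) * real (card (ballots (box_complement d (2 * n) c))))"

lemma sum_squares_pos: "0 < sum_squares d n"
  unfolding sum_squares_def
proof (rule sum_pos)
  show "partitions d (d * n) \<noteq> {}" using rect_partition by blast
qed (auto simp: finite_partitions card_ballots_pos)

text \<open>Each product is at most the mean of the two squares, and complementation permutes the
  shapes in the box, so both squares have the same sum.\<close>

lemma sum_dual_le: "sum_dual d n \<le> sum_squares d n"
proof -
  let ?X = "box_partitions d (2 * n) (d * n)" and ?f = "\<lambda>c. real (card (ballots c))"
  let ?k = "box_complement d (2 * n)"
  have kX: "?k c \<in> ?X" if "c \<in> ?X" for c
    using box_complement_partition[OF that] by (simp add: mult.commute)
  have kk: "?k (?k c) = c" if "c \<in> ?X" for c
  proof
    fix i
    have "c i \<le> 2 * n" using that partitions_le_first[of c d "d * n" i] by (auto simp: box_partitions_def)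
    moreover have "d - 1 - (d - 1 - i) = i" "d - 1 - i < d" if "i < d" using that by auto
    moreover have "c i = 0" if "d \<le> i" using that \<open>c \<in> ?X\<close> by (auto simp: box_partitions_def partitions_def)
    ultimately show "?k (?k c) i = c i" by (auto simp: box_complement_def)
  qed
  have "sum_dual d n \<le> (\<Sum>c\<in>?X. ((?f c)\<^sup>2 + (?f (?k c))\<^sup>2) / 2)"
    unfolding sum_dual_def
  proof (rule sum_mono)
    fix c show "?f c * ?f (?k c) \<le> ((?f c)\<^sup>2 + (?f (?k c))\<^sup>2) / 2"
      using sum_squares_bound[of "?f c" "?f (?k c)"] by simp
  qed
  also have "\<dots> = ((\<Sum>c\<in>?X. (?f c)\<^sup>2) + (\<Sum>c\<in>?X. (?f (?k c))\<^sup>2)) / 2"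
    by (simp add: sum.distrib flip: sum_divide_distrib)
  also have "(\<Sum>c\<in>?X. (?f (?k c))\<^sup>2) = (\<Sum>c\<in>?X. (?f c)\<^sup>2)"
    by (rule sum.reindex_bij_witness[of _ ?k ?k]) (use kX kk in auto)
  also have "((\<Sum>c\<in>?X. (?f c)\<^sup>2) + (\<Sum>c\<in>?X. (?f c)\<^sup>2)) / 2 = (\<Sum>c\<in>?X. (?f c)\<^sup>2)" by simp
  also have "\<dots> \<le> sum_squares d n"
    unfolding sum_squares_def by (rule sum_mono2) (auto simp: finite_partitions box_partitions_def)
  finally show ?thesis .
qed

text \<open>Only the shapes in \<open>G\<close> are kept. They lose at most the reflection factor
  \<open>\<epsilon>\<close> each, and the discarded shapes are few and individually small compared
  with one term of \<open>sum_squares d n\<close>.\<close>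

lemma sum_dual_ge:
  assumes d: "0 < d" and s: "1 \<le> s" "s < n"
    and \<delta>: "(2 * real s + real d) ^ 3 / (2 * real n + real d)\<^sup>2 \<le> 1"
  shows "sum_dual d n \<ge> (1 - (2 * real s + real d) ^ 3 / (2 * real n + real d)\<^sup>2) ^ d *
    (1 - (real d * real n + 1) ^ d * ((real n + real d) ^ (d * d) * exp (- (real s * (real s - 1) / (4 * real n))))\<^sup>2)
    * sum_squares d n"
proof -
  let ?P = "partitions d (d * n)" and ?f = "\<lambda>c. real (card (ballots c))"
  let ?k = "box_complement d (2 * n)"
  define \<epsilon> where "\<epsilon> = (1 - (2 * real s + real d) ^ 3 / (2 * real n + real d)\<^sup>2) ^ d"
  define \<tau> where "\<tau> = (real n + real d) ^ (d * d) * exp (- (real s * (real s - 1) / (4 * real n)))"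
  define G where "G = {c \<in> ?P. \<forall>i<d. c i < n + s \<and> n < c i + s}"
  have \<epsilon>: "0 \<le> \<epsilon>" using \<delta> by (simp add: \<epsilon>_def)
  have \<tau>: "0 \<le> \<tau>" by (simp add: \<tau>_def)
  have GP: "G \<subseteq> ?P" by (auto simp: G_def)
  have near: "c \<in> box_partitions d (2 * n) (d * n)" "?f c * \<epsilon> \<le> ?f (?k c)" if "c \<in> G" for c
    using card_ballots_near[OF s(2) _ _ d \<delta>, of c] that by (auto simp: G_def \<epsilon>_def)
  have "(\<Sum>c\<in>?P - G. (?f c)\<^sup>2) \<le> real (card (?P - G)) * (?f (rect d n) * \<tau>)\<^sup>2"
  proof (rule sum_bounded_above)
    fix c assume c: "c \<in> ?P - G"
    then obtain i where i: "i < d" "n + s \<le> c i \<or> c i + s \<le> n" by (auto simp: G_def not_less)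
    have "?f c \<le> ?f (rect d n) * \<tau>"
      unfolding \<tau>_def using card_ballots_far[of d n s c i] d c s i by auto
    then show "(?f c)\<^sup>2 \<le> (?f (rect d n) * \<tau>)\<^sup>2" by (intro power_mono) auto
  qed
  also have "\<dots> \<le> (real d * real n + 1) ^ d * (?f (rect d n) * \<tau>)\<^sup>2"
  proof (rule mult_right_mono)
    have "card (?P - G) \<le> card ?P" by (intro card_mono finite_partitions) auto
    also have "\<dots> \<le> (d * n + 1) ^ d" by (rule card_partitions_le)
    finally have "real (card (?P - G)) \<le> real ((d * n + 1) ^ d)" by (simp only: of_nat_le_iff)
    then show "real (card (?P - G)) \<le> (real d * real n + 1) ^ d" by (simp add: add.commute)
  qed simp
  also have "\<dots> = (real d * real n + 1) ^ d * \<tau>\<^sup>2 * (?f (rect d n))\<^sup>2" by (simp add: power_mult_distrib)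
  also have "\<dots> \<le> (real d * real n + 1) ^ d * \<tau>\<^sup>2 * sum_squares d n"
  proof (rule mult_left_mono)
    \<comment> \<open>The rectangle with \<open>n\<close> columns is a summand, so the tail becomes
      a multiple of the whole sum.\<close>
    show "(?f (rect d n))\<^sup>2 \<le> sum_squares d n"
      unfolding sum_squares_def by (rule member_le_sum[OF rect_partition]) (auto simp: finite_partitions)
  qed simp
  finally have tail: "(\<Sum>c\<in>?P - G. (?f c)\<^sup>2) \<le> (real d * real n + 1) ^ d * \<tau>\<^sup>2 * sum_squares d n" .
  have "sum_squares d n = (\<Sum>c\<in>?P - G. (?f c)\<^sup>2) + (\<Sum>c\<in>G. (?f c)\<^sup>2)"
    unfolding sum_squares_def by (rule sum.subset_diff[OF GP finite_partitions])
  then have "(1 - (real d * real n + 1) ^ d * \<tau>\<^sup>2) * sum_squares d n \<le> (\<Sum>c\<in>G. (?f c)\<^sup>2)"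
    using tail by (simp add: algebra_simps)
  then have "\<epsilon> * ((1 - (real d * real n + 1) ^ d * \<tau>\<^sup>2) * sum_squares d n) \<le> \<epsilon> * (\<Sum>c\<in>G. (?f c)\<^sup>2)"
    using \<epsilon> by (rule mult_left_mono)
  also have "\<dots> = (\<Sum>c\<in>G. ?f c * (?f c * \<epsilon>))"
    by (simp add: sum_distrib_left power2_eq_square mult_ac)
  also have "\<dots> \<le> (\<Sum>c\<in>G. ?f c * ?f (?k c))"
    using near by (intro sum_mono mult_left_mono) auto
  also have "\<dots> \<le> sum_dual d n"
    unfolding sum_dual_def
    by (rule sum_mono2) (use near in \<open>auto simp: box_partitions_def finite_partitions\<close>)
  finally show ?thesis by (simp add: \<epsilon>_def \<tau>_def mult.assoc)
qed

lemma sum_dual_ratio_tendsto: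
  assumes d: "0 < d"
  shows "(\<lambda>n. sum_dual d n / sum_squares d n) \<longlonglongrightarrow> 1"
proof -
  define p where "p n = real n powr (3/5)" for n :: nat
  \<comment> \<open>Rounding \<open>n^(3/5)\<close> down gives
    \<open>p n - 1 \<le> s n \<le> p n\<close>. The upper estimate controls the reflection error and
    the lower one the tail, hence \<open>(p n - 1) * (p n - 2)\<close> in \<open>T\<close>.\<close>
  define s where "s n = nat \<lfloor>p n\<rfloor>" for n
  define \<delta> where "\<delta> n = (2 * p n + real d) ^ 3 / (2 * real n + real d)\<^sup>2" for n
  define T where "T n = (real d * real n + 1) ^ d * ((real n + real d) ^ (d * d) * exp (- ((p n - 1) * (p n - 2) / (4 * real n))))\<^sup>2" for n
  have \<delta>0: "\<delta> \<longlonglongrightarrow> 0" unfolding \<delta>_def p_def by (rule limit_bulk)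
  have T0: "T \<longlonglongrightarrow> 0" unfolding T_def p_def by (rule limit_tail)
  have L: "(\<lambda>n. (1 - \<delta> n) ^ d * (1 - T n)) \<longlonglongrightarrow> (1 - 0) ^ d * (1 - 0)"
    by (intro tendsto_intros \<delta>0 T0)
  have "\<forall>\<^sub>F n in sequentially. 2 \<le> p n" unfolding p_def by real_asymp
  moreover have "\<forall>\<^sub>F n in sequentially. p n < real n" unfolding p_def by real_asymp
  moreover have "\<forall>\<^sub>F n in sequentially. \<delta> n < 1" by (rule order_tendstoD(2)[OF \<delta>0]) simp
  moreover have "\<forall>\<^sub>F n in sequentially. T n < 1" by (rule order_tendstoD(2)[OF T0]) simp
  ultimately have low: "\<forall>\<^sub>F n in sequentially. (1 - \<delta> n) ^ d * (1 - T n) \<le> sum_dual d n / sum_squares d n"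
  proof eventually_elim
    case (elim n)
    have s: "real (s n) \<le> p n" "p n - 1 \<le> real (s n)"
      using elim(1) unfolding s_def by linarith+
    then have s': "1 \<le> s n" "s n < n" using elim by linarith+
    let ?\<delta> = "(2 * real (s n) + real d) ^ 3 / (2 * real n + real d)\<^sup>2"
    let ?T = "(real d * real n + 1) ^ d * ((real n + real d) ^ (d * d) * exp (- (real (s n) * (real (s n) - 1) / (4 * real n))))\<^sup>2"
    have \<delta>: "?\<delta> \<le> \<delta> n"
      unfolding \<delta>_def using s by (intro divide_right_mono power_mono) auto
    have "(p n - 1) * (p n - 2) \<le> real (s n) * (real (s n) - 1)"
      using s elim(1) by (intro mult_mono) auto
    then have T: "?T \<le> T n"
      unfolding T_def by (intro mult_left_mono power_mono) (auto intro!: divide_right_mono)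
    have "(1 - \<delta> n) ^ d * (1 - T n) \<le> (1 - ?\<delta>) ^ d * (1 - ?T)"
    proof (intro mult_mono power_mono)
      show "0 \<le> (1 - ?\<delta>) ^ d" using elim \<delta> by (intro zero_le_power) linarith
    qed (use elim \<delta> T in linarith)+
    then have "(1 - \<delta> n) ^ d * (1 - T n) * sum_squares d n \<le> (1 - ?\<delta>) ^ d * (1 - ?T) * sum_squares d n"
      using sum_squares_pos[of d n] by (intro mult_right_mono) auto
    also have "\<dots> \<le> sum_dual d n" by (rule sum_dual_ge[OF d s']) (use \<delta> elim in linarith)
    finally show ?case using sum_squares_pos[of d n] by (simp add: pos_le_divide_eq)
  qed
  have up: "\<forall>\<^sub>F n in sequentially. sum_dual d n / sum_squares d n \<le> 1"
    using sum_dual_le sum_squares_pos by (intro always_eventually allI) (simp add: divide_le_eq_1)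
  show ?thesis
    by (rule tendsto_sandwich[OF low up]) (use L in simp_all)
qed

theorem theorem3:
  fixes d :: nat
  assumes "d \<ge> 2"
  shows "(\<lambda>n. real (card (perms_no_decreasing (d * n) (d + 1)))
              / real (card (involutions_longest (2 * d * n) d (2 * n)))) \<longlonglongrightarrow> 1"
proof -
  have d: "0 < d" using assms by simp
  have P: "real (card (perms_no_decreasing (d * n) (d + 1))) = sum_squares d n" for n
    using card_perms_no_decreasing[of "d * n" d] by (simp add: sum_squares_def)
  \<comment> \<open>For \<open>n = 0\<close> there is no such involution, since the empty word has
    no decreasing subsequence of length \<open>d\<close>, while \<open>sum_dual d 0\<close> is
    1.\<close>
  have I: "real (card (involutions_longest (2 * d * n) d (2 * n))) = sum_dual d n" if "0 < n" for n
  proof -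
    have e: "2 * d * n = d * (2 * n)" by simp
    have "card (involutions_longest (2 * d * n) d (2 * n)) = card (ballots (rect d (2 * n)))"
      unfolding e by (rule card_involutions_longest) (use d that in auto)
    also have "\<dots> = (\<Sum>c\<in>box_partitions d (2 * n) (d * n). card (ballots c) * card (ballots (box_complement d (2 * n) c)))"
      by (rule card_ballots_rect[OF d]) simp
    finally show ?thesis by (simp add: sum_dual_def)
  qed
  have "(\<lambda>n. inverse (sum_dual d n / sum_squares d n)) \<longlonglongrightarrow> inverse 1"
    by (intro tendsto_inverse sum_dual_ratio_tendsto d) simp
  moreover have "\<forall>\<^sub>F n in sequentially. inverse (sum_dual d n / sum_squares d n) =
      real (card (perms_no_decreasing (d * n) (d + 1))) / real (card (involutions_longest (2 * d * n) d (2 * n)))"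
    using eventually_gt_at_top[of 0] by eventually_elim (simp only: P I inverse_divide)
  ultimately show ?thesis by (simp add: filterlim_cong)
qed

end
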